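(* Let $\Gamma$ be a countable group, let $\varphi_o:\Gamma\to\mathbb{R}$ be a quasimorphism with $\varphi_o(e)=0$, and let $p$ be a symmetric probability measure on $\Gamma$ whose support generates $\Gamma$ and such that $\varphi_o$ is $p$-integrable. If $\varphi_o$ is not at bounded distance from a homomorphism $\Gamma\to\mathbb{R}$, then the following hold: (i) Every $p$-stationary probability measure on $\mathcal{L}_p(\varphi_o)$ is supported on $\mathcal{C}_p(\varphi_o)$. (ii) $\mathcal{C}_p(\varphi_o)$ admits a unique $p$-stationary probability measure $\nu_{\varphi_o}$. (iii) $(\mathcal{C}_p(\varphi_o),\nu_{\varphi_o})$ is a non-trivial $(\Gamma,p)$-boundary. (iv) If $\nu$ is any $p$-stationary probability measure on $\Delta_{\varphi_o}$, then there exists a measure-preserving, $\nu$-measurable, $\nu$-almost everywhere $\Gamma$-equivariant map $(\Delta_{\varphi_o},\nu)\to(\mathcal{C}_p(\varphi_o),\nu_{\varphi_o})$.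
   Context: $\varphi:\Gamma\to\mathbb{R}$ is a quasimorphism if $\sup_{g,h}|\varphi(gh)-\varphi(g)-\varphi(h)|<\infty$. Functions are at bounded distance if their difference is bounded. $\varphi_o$ is $p$-integrable if $\sum_\gamma p(\gamma)|\varphi_o(\gamma)|<\infty$. $\mathscr{F}_o(\Gamma):=\{\varphi\in\mathbb{R}^\Gamma\mid\varphi(e)=0\}$ carries the product topology and the continuous $\Gamma$-action $(\gamma.\varphi)(\gamma')=\varphi(\gamma'\gamma)-\varphi(\gamma)$; $\Delta_\varphi$ denotes the closure of the $\Gamma$-orbit of $\varphi$ in $\mathscr{F}_o(\Gamma)$. $\mathcal{L}_p(\varphi_o):=\{\psi\in\mathscr{F}_o(\Gamma)\mid p*\psi=\psi,\ \|\psi-\varphi_o\|_\infty<\infty\}$, where $(p*\psi)(\gamma)=\sum_{\gamma'}p(\gamma')\psi(\gamma'^{-1}\gamma)$; this is a $\Gamma$-invariant set, containing $\Delta_\psi$ for each of its elements $\psi$. The left-$p$-harmonic core of $\varphi_o$ is $\mathcal{C}_p(\varphi_o):=\bigcap_{\psi\in\mathcal{L}_p(\varphi_o)}\Delta_\psi$. A Borel probability measure $\nu$ on a $\Gamma$-space is $p$-stationary if $p*\nu=\nu$. The Poisson boundary of $(\Gamma,p)$ is the ergodic $p$-stationary $\Gamma$-space $(B,m)$, unique up to measure-preserving $\Gamma$-isomorphism, such that: (i) $f\mapsto\big(\gamma\mapsto\int_B f(\gamma.b)\,dm(b)\big)$ is a surjective isometry $\mathscr{P}_m$ from $L^\infty(B,m)$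 onto the bounded right-$p$-harmonic functions on $\Gamma$ (those $h$ with $h*p=h$); (ii) for every countable $\mathcal{A}\subset L^\infty(B,m)$ there are a $p^{\otimes\mathbb{N}}$-conull Borel set $\Omega\subset\Gamma^{\mathbb{N}}$ and a Borel map $Z_\infty:\Omega\to B$ with $(Z_\infty)_*p^{\otimes\mathbb{N}}=m$ and $\lim_n\mathscr{P}_mf(\omega_1\cdots\omega_n)=f(Z_\infty(\omega))$ for all $\omega\in\Omega$, $f\in\mathcal{A}$. A $(\Gamma,p)$-boundary is a pair $(B',\pi_*m)$ with $\pi:B\to B'$ a $\Gamma$-equivariant Borel map to a standard Borel $\Gamma$-space; it is trivial if $\pi_*m$ is a point mass at a $\Gamma$-fixed point, and non-trivial otherwise. *)

theory Defs
  imports "HOL-Probability.Probability"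
begin

text \<open>
  Groups are types of class \<^class>\<open>group_add\<close>: the group law is written
  additively (identity \<open>0\<close>, inverse \<open>- g\<close>), but it is not assumed to be
  commutative. A probability measure on the countable group is a \<^typ>\<open>'g pmf\<close>.
\<close>

definition quasimorphism :: "('g::group_add \<Rightarrow> real) \<Rightarrow> bool" where
  "quasimorphism \<phi> \<longleftrightarrow> bdd_above (range (\<lambda>(g, h). \<bar>\<phi> (g + h) - \<phi> g - \<phi> h\<bar>))"

definition real_hom :: "('g::group_add \<Rightarrow> real) \<Rightarrow> bool" where
  "real_hom f \<longleftrightarrow> (\<forall>g h. f (g + h) = f g + f h)"

definition bounded_distance :: "('g \<Rightarrow> real) \<Rightarrow> ('g \<Rightarrow> real) \<Rightarrow> bool" where
  "bounded_distance \<phi> \<psi> \<longleftrightarrow> bounded (range (\<lambda>g. \<phi> g - \<psi> g))"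

definition p_integrable :: "'g pmf \<Rightarrow> ('g \<Rightarrow> real) \<Rightarrow> bool" where
  "p_integrable p \<phi> \<longleftrightarrow> (\<lambda>g. pmf p g * \<bar>\<phi> g\<bar>) summable_on UNIV"

definition symmetric_pmf :: "'g::group_add pmf \<Rightarrow> bool" where
  "symmetric_pmf p \<longleftrightarrow> (\<forall>g. pmf p (- g) = pmf p g)"

definition is_subgroup :: "'g::group_add set \<Rightarrow> bool" where
  "is_subgroup H \<longleftrightarrow> 0 \<in> H \<and> (\<forall>x\<in>H. \<forall>y\<in>H. x + y \<in> H) \<and> (\<forall>x\<in>H. - x \<in> H)"

definition generates_group :: "'g::group_add set \<Rightarrow> bool" where
  "generates_group S \<longleftrightarrow> is_subgroup hull S = UNIV"

text \<open>
  Convolution. With \<open>f = pmf p\<close> it is the left convolution by \<open>p\<close>, with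
  \<open>h = pmf p\<close> the right convolution by \<open>p\<close>.
\<close>

definition conv :: "('g::group_add \<Rightarrow> real) \<Rightarrow> ('g \<Rightarrow> real) \<Rightarrow> 'g \<Rightarrow> real" where
  "conv f h g = (\<Sum>\<^sub>\<infinity>x. f x * h (- x + g))"

text \<open>
  The type \<^typ>\<open>'g \<Rightarrow> real\<close> carries the product topology. The map \<open>act0\<close> is
  an action only on the closed subspace \<open>F0\<close>, as \<open>act0 0 \<phi> = \<phi>\<close> requires
  \<open>\<phi> 0 = 0\<close>. Since \<open>F0\<close> is closed, the closure of an orbit in \<open>F0\<close> is its closure
  in the full function space.
\<close>

definition F0 :: "('g::group_add \<Rightarrow> real) set" where
  "F0 = {\<phi>. \<phi> 0 = 0}"

definition act0 :: "'g::group_add \<Rightarrow> ('g \<Rightarrow> real) \<Rightarrow> 'g \<Rightarrow> real" where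
  "act0 \<gamma> \<phi> = (\<lambda>g. \<phi> (g + \<gamma>) - \<phi> \<gamma>)"

definition orbit_closure :: "('g::group_add \<Rightarrow> real) \<Rightarrow> ('g \<Rightarrow> real) set" where
  "orbit_closure \<phi> = closure (range (\<lambda>\<gamma>. act0 \<gamma> \<phi>))"

definition harmonic_set :: "'g::group_add pmf \<Rightarrow> ('g \<Rightarrow> real) \<Rightarrow> ('g \<Rightarrow> real) set" where
  "harmonic_set p \<phi> = {\<psi> \<in> F0. conv (pmf p) \<psi> = \<psi> \<and> bounded_distance \<psi> \<phi>}"

definition harmonic_core :: "'g::group_add pmf \<Rightarrow> ('g \<Rightarrow> real) \<Rightarrow> ('g \<Rightarrow> real) set" where
  "harmonic_core p \<phi> = (\<Inter>\<psi>\<in>harmonic_set p \<phi>. orbit_closure \<psi>)"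

definition measurable_action :: "('g::group_add \<Rightarrow> 'b \<Rightarrow> 'b) \<Rightarrow> 'b measure \<Rightarrow> bool" where
  "measurable_action a M \<longleftrightarrow>
     (\<forall>\<gamma>. a \<gamma> \<in> measurable M M) \<and>
     (\<forall>x\<in>space M. a 0 x = x) \<and>
     (\<forall>\<gamma> \<delta>. \<forall>x\<in>space M. a (\<gamma> + \<delta>) x = a \<gamma> (a \<delta> x))"

text \<open>Only the measurable structure of \<open>M\<close> matters here.\<close>

definition standard_borel :: "'b measure \<Rightarrow> bool" where
  "standard_borel M \<longleftrightarrow>
     (\<exists>T. completely_metrizable_space T \<and> second_countable T \<and> topspace T = space M \<and>
          sets M = sigma_sets (topspace T) {U. openin T U})"

definition stationary :: "'g::group_add pmf \<Rightarrow> ('g \<Rightarrow> 'b \<Rightarrow> 'b) \<Rightarrow> 'b measure \<Rightarrow> bool" where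
  "stationary p a \<nu> \<longleftrightarrow>
     prob_space \<nu> \<and> measurable_action a \<nu> \<and>
     (\<forall>A\<in>sets \<nu>. measure \<nu> A = (\<Sum>\<^sub>\<infinity>\<gamma>. pmf p \<gamma> * measure \<nu> (a \<gamma> -` A \<inter> space \<nu>)))"

definition stationary_on ::
    "'g::group_add pmf \<Rightarrow> ('g \<Rightarrow> real) set \<Rightarrow> ('g \<Rightarrow> real) measure \<Rightarrow> bool" where
  "stationary_on p X \<nu> \<longleftrightarrow> sets \<nu> = sets (restrict_space borel X) \<and> stationary p act0 \<nu>"

text \<open>Meaningful only when the stationary probability measure on the core is unique.\<close>

definition core_measure :: "'g::group_add pmf \<Rightarrow> ('g \<Rightarrow> real) \<Rightarrow> ('g \<Rightarrow> real) measure" where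
  "core_measure p \<phi> = (THE \<nu>. stationary_on p (harmonic_core p \<phi>) \<nu>)"

definition ergodic_action :: "('g::group_add \<Rightarrow> 'b \<Rightarrow> 'b) \<Rightarrow> 'b measure \<Rightarrow> bool" where
  "ergodic_action a m \<longleftrightarrow>
     (\<forall>A\<in>sets m. (\<forall>\<gamma>. a \<gamma> -` A \<inter> space m = A) \<longrightarrow> measure m A = 0 \<or> measure m A = 1)"

text \<open>
  Elements of \<open>L\<^sup>\<infinity>\<close> are represented by essentially bounded measurable functions.
  The transform of such a function depends only on its class modulo null sets,
  because the translates of a stationary measure by the support of \<open>p\<close>, hence by
  the group it generates, are absolutely continuous when \<open>p\<close> is symmetric.
\<close>

definition Linf_space :: "'b measure \<Rightarrow> ('b \<Rightarrow> real) set" where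
  "Linf_space m = {f \<in> borel_measurable m. esssup m (\<lambda>x. ereal \<bar>f x\<bar>) < \<infinity>}"

definition poisson_transform ::
    "('g \<Rightarrow> 'b \<Rightarrow> 'b) \<Rightarrow> 'b measure \<Rightarrow> ('b \<Rightarrow> real) \<Rightarrow> 'g \<Rightarrow> real" where
  "poisson_transform a m f \<gamma> = (\<integral>b. f (a \<gamma> b) \<partial>m)"

definition bounded_right_harmonic :: "'g::group_add pmf \<Rightarrow> ('g \<Rightarrow> real) set" where
  "bounded_right_harmonic p = {h. bounded (range h) \<and> conv h (pmf p) = h}"

definition increments_measure :: "'g pmf \<Rightarrow> (nat \<Rightarrow> 'g) measure" where
  "increments_measure p = PiM UNIV (\<lambda>_. measure_pmf p)"

text \<open>
  The \<open>n\<close>-th position of the random walk with increments \<open>\<omega>\<close> is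
  \<open>sum_list (map \<omega> [0..<n])\<close>, i.e. the ordered product of the first \<open>n\<close> increments.
  As the transform is linear, preserving the norm makes it isometric.
\<close>

definition poisson_boundary ::
    "'g::group_add pmf \<Rightarrow> ('g \<Rightarrow> 'b \<Rightarrow> 'b) \<Rightarrow> 'b measure \<Rightarrow> bool" where
  "poisson_boundary p a m \<longleftrightarrow>
     standard_borel m \<and> stationary p a m \<and> ergodic_action a m \<and>
     poisson_transform a m ` Linf_space m = bounded_right_harmonic p \<and>
     (\<forall>f\<in>Linf_space m.
        (SUP \<gamma>. ereal \<bar>poisson_transform a m f \<gamma>\<bar>) = esssup m (\<lambda>x. ereal \<bar>f x\<bar>)) \<and>
     (\<forall>\<A>\<subseteq>Linf_space m. countable \<A> \<longrightarrow>
        (\<exists>\<Omega> Z. \<Omega> \<in> sets (increments_measure p) \<and> measure (increments_measure p) \<Omega> = 1 \<and>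
           Z \<in> measurable (restrict_space (increments_measure p) \<Omega>) m \<and>
           distr (restrict_space (increments_measure p) \<Omega>) m Z = m \<and>
           (\<forall>\<omega>\<in>\<Omega>. \<forall>f\<in>\<A>.
              (\<lambda>n. poisson_transform a m f (sum_list (map \<omega> [0..<n]))) \<longlonglongrightarrow> f (Z \<omega>))))"

text \<open>
  \<open>(M, a')\<close> is an equivariant Borel image of the Poisson boundary. The Poisson
  boundary is only defined up to isomorphism modulo null sets, so the property is
  required of every model \<open>m\<close> on the type \<^typ>\<open>'b\<close>, and the factor map is defined on
  an invariant conull Borel set \<open>B0\<close>, which is a model itself. Equivariance on all of
  \<open>space m\<close> would depend on the model: adjoining to \<open>m\<close> a null fixed point yields another
  model, which has no equivariant map to a space without fixed points.
\<close>

definition Gp_boundary ::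
    "'b itself \<Rightarrow> 'g::group_add pmf \<Rightarrow> ('g \<Rightarrow> 'c \<Rightarrow> 'c) \<Rightarrow> 'c measure \<Rightarrow> bool" where
  "Gp_boundary TYPE('b) p a' M \<longleftrightarrow>
     standard_borel M \<and> measurable_action a' M \<and>
     (\<forall>(m :: 'b measure) a. poisson_boundary p a m \<longrightarrow>
        (\<exists>B0 \<pi>. B0 \<in> sets m \<and> measure m B0 = 1 \<and> (\<forall>\<gamma>. \<forall>b\<in>B0. a \<gamma> b \<in> B0) \<and>
           \<pi> \<in> measurable (restrict_space m B0) M \<and>
           (\<forall>\<gamma>. \<forall>b\<in>B0. \<pi> (a \<gamma> b) = a' \<gamma> (\<pi> b)) \<and>
           distr (restrict_space m B0) M \<pi> = M))"

definition trivial_boundary :: "('g \<Rightarrow> 'c \<Rightarrow> 'c) \<Rightarrow> 'c measure \<Rightarrow> bool" where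
  "trivial_boundary a' M \<longleftrightarrow> (\<exists>x\<in>space M. (\<forall>\<gamma>. a' \<gamma> x = x) \<and> M = return M x)"

text \<open>A \<open>\<nu>\<close>-measurable map is one that is measurable for the completion of \<open>\<nu>\<close>.\<close>

definition ae_factor_map ::
    "('g \<Rightarrow> 'b \<Rightarrow> 'b) \<Rightarrow> 'b measure \<Rightarrow> ('g \<Rightarrow> 'c \<Rightarrow> 'c) \<Rightarrow> 'c measure \<Rightarrow> ('b \<Rightarrow> 'c) \<Rightarrow> bool" where
  "ae_factor_map a \<nu> a' M \<pi> \<longleftrightarrow>
     \<pi> \<in> measurable (completion \<nu>) M \<and>
     distr (completion \<nu>) M \<pi> = M \<and>
     (AE x in \<nu>. \<forall>\<gamma>. \<pi> (a \<gamma> x) = a' \<gamma> (\<pi> x))"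

end

theory Submission
  imports Defs
begin

text \<open>
  Let \<open>w n\<close> be the law of the random walk with step law \<open>p\<close> after \<open>n\<close> steps (\<open>walk p n\<close>),
  and write \<open>x.\<phi>\<close> for \<open>act0 x \<phi>\<close>. Everything rests on the comparison of orbits and on
  second moments; no compactness of spaces of measures is used.

  Contraction. Two elements \<open>\<phi>\<close>, \<open>\<psi>\<close> of the harmonic set differ by a bounded left-harmonic
  function \<open>b\<close>. The second moments of \<open>b\<close> under \<open>w n\<close> increase with \<open>n\<close> and are bounded,
  and their increments are the mean square variations of \<open>b\<close> under one more step, so these
  tend to \<open>0\<close> (\<open>harmonic_increment\<close>). As the support of \<open>p\<close> generates the group, the mean
  distance between \<open>x.\<phi>\<close> and \<open>x.\<psi>\<close> under \<open>w n\<close> tends to \<open>0\<close> (\<open>harmonic_set_contraction\<close>).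
  Let \<open>\<nu>\<close> be a stationary measure on the harmonic set, \<open>\<psi>\<close> an element of this set and \<open>F\<close>
  a bounded Lipschitz function. The integral of \<open>F\<close> is the mean over \<open>x\<close> and \<open>\<phi>\<close> of
  \<open>F (x.\<phi>)\<close>, so it is the limit of the means of \<open>F (x.\<psi>)\<close> under \<open>w n\<close>
  (\<open>stationary_lipschitz_limit\<close>). Hence \<open>\<nu>\<close> is unique, and taking for \<open>F\<close> the truncated
  distance to the orbit closure of \<open>\<psi>\<close> shows that it charges only this closure. By the
  Lindelof property it is carried by the core.

  Harmonic correction. For \<open>\<phi>\<close> near \<open>\<phi>o\<close> the means \<open>c n\<close> of \<open>\<phi>\<close> under \<open>w n\<close> are bounded,
  because \<open>w n\<close> is symmetric and a quasimorphism is odd up to a bounded error. They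
  satisfy \<open>c (n + 1) = c 1 + P (c n)\<close> for the averaging operator \<open>P\<close> of the action, so
  their upper limit \<open>S\<close> satisfies \<open>S \<le> c 1 + P S\<close>; integrating against a stationary
  measure forces equality almost everywhere (\<open>stationary_cohomological_equation\<close>). Then
  \<open>\<phi> g + S (g.\<phi>) - S \<phi>\<close>, as a function of \<open>g\<close>, is left-harmonic and depends equivariantly
  on \<open>\<phi>\<close>. So every stationary space with an equivariant map to functions near \<open>\<phi>o\<close> has an
  equivariant map to the core, defined almost everywhere, and uniqueness identifies the
  image of its measure (\<open>factor_onto_core\<close>). The orbit closure of \<open>\<phi>o\<close> is one such space.

  Existence and the Poisson boundary. Averaging \<open>\<phi>o\<close> along the walk gives a function \<open>\<psi>\<close>
  near \<open>\<phi>o\<close> that is right-harmonic. Each function \<open>y \<mapsto> \<psi> (g + y) - \<psi> y\<close> is then bounded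
  and right-harmonic. Along the paths of the walk these functions are bounded martingales,
  so \<open>z.\<psi>\<close>, with \<open>z\<close> the position of the walk, converges almost surely along a subsequence
  of times; the law of the limit is stationary, and the harmonic correction moves it to
  the core. On a Poisson boundary the same functions are transforms of bounded functions
  \<open>F g\<close>, and \<open>b \<mapsto> (\<lambda>g. F g b)\<close> is almost everywhere an equivariant map to functions near
  \<open>\<phi>o\<close>. The boundary is not trivial, since a fixed point in the core is a homomorphism at
  bounded distance from \<open>\<phi>o\<close>.
\<close>

section \<open>Expectations under a probability mass function\<close>

lemma measure_pmf_pair:
  fixes A :: "'a::countable pmf" and B :: "'b::countable pmf"
  shows "measure_pmf A \<Otimes>\<^sub>M measure_pmf B = measure_pmf (pair_pmf A B)"
proof (rule pair_measure_eqI)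
  show "sigma_finite_measure (measure_pmf A)" "sigma_finite_measure (measure_pmf B)"
    by (auto intro: prob_space_imp_sigma_finite measure_pmf.prob_space_axioms)
  show "sets (measure_pmf A \<Otimes>\<^sub>M measure_pmf B) = sets (measure_pmf (pair_pmf A B))"
  proof -
    have "sets (measure_pmf A \<Otimes>\<^sub>M measure_pmf B) = sets (count_space (UNIV::'a set) \<Otimes>\<^sub>M count_space (UNIV::'b set))"
      by (rule sets_pair_measure_cong) simp_all
    also have "\<dots> = UNIV"
      by (subst pair_measure_countable) auto
    finally show ?thesis by simp
  qed
next
  fix X Y assume "X \<in> sets (measure_pmf A)" "Y \<in> sets (measure_pmf B)"
  have "emeasure (pair_pmf A B) (X \<times> Y) = (\<integral>\<^sup>+ x. indicator (X \<times> Y) x \<partial>pair_pmf A B)"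
    by simp
  also have "\<dots> = (\<integral>\<^sup>+ a. \<integral>\<^sup>+ b. indicator X a * indicator Y b \<partial>B \<partial>A)"
    by (simp add: nn_integral_pair_pmf' indicator_times)
  also have "\<dots> = emeasure A X * emeasure B Y"
    by (simp add: nn_integral_cmult nn_integral_multc)
  finally show "emeasure A X * emeasure B Y = emeasure (pair_pmf A B) (X \<times> Y)" ..
qed

lemma integral_pair_pmf:
  fixes A :: "'a::countable pmf" and B :: "'b::countable pmf" and f :: "'a \<times> 'b \<Rightarrow> real"
  assumes "integrable (pair_pmf A B) f"
  shows "(\<integral>z. f z \<partial>pair_pmf A B) = (\<integral>x. \<integral>y. f (x, y) \<partial>B \<partial>A)"
    and "integrable A (\<lambda>x. \<integral>y. f (x, y) \<partial>B)"
proof -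
  interpret pair_sigma_finite "measure_pmf A" "measure_pmf B"
    by (intro pair_sigma_finite.intro prob_space_imp_sigma_finite measure_pmf.prob_space_axioms)
  note f = assms[folded measure_pmf_pair]
  show "(\<integral>z. f z \<partial>pair_pmf A B) = (\<integral>x. \<integral>y. f (x, y) \<partial>B \<partial>A)"
    using integral_fst[of "\<lambda>x y. f (x, y)"] f by (simp add: measure_pmf_pair)
  show "integrable A (\<lambda>x. \<integral>y. f (x, y) \<partial>B)"
    using integrable_fst[of "\<lambda>x y. f (x, y)"] f by simp
qed

text \<open>No summability is needed: both sides are \<open>0\<close> when the function is not integrable.\<close>

lemma infsum_pmf_eq_integral:
  fixes f :: "'a::countable \<Rightarrow> real"
  shows "(\<Sum>\<^sub>\<infinity>x. pmf p x * f x) = (\<integral>x. f x \<partial>measure_pmf p)"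
proof -
  have i: "(\<integral>x. f x \<partial>measure_pmf p) = (\<integral>x. pmf p x * f x \<partial>count_space UNIV)"
    by (subst measure_pmf_eq_density) (simp add: integral_density)
  have iff: "(\<lambda>x. pmf p x * f x) summable_on UNIV \<longleftrightarrow> integrable (count_space UNIV) (\<lambda>x. pmf p x * f x)"
    unfolding summable_on_iff_abs_summable_on_real[of "\<lambda>x. pmf p x * f x"]
      abs_summable_equivalent Infinite_Set_Sum.abs_summable_on_def ..
  show ?thesis
  proof (cases "integrable (count_space UNIV) (\<lambda>x. pmf p x * f x)")
    case True
    then have "Infinite_Set_Sum.abs_summable_on (\<lambda>x. pmf p x * f x) UNIV"
      by (simp only: Infinite_Set_Sum.abs_summable_on_def)
    then show ?thesis
      by (simp add: i infsetsum_infsum[symmetric] infsetsum_def)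
  next
    case False
    then show ?thesis
      using iff by (simp add: i infsum_not_exists not_integrable_integral_eq)
  qed
qed

section \<open>The laws of the random walk\<close>

text \<open>The law of the position after \<open>n\<close> steps. A step is added on the left; as the steps are
  independent with the same law, adding it on the right gives the same law (\<open>walk_Suc_right\<close>).\<close>

primrec walk :: "'g::{group_add,countable} pmf \<Rightarrow> nat \<Rightarrow> 'g pmf" where
  "walk p 0 = return_pmf 0"
| "walk p (Suc n) = map_pmf (\<lambda>(x, y). x + y) (pair_pmf p (walk p n))"

lemma walk_Suc_right: "walk p (Suc n) = map_pmf (\<lambda>(y, x). y + x) (pair_pmf (walk p n) p)"
proof (induction n)
  case 0
  show ?case
    by (simp add: pair_pmf_def map_bind_pmf bind_assoc_pmf bind_return_pmf)
next
  case (Suc n)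
  have "walk p (Suc (Suc n)) = map_pmf (\<lambda>(x, y). x + y) (pair_pmf p (walk p (Suc n)))"
    by simp
  also have "\<dots> = map_pmf (\<lambda>(x, y). x + y) (pair_pmf p (map_pmf (\<lambda>(y, x). y + x) (pair_pmf (walk p n) p)))"
    by (simp only: Suc.IH)
  also have "\<dots> = map_pmf (\<lambda>(y, x). y + x) (pair_pmf (walk p (Suc n)) p)"
    by (simp only: walk.simps pair_pmf_def map_pmf_def bind_assoc_pmf bind_return_pmf case_prod_conv add.assoc)
  finally show ?case .
qed

lemma integral_walk_Suc:
  fixes f :: "'g::{group_add,countable} \<Rightarrow> real"
  assumes "integrable (walk p (Suc n)) f"
  shows "(\<integral>z. f z \<partial>walk p (Suc n)) = (\<integral>x. \<integral>y. f (x + y) \<partial>walk p n \<partial>p)"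
    and "integrable p (\<lambda>x. \<integral>y. f (x + y) \<partial>walk p n)"
proof -
  have i: "integrable (pair_pmf p (walk p n)) (\<lambda>z. f (fst z + snd z))"
    using assms by (simp add: integrable_map_pmf_eq case_prod_beta')
  show "(\<integral>z. f z \<partial>walk p (Suc n)) = (\<integral>x. \<integral>y. f (x + y) \<partial>walk p n \<partial>p)"
    using integral_pair_pmf(1)[OF i] by (simp add: case_prod_beta')
  show "integrable p (\<lambda>x. \<integral>y. f (x + y) \<partial>walk p n)"
    using integral_pair_pmf(2)[OF i] by simp
qed

lemma integral_walk_Suc_right:
  fixes f :: "'g::{group_add,countable} \<Rightarrow> real"
  assumes "integrable (walk p (Suc n)) f"
  shows "(\<integral>z. f z \<partial>walk p (Suc n)) = (\<integral>y. \<integral>x. f (y + x) \<partial>p \<partial>walk p n)"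
    and "(\<integral>z. f z \<partial>walk p (Suc n)) = (\<integral>x. \<integral>y. f (y + x) \<partial>walk p n \<partial>p)"
    and "integrable p (\<lambda>x. \<integral>y. f (y + x) \<partial>walk p n)"
proof -
  have i: "integrable (pair_pmf (walk p n) p) (\<lambda>z. f (fst z + snd z))"
    using assms by (simp only: walk_Suc_right integrable_map_pmf_eq case_prod_beta')
  show "(\<integral>z. f z \<partial>walk p (Suc n)) = (\<integral>y. \<integral>x. f (y + x) \<partial>p \<partial>walk p n)"
    using integral_pair_pmf(1)[OF i] by (simp add: walk_Suc_right case_prod_beta' del: walk.simps)
  have e: "walk p (Suc n) = map_pmf (\<lambda>(x, y). y + x) (pair_pmf p (walk p n))"
    by (subst pair_commute_pmf) (simp add: walk_Suc_right pmf.map_comp o_def case_prod_beta' del: walk.simps)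
  have j: "integrable (pair_pmf p (walk p n)) (\<lambda>z. f (snd z + fst z))"
    using assms by (simp only: e integrable_map_pmf_eq case_prod_beta')
  show "(\<integral>z. f z \<partial>walk p (Suc n)) = (\<integral>x. \<integral>y. f (y + x) \<partial>walk p n \<partial>p)"
    using integral_pair_pmf(1)[OF j] by (simp add: e case_prod_beta' del: walk.simps)
  show "integrable p (\<lambda>x. \<integral>y. f (y + x) \<partial>walk p n)"
    using integral_pair_pmf(2)[OF j] by simp
qed

lemma map_uminus_symmetric_pmf:
  assumes "symmetric_pmf p"
  shows "map_pmf uminus p = p"
proof (rule pmf_eqI)
  fix g
  have "pmf (map_pmf uminus p) (- (- g)) = pmf p (- g)"
    by (rule pmf_map_inj') (auto simp: inj_def)
  then show "pmf (map_pmf uminus p) g = pmf p g"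
    using assms by (simp add: symmetric_pmf_def)
qed

lemma map_uminus_walk:
  assumes "symmetric_pmf p"
  shows "map_pmf uminus (walk p n) = walk p n"
proof (induction n)
  case (Suc n)
  have "map_pmf uminus (walk p (Suc n)) =
      map_pmf (\<lambda>(y, x). y + x) (map_pmf (\<lambda>(y, x). (- y, - x)) (pair_pmf (walk p n) p))"
    unfolding walk.simps
    by (subst pair_commute_pmf) (simp only: pmf.map_comp o_def case_prod_beta' fst_conv snd_conv minus_add)
  also have "\<dots> = map_pmf (\<lambda>(y, x). y + x) (pair_pmf (map_pmf uminus (walk p n)) (map_pmf uminus p))"
    by (simp only: map_pair)
  also have "\<dots> = walk p (Suc n)"
    using assms by (simp only: Suc.IH map_uminus_symmetric_pmf walk_Suc_right)
  finally show ?case .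
qed simp

text \<open>The support of a symmetric \<open>p\<close> is closed under inverses, so it generates the group already as a
  semigroup.\<close>

lemma generated_induct [consumes 2, case_names zero step]:
  fixes p :: "'g::{group_add,countable} pmf"
  assumes sym: "symmetric_pmf p" and gen: "generates_group (set_pmf p)"
    and zero: "P 0" and step: "\<And>g s. P g \<Longrightarrow> s \<in> set_pmf p \<Longrightarrow> P (g + s)"
  shows "P g"
proof -
  have neg: "- s \<in> set_pmf p" if "s \<in> set_pmf p" for s
    using that sym by (simp add: set_pmf_iff symmetric_pmf_def)
  define H where "H = {sum_list xs |xs. set xs \<subseteq> set_pmf p}"
  have "is_subgroup H"
    unfolding is_subgroup_def
  proof (intro conjI ballI)
    show "0 \<in> H" unfolding H_def by (auto intro!: exI[of _ "[]"])
    fix x assume "x \<in> H"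
    then obtain xs where xs: "x = sum_list xs" "set xs \<subseteq> set_pmf p" unfolding H_def by auto
    { fix y assume "y \<in> H"
      then obtain ys where "y = sum_list ys" "set ys \<subseteq> set_pmf p" unfolding H_def by auto
      then show "x + y \<in> H" unfolding H_def using xs by (auto intro!: exI[of _ "xs @ ys"]) }
    have "- sum_list xs = sum_list (rev (map uminus xs))"
      by (induction xs) (simp_all add: minus_add)
    moreover have "set (rev (map uminus xs)) \<subseteq> set_pmf p"
      using xs(2) neg by auto
    ultimately show "- x \<in> H"
      unfolding H_def xs(1) by blast
  qed
  moreover have "set_pmf p \<subseteq> H"
    unfolding H_def by (auto intro!: exI[of _ "[_]"])
  ultimately have "is_subgroup hull set_pmf p \<subseteq> H"
    by (simp add: hull_minimal)
  then have "g \<in> H" using gen by (auto simp: generates_group_def)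
  then obtain xs where "g = sum_list xs" "set xs \<subseteq> set_pmf p" unfolding H_def by auto
  moreover have "P (sum_list xs)" if "set xs \<subseteq> set_pmf p" for xs
    using that by (induction xs rule: rev_induct) (auto intro: zero step)
  ultimately show ?thesis by simp
qed

section \<open>Stationary measures\<close>

lemma measurable_pmf_pair:
  fixes p :: "'g::countable pmf"
  assumes "\<And>\<gamma>. f \<gamma> \<in> measurable M N"
  shows "(\<lambda>(\<gamma>, x). f \<gamma> x) \<in> measurable (measure_pmf p \<Otimes>\<^sub>M M) N"
proof -
  have "(\<lambda>(\<gamma>, x). f \<gamma> x) \<in> measurable (count_space UNIV \<Otimes>\<^sub>M M) N"
    using assms by (intro measurable_pair_measure_countable1) auto
  moreover have "sets (measure_pmf p \<Otimes>\<^sub>M M) = sets (count_space UNIV \<Otimes>\<^sub>M M)"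
    by (rule sets_pair_measure_cong) simp_all
  ultimately show ?thesis
    by (simp cong: measurable_cong_sets)
qed

lemma borel_measurable_integral_pmf:
  fixes f :: "'i::countable \<Rightarrow> 'a \<Rightarrow> real"
  assumes "\<And>x. f x \<in> borel_measurable M"
  shows "(\<lambda>w. \<integral>x. f x w \<partial>measure_pmf q) \<in> borel_measurable M"
proof -
  have "(\<lambda>(x, w). f x w) \<in> borel_measurable (measure_pmf q \<Otimes>\<^sub>M M)"
    by (rule measurable_pmf_pair[OF assms])
  from measurable_compose[OF measurable_pair_swap' this] show ?thesis
    by (intro sigma_finite_measure.borel_measurable_lebesgue_integral
      prob_space_imp_sigma_finite measure_pmf.prob_space_axioms) (simp add: case_prod_beta')
qed

lemma measure_distr_action:
  fixes p :: "'g::{group_add,countable} pmf"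
  assumes M: "prob_space M" and a: "\<And>\<gamma>. a \<gamma> \<in> measurable M N" and A: "A \<in> sets N"
  shows "measure (distr (measure_pmf p \<Otimes>\<^sub>M M) N (\<lambda>(\<gamma>, x). a \<gamma> x)) A =
    (\<Sum>\<^sub>\<infinity>\<gamma>. pmf p \<gamma> * measure M (a \<gamma> -` A \<inter> space M))"
proof -
  interpret M: prob_space M by fact
  interpret pair_prob_space "measure_pmf p" M
    by (intro pair_prob_space.intro pair_sigma_finite.intro M measure_pmf.prob_space_axioms
      prob_space_imp_sigma_finite)
  note [measurable] = measurable_pmf_pair[OF a, where p=p] A
  let ?B = "(\<lambda>(\<gamma>, x). a \<gamma> x) -` A \<inter> space (measure_pmf p \<Otimes>\<^sub>M M)"
  have B: "?B \<in> sets (measure_pmf p \<Otimes>\<^sub>M M)"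
    by measurable
  have "emeasure (distr (measure_pmf p \<Otimes>\<^sub>M M) N (\<lambda>(\<gamma>, x). a \<gamma> x)) A = emeasure (measure_pmf p \<Otimes>\<^sub>M M) ?B"
    by (rule emeasure_distr) measurable
  also have "\<dots> = (\<integral>\<^sup>+\<gamma>. emeasure M (Pair \<gamma> -` ?B) \<partial>p)"
    using B by (rule M.emeasure_pair_measure_alt)
  also have "\<dots> = (\<integral>\<^sup>+\<gamma>. ennreal (measure M (a \<gamma> -` A \<inter> space M)) \<partial>p)"
    by (intro nn_integral_cong)
      (auto simp: M.emeasure_eq_measure space_pair_measure intro!: arg_cong[where f="measure M"])
  also have "\<dots> = ennreal (\<integral>\<gamma>. measure M (a \<gamma> -` A \<inter> space M) \<partial>p)"
    by (intro nn_integral_eq_integral measure_pmf.integrable_const_bound[where B=1]) auto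
  finally have "measure (distr (measure_pmf p \<Otimes>\<^sub>M M) N (\<lambda>(\<gamma>, x). a \<gamma> x)) A =
      (\<integral>\<gamma>. measure M (a \<gamma> -` A \<inter> space M) \<partial>p)"
    by (simp add: measure_def)
  then show ?thesis
    by (simp add: infsum_pmf_eq_integral)
qed

lemma prob_space_distr_action:
  fixes p :: "'g::{group_add,countable} pmf"
  assumes M: "prob_space M" and a: "\<And>\<gamma>. a \<gamma> \<in> measurable M N"
  shows "prob_space (distr (measure_pmf p \<Otimes>\<^sub>M M) N (\<lambda>(\<gamma>, x). a \<gamma> x))"
proof -
  interpret M: prob_space M by fact
  interpret pair_prob_space "measure_pmf p" M
    by (intro pair_prob_space.intro pair_sigma_finite.intro M measure_pmf.prob_space_axioms
      prob_space_imp_sigma_finite)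
  show ?thesis
    by (rule P.prob_space_distr) (rule measurable_pmf_pair[OF a])
qed

text \<open>Stationarity says that \<open>M\<close> is the law of \<open>a \<gamma> x\<close>, where \<open>\<gamma>\<close> and \<open>x\<close> are independent
  with laws \<open>p\<close> and \<open>M\<close>.\<close>

lemma stationary_iff_distr:
  fixes p :: "'g::{group_add,countable} pmf"
  assumes M: "prob_space M" and a: "measurable_action a M"
  shows "stationary p a M \<longleftrightarrow> distr (measure_pmf p \<Otimes>\<^sub>M M) M (\<lambda>(\<gamma>, x). a \<gamma> x) = M"
proof -
  have am: "a \<gamma> \<in> measurable M M" for \<gamma>
    using a by (simp add: measurable_action_def)
  interpret M: prob_space M by fact
  interpret D: prob_space "distr (measure_pmf p \<Otimes>\<^sub>M M) M (\<lambda>(\<gamma>, x). a \<gamma> x)"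
    by (rule prob_space_distr_action[OF M am])
  have "distr (measure_pmf p \<Otimes>\<^sub>M M) M (\<lambda>(\<gamma>, x). a \<gamma> x) = M \<longleftrightarrow>
    (\<forall>A\<in>sets M. measure (distr (measure_pmf p \<Otimes>\<^sub>M M) M (\<lambda>(\<gamma>, x). a \<gamma> x)) A = measure M A)"
    by (metis (no_types, lifting) D.emeasure_eq_measure M.emeasure_eq_measure measure_eqI sets_distr)
  then show ?thesis
    using M a by (auto simp: stationary_def measure_distr_action[OF M am])
qed

lemma stationary_integral:
  fixes p :: "'g::{group_add,countable} pmf" and F :: "'b \<Rightarrow> real"
  assumes st: "stationary p a M" and [measurable]: "F \<in> borel_measurable M"
    and bnd: "\<And>x. x \<in> space M \<Longrightarrow> \<bar>F x\<bar> \<le> C"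
  shows "(\<integral>x. F x \<partial>M) = (\<integral>\<gamma>. \<integral>x. F (a \<gamma> x) \<partial>M \<partial>p)"
    and "(\<integral>x. F x \<partial>M) = (\<integral>x. \<integral>\<gamma>. F (a \<gamma> x) \<partial>p \<partial>M)"
    and "integrable M (\<lambda>x. \<integral>\<gamma>. F (a \<gamma> x) \<partial>p)"
proof -
  have M: "prob_space M" and a: "measurable_action a M"
    using st by (auto simp: stationary_def)
  have am[measurable]: "a \<gamma> \<in> measurable M M" for \<gamma>
    using a by (simp add: measurable_action_def)
  interpret M: prob_space M by fact
  interpret pair_prob_space "measure_pmf p" M
    by (intro pair_prob_space.intro pair_sigma_finite.intro M measure_pmf.prob_space_axioms
      prob_space_imp_sigma_finite)
  note [measurable] = measurable_pmf_pair[OF am, where p=p]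
  have eq: "distr (measure_pmf p \<Otimes>\<^sub>M M) M (\<lambda>(\<gamma>, x). a \<gamma> x) = M"
    using st stationary_iff_distr[OF M a] by blast
  have Fm[measurable]: "(\<lambda>(\<gamma>, x). F (a \<gamma> x)) \<in> borel_measurable (measure_pmf p \<Otimes>\<^sub>M M)"
    by (rule measurable_pmf_pair) measurable
  have sp: "a \<gamma> x \<in> space M" if "x \<in> space M" for \<gamma> x
    using measurable_space[OF am that] .
  have int: "integrable (measure_pmf p \<Otimes>\<^sub>M M) (\<lambda>(\<gamma>, x). F (a \<gamma> x))"
    by (rule P.integrable_const_bound[where B=C]) (auto simp: space_pair_measure bnd sp)
  have "(\<integral>x. F x \<partial>M) = (\<integral>x. F x \<partial>distr (measure_pmf p \<Otimes>\<^sub>M M) M (\<lambda>(\<gamma>, x). a \<gamma> x))"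
    by (simp only: eq)
  also have "\<dots> = (\<integral>z. (\<lambda>(\<gamma>, x). F (a \<gamma> x)) z \<partial>(measure_pmf p \<Otimes>\<^sub>M M))"
    by (subst integral_distr) (auto simp: case_prod_beta')
  finally have e: "(\<integral>x. F x \<partial>M) = (\<integral>z. (\<lambda>(\<gamma>, x). F (a \<gamma> x)) z \<partial>(measure_pmf p \<Otimes>\<^sub>M M))" .
  show "(\<integral>x. F x \<partial>M) = (\<integral>\<gamma>. \<integral>x. F (a \<gamma> x) \<partial>M \<partial>p)"
    using e integral_fst[OF int] by simp
  show "(\<integral>x. F x \<partial>M) = (\<integral>x. \<integral>\<gamma>. F (a \<gamma> x) \<partial>p \<partial>M)"
    using e integral_snd[OF int] by simp
  show "integrable M (\<lambda>x. \<integral>\<gamma>. F (a \<gamma> x) \<partial>p)"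
    using integrable_snd[OF int] .
qed

lemma stationary_integral_walk:
  fixes p :: "'g::{group_add,countable} pmf" and F :: "'b \<Rightarrow> real"
  assumes st: "stationary p a M" and "F \<in> borel_measurable M"
    and "\<And>x. x \<in> space M \<Longrightarrow> \<bar>F x\<bar> \<le> C"
  shows "(\<integral>x. F x \<partial>M) = (\<integral>\<gamma>. \<integral>x. F (a \<gamma> x) \<partial>M \<partial>walk p n)"
  using assms(2,3)
proof (induction n arbitrary: F)
  case 0
  have "(\<integral>x. F x \<partial>M) = (\<integral>x. F (a 0 x) \<partial>M)"
    using st by (intro Bochner_Integration.integral_cong) (auto simp: stationary_def measurable_action_def)
  then show ?case by simp
next
  case (Suc n)
  have a: "measurable_action a M" and M: "prob_space M"
    using st by (auto simp: stationary_def)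
  interpret M: prob_space M by fact
  have am[measurable]: "a \<gamma> \<in> measurable M M" for \<gamma>
    using a by (simp add: measurable_action_def)
  note Suc.prems(1)[measurable]
  have sp: "a \<gamma> x \<in> space M" if "x \<in> space M" for \<gamma> x
    using measurable_space[OF am that] .
  have "C \<ge> 0"
    using M.not_empty Suc.prems(2) abs_ge_zero order_trans by blast
  have b: "\<bar>\<integral>x. F (a \<gamma> x) \<partial>M\<bar> \<le> C" for \<gamma>
  proof -
    have "\<bar>\<integral>x. F (a \<gamma> x) \<partial>M\<bar> \<le> (\<integral>x. \<bar>F (a \<gamma> x)\<bar> \<partial>M)"
      by (rule integral_abs_bound)
    also have "\<dots> \<le> (\<integral>x. C \<partial>M)"
      by (rule integral_mono) (auto intro!: M.integrable_const_bound[where B=C] Suc.prems(2) sp)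
    finally show ?thesis by (simp add: M.prob_space)
  qed
  have "(\<integral>x. F x \<partial>M) = (\<integral>\<gamma>. \<integral>x. F (a \<gamma> x) \<partial>M \<partial>p)"
    by (rule stationary_integral(1)[OF st Suc.prems])
  also have "\<dots> = (\<integral>\<gamma>. \<integral>\<delta>. \<integral>x. F (a \<gamma> (a \<delta> x)) \<partial>M \<partial>walk p n \<partial>p)"
    by (intro Bochner_Integration.integral_cong refl Suc.IH) (auto intro: Suc.prems(2) sp)
  also have "\<dots> = (\<integral>\<gamma>. \<integral>\<delta>. \<integral>x. F (a (\<gamma> + \<delta>) x) \<partial>M \<partial>walk p n \<partial>p)"
    using a by (intro Bochner_Integration.integral_cong refl) (auto simp: measurable_action_def)
  also have "\<dots> = (\<integral>\<gamma>. \<integral>x. F (a \<gamma> x) \<partial>M \<partial>walk p (Suc n))"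
    by (rule integral_walk_Suc(1)[symmetric])
      (rule measure_pmf.integrable_const_bound[where B=C], use b in auto)
  finally show ?case .
qed

text \<open>A stationary measure is quasi-invariant when the support of \<open>p\<close> is symmetric and
  generates the group.\<close>

lemma stationary_AE_translate:
  fixes p :: "'g::{group_add,countable} pmf"
  assumes st: "stationary p a M" and sym: "symmetric_pmf p" and gen: "generates_group (set_pmf p)"
    and P: "AE x in M. P x"
  shows "AE x in M. P (a \<gamma> x)"
  using sym gen
proof (induction \<gamma> rule: generated_induct)
  case zero
  have "AE x in M. a 0 x = x"
    using st by (auto simp: stationary_def measurable_action_def)
  with P show ?case by eventually_elim simp
next
  case (step g s)
  have M: "prob_space M" and a: "measurable_action a M"
    using st by (auto simp: stationary_def)
  interpret M: prob_space M by fact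
  have am[measurable]: "a \<gamma> \<in> measurable M M" for \<gamma>
    using a by (simp add: measurable_action_def)
  obtain N where N: "{x\<in>space M. \<not> P (a g x)} \<subseteq> N" "emeasure M N = 0" "N \<in> sets M"
    using step(1) by (auto elim!: AE_E)
  have "measure M N = (\<Sum>\<^sub>\<infinity>\<gamma>. pmf p \<gamma> * measure M (a \<gamma> -` N \<inter> space M))"
    using st N(3) unfolding stationary_def by blast
  then have "(\<integral>\<gamma>. measure M (a \<gamma> -` N \<inter> space M) \<partial>p) = 0"
    using N(2) by (simp add: infsum_pmf_eq_integral measure_def)
  then have "AE \<gamma> in p. measure M (a \<gamma> -` N \<inter> space M) = 0"
    by (subst integral_nonneg_eq_0_iff_AE[symmetric])
      (auto intro!: measure_pmf.integrable_const_bound[where B=1])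
  then have "measure M (a s -` N \<inter> space M) = 0"
    using step(2) by (auto simp: AE_measure_pmf_iff)
  then have "AE x in M. x \<notin> a s -` N \<inter> space M"
    using N(3) by (intro AE_not_in) (auto simp: null_sets_def M.emeasure_eq_measure)
  moreover have "AE x in M. x \<in> space M" by simp
  ultimately show ?case
  proof eventually_elim
    case (elim x)
    then have "a s x \<in> space M" "a s x \<notin> N" using measurable_space[OF am] by auto
    then have "P (a g (a s x))" using N(1) by auto
    then show ?case using a elim by (simp add: measurable_action_def)
  qed
qed

text \<open>The image of a stationary measure under an almost everywhere equivariant map is stationary.\<close>

lemma stationary_distr:
  fixes p :: "'g::{group_add,countable} pmf"
  assumes st: "stationary p a M" and act: "measurable_action a' N"
    and [measurable]: "f \<in> measurable M N"
    and eq: "AE x in M. \<forall>\<gamma>. f (a \<gamma> x) = a' \<gamma> (f x)"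
  shows "stationary p a' (distr M N f)"
  unfolding stationary_def
proof (intro conjI ballI)
  have M: "prob_space M" and a: "measurable_action a M"
    using st by (auto simp: stationary_def)
  interpret M: prob_space M by fact
  have am[measurable]: "a \<gamma> \<in> measurable M M" for \<gamma>
    using a by (simp add: measurable_action_def)
  have a'm[measurable]: "a' \<gamma> \<in> measurable N N" for \<gamma>
    using act by (simp add: measurable_action_def)
  show "prob_space (distr M N f)"
    by (rule M.prob_space_distr) measurable
  show "measurable_action a' (distr M N f)"
    using act by (auto simp: measurable_action_def)
  fix A assume "A \<in> sets (distr M N f)"
  then have A[measurable]: "A \<in> sets N" by simp
  have B: "a' \<gamma> -` A \<inter> space N \<in> sets N" for \<gamma> by measurable
  have "measure (distr M N f) A = measure M (f -` A \<inter> space M)"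
    by (rule measure_distr) measurable
  also have "\<dots> = (\<Sum>\<^sub>\<infinity>\<gamma>. pmf p \<gamma> * measure M (a \<gamma> -` (f -` A \<inter> space M) \<inter> space M))"
  proof -
    have "f -` A \<inter> space M \<in> sets M" by measurable
    then show ?thesis using st unfolding stationary_def by blast
  qed
  also have "\<dots> = (\<Sum>\<^sub>\<infinity>\<gamma>. pmf p \<gamma> * measure (distr M N f) (a' \<gamma> -` A \<inter> space (distr M N f)))"
  proof (intro infsum_cong arg_cong2[where f="(*)"] refl)
    fix \<gamma>
    have "measure M (a \<gamma> -` (f -` A \<inter> space M) \<inter> space M) = measure M (f -` (a' \<gamma> -` A \<inter> space N) \<inter> space M)"
    proof (rule M.finite_measure_eq_AE)
      show "AE x in M. (x \<in> a \<gamma> -` (f -` A \<inter> space M) \<inter> space M) = (x \<in> f -` (a' \<gamma> -` A \<inter> space N) \<inter> space M)"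
        using eq
      proof eventually_elim
        case (elim x)
        then show ?case using measurable_space[OF am, of x \<gamma>] measurable_space[OF \<open>f \<in> measurable M N\<close>, of x] by auto
      qed
    qed measurable
    also have "\<dots> = measure (distr M N f) (a' \<gamma> -` A \<inter> space N)"
      by (rule measure_distr[symmetric]) (use B in auto)
    finally show "measure M (a \<gamma> -` (f -` A \<inter> space M) \<inter> space M) =
        measure (distr M N f) (a' \<gamma> -` A \<inter> space (distr M N f))" by simp
  qed
  finally show "measure (distr M N f) A =
     (\<Sum>\<^sub>\<infinity>\<gamma>. pmf p \<gamma> * measure (distr M N f) (a' \<gamma> -` A \<inter> space (distr M N f)))" .
qed

section \<open>The metric on the space of functions\<close>

lemma dist_fun_le_2: "dist (x :: 'g::countable \<Rightarrow> real) y \<le> 2"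
proof -
  have g: "summable (\<lambda>n. (1/2::real)^n)"
    by (simp add: summable_geometric_iff)
  have s: "summable (\<lambda>n. (1/2)^n * min (dist (x (from_nat n)) (y (from_nat n))) 1)"
    by (rule summable_comparison_test'[OF g]) (simp add: mult_left_le)
  have "(\<Sum>n. (1/2)^n * min (dist (x (from_nat n)) (y (from_nat n))) 1) \<le> (\<Sum>n. (1/2::real)^n)"
    by (rule suminf_le[OF _ s g]) (simp add: mult_left_le)
  also have "\<dots> = 2"
    using suminf_geometric[of "1/2::real"] by simp
  finally show ?thesis by (simp add: dist_fun_def)
qed

lemma dist_fun_le_sum:
  "dist (x :: 'g::countable \<Rightarrow> real) y \<le> 2 * (\<Sum>n\<le>N. \<bar>x (from_nat n) - y (from_nat n)\<bar>) + (1/2)^N"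
proof -
  have "Max {dist (x (from_nat n)) (y (from_nat n))|n. n \<le> N} \<le> (\<Sum>n\<le>N. \<bar>x (from_nat n) - y (from_nat n)\<bar>)"
    by (subst Max_le_iff) (auto simp: dist_real_def intro!: member_le_sum)
  then show ?thesis
    using dist_fun_le_dist_first_terms[of x y N] by simp
qed

text \<open>Coordinatewise convergence in mean implies convergence of the mean distance.\<close>

lemma tendsto_integral_dist_fun:
  fixes X Y :: "'i \<Rightarrow> 'a \<Rightarrow> 'g::countable \<Rightarrow> real"
  assumes M: "\<And>i. prob_space (M i)"
    and [measurable]: "\<And>i. X i \<in> borel_measurable (M i)" "\<And>i. Y i \<in> borel_measurable (M i)"
    and int: "\<And>i g. integrable (M i) (\<lambda>w. \<bar>X i w g - Y i w g\<bar>)"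
    and lim: "\<And>g. ((\<lambda>i. \<integral>w. \<bar>X i w g - Y i w g\<bar> \<partial>M i) \<longlongrightarrow> 0) F"
  shows "((\<lambda>i. \<integral>w. dist (X i w) (Y i w) \<partial>M i) \<longlongrightarrow> 0) F"
proof (rule tendstoI)
  fix e :: real assume e: "e > 0"
  obtain N where N: "(1/2::real)^N < e/2"
    using real_arch_pow_inv[of "e/2" "1/2"] e by auto
  have "((\<lambda>i. 2 * (\<Sum>n\<le>N. \<integral>w. \<bar>X i w (from_nat n) - Y i w (from_nat n)\<bar> \<partial>M i)) \<longlongrightarrow> 2 * (\<Sum>n\<le>N. 0)) F"
    by (intro tendsto_intros lim)
  then have "eventually (\<lambda>i. 2 * (\<Sum>n\<le>N. \<integral>w. \<bar>X i w (from_nat n) - Y i w (from_nat n)\<bar> \<partial>M i) < e/2) F"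
    using e by (intro order_tendstoD(2)[where y=0]) auto
  then show "eventually (\<lambda>i. dist (\<integral>w. dist (X i w) (Y i w) \<partial>M i) 0 < e) F"
  proof eventually_elim
    case (elim i)
    interpret prob_space "M i" by (rule M)
    have "(\<integral>w. dist (X i w) (Y i w) \<partial>M i) \<le>
        (\<integral>w. 2 * (\<Sum>n\<le>N. \<bar>X i w (from_nat n) - Y i w (from_nat n)\<bar>) + (1/2)^N \<partial>M i)"
    proof (rule integral_mono)
      show "integrable (M i) (\<lambda>w. dist (X i w) (Y i w))"
        by (rule integrable_const_bound[where B=2]) (auto simp: dist_fun_le_2)
    qed (intro Bochner_Integration.integrable_add integrable_mult_right Bochner_Integration.integrable_sum int integrable_const dist_fun_le_sum)+
    also have "\<dots> = 2 * (\<Sum>n\<le>N. \<integral>w. \<bar>X i w (from_nat n) - Y i w (from_nat n)\<bar> \<partial>M i) + (1/2)^N"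
      using int by (simp add: prob_space)
    also have "\<dots> < e" using elim N by simp
    finally show ?case by simp
  qed
qed

text \<open>Probability measures on a metric space are determined by the integrals of bounded Lipschitz
  functions, since these approximate the indicator functions of closed sets.\<close>

lemma finite_measure_eqI_lipschitz:
  fixes M N :: "'a::metric_space measure"
  assumes M: "prob_space M" "sets M = sets borel" and N: "prob_space N" "sets N = sets borel"
    and eq: "\<And>(F::'a \<Rightarrow> real) L. L-lipschitz_on UNIV F \<Longrightarrow> (\<And>x. \<bar>F x\<bar> \<le> 1) \<Longrightarrow> (\<integral>x. F x \<partial>M) = (\<integral>x. F x \<partial>N)"
  shows "M = N"
proof (rule measure_eqI_generator_eq[where E="Collect closed" and \<Omega>=UNIV and A="\<lambda>_. UNIV"])
  show "Int_stable (Collect closed :: 'a set set)" by (auto simp: Int_stable_def)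
  show "sets M = sigma_sets UNIV (Collect closed)" "sets N = sigma_sets UNIV (Collect closed)"
    by (auto simp: M(2) N(2) borel_eq_closed)
  show "emeasure M UNIV \<noteq> \<infinity>"
    using prob_space.emeasure_space_1[OF M(1)] sets_eq_imp_space_eq[OF M(2)] by simp
  fix C :: "'a set" assume "C \<in> Collect closed"
  then have C: "closed C" by simp
  show "emeasure M C = emeasure N C"
  proof (cases "C = {}")
    case False
    define F where "F = (\<lambda>(k::nat) x. max 0 (1 - real k * infdist x C))"
    have lip: "(real k)-lipschitz_on UNIV (F k)" for k
    proof (rule lipschitz_onI)
      fix x y
      have "real k * \<bar>infdist x C - infdist y C\<bar> \<le> real k * dist x y"
        by (rule mult_left_mono[OF infdist_triangle_abs]) simp
      moreover have "\<bar>F k x - F k y\<bar> \<le> \<bar>real k * infdist x C - real k * infdist y C\<bar>"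
        unfolding F_def by (simp add: max_def abs_if)
      moreover have "\<bar>real k * infdist x C - real k * infdist y C\<bar> = real k * \<bar>infdist x C - infdist y C\<bar>"
        by (simp add: right_diff_distrib[symmetric] abs_mult)
      ultimately show "dist (F k x) (F k y) \<le> real k * dist x y"
        by (simp add: dist_real_def)
    qed simp
    have bnd: "\<bar>F k x\<bar> \<le> 1" for k x by (simp add: F_def infdist_nonneg max_def)
    have [measurable]: "F k \<in> borel_measurable borel" for k
      by (rule borel_measurable_continuous_onI[OF lipschitz_on_continuous_on[OF lip]])
    have lim: "(\<lambda>k. F k x) \<longlonglongrightarrow> indicator C x" for x
    proof (cases "x \<in> C")
      case True
      then show ?thesis by (simp add: F_def)
    next
      case False
      then have d: "infdist x C > 0"
        using C \<open>C \<noteq> {}\<close> by (simp add: infdist_pos_not_in_closed)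
      obtain K where K: "1 < real K * infdist x C" using d reals_Archimedean3 by blast
      have "F k x = 0" if "k \<ge> K" for k
      proof -
        have "real K * infdist x C \<le> real k * infdist x C"
          using that d by (intro mult_right_mono) auto
        with K show ?thesis by (simp add: F_def)
      qed
      then show ?thesis
        using False by (intro tendsto_eventually) (auto simp: eventually_sequentially)
    qed
    have conv: "(\<lambda>k. \<integral>x. F k x \<partial>P) \<longlonglongrightarrow> measure P C" if P: "prob_space P" "sets P = sets borel" for P
    proof -
      interpret P: prob_space P by fact
      have "(\<lambda>k. \<integral>x. F k x \<partial>P) \<longlonglongrightarrow> (\<integral>x. indicator C x \<partial>P)"
        by (rule integral_dominated_convergence[where w="\<lambda>_. 1"])
          (use C P(2) lim bnd in \<open>auto cong: measurable_cong_sets\<close>)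
      then show ?thesis using C P(2) sets_eq_imp_space_eq[OF P(2)] by simp
    qed
    have "(\<lambda>k. \<integral>x. F k x \<partial>M) = (\<lambda>k. \<integral>x. F k x \<partial>N)"
      using eq[OF lip bnd] by auto
    then have "measure M C = measure N C"
      using conv[OF M] conv[OF N] LIMSEQ_unique by auto
    then show ?thesis
      using M N by (simp add: prob_space_def finite_measure.emeasure_eq_measure)
  qed simp
qed auto

section \<open>The action on functions\<close>

lemma act0_add: "act0 (\<gamma> + \<delta>) \<phi> = act0 \<gamma> (act0 \<delta> \<phi>)"
  by (simp add: act0_def add.assoc)

lemma act0_zero: "\<phi> \<in> F0 \<Longrightarrow> act0 0 \<phi> = \<phi>"
  by (simp add: act0_def F0_def)

lemma act0_in_F0: "act0 \<gamma> \<phi> \<in> F0"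
  by (simp add: act0_def F0_def)

lemma continuous_on_coordinate [continuous_intros]: "continuous_on A (\<lambda>\<phi> :: 'g \<Rightarrow> real. \<phi> g)"
  by (rule continuous_on_subset[OF continuous_on_product_coordinates]) simp

lemma continuous_on_act0: "continuous_on A (act0 \<gamma>)"
  unfolding act0_def by (intro continuous_on_coordinatewise_then_product continuous_intros)

lemma closed_F0: "closed (F0 :: ('g::group_add \<Rightarrow> real) set)"
  unfolding F0_def by (intro closed_Collect_eq continuous_intros)

lemma measurable_act0 [measurable]:
  "act0 \<gamma> \<in> measurable borel (borel :: ('g::{group_add,countable} \<Rightarrow> real) measure)"
  by (rule borel_measurable_continuous_onI[OF continuous_on_act0])

lemma measurable_action_act0:
  fixes X :: "('g::{group_add,countable} \<Rightarrow> real) set"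
  assumes "X \<subseteq> F0" and "\<And>\<gamma> \<phi>. \<phi> \<in> X \<Longrightarrow> act0 \<gamma> \<phi> \<in> X"
  shows "measurable_action act0 (restrict_space borel X)"
  unfolding measurable_action_def
proof (intro conjI allI ballI)
  show "act0 \<gamma> \<in> restrict_space borel X \<rightarrow>\<^sub>M restrict_space borel X" for \<gamma>
    using assms(2) by (intro measurable_restrict_space3) auto
  show "act0 0 x = x" if "x \<in> space (restrict_space borel X)" for x
    using that assms(1) by (auto simp: space_restrict_space intro!: act0_zero)
qed (simp add: act0_add)

lemma orbit_closure_act0:
  assumes "\<phi> \<in> orbit_closure \<psi>"
  shows "act0 \<gamma> \<phi> \<in> orbit_closure \<psi>"
proof -
  have "act0 \<gamma> ` closure (range (\<lambda>\<gamma>. act0 \<gamma> \<psi>)) \<subseteq> closure (range (\<lambda>\<gamma>. act0 \<gamma> \<psi>))"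
    by (rule image_closure_subset[OF continuous_on_act0])
      (auto simp: act0_add[symmetric] intro!: subsetD[OF closure_subset])
  with assms show ?thesis by (auto simp: orbit_closure_def)
qed

lemma closed_orbit_closure: "closed (orbit_closure \<psi>)"
  by (simp add: orbit_closure_def)

lemma orbit_closure_subset:
  assumes "\<And>\<gamma>. act0 \<gamma> \<psi> \<in> Q" and "closed Q"
  shows "orbit_closure \<psi> \<subseteq> Q"
  unfolding orbit_closure_def using assms by (intro closure_minimal) auto

lemma orbit_closure_F0: "orbit_closure \<psi> \<subseteq> F0"
  by (rule orbit_closure_subset[OF act0_in_F0 closed_F0])

section \<open>Harmonic functions along the random walk\<close>

lemma integrable_pmf_bounded:
  fixes f :: "'a \<Rightarrow> real"
  assumes "\<And>x. \<bar>f x\<bar> \<le> C"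
  shows "integrable (measure_pmf p) f"
  using assms by (intro measure_pmf.integrable_const_bound[where B=C]) auto

lemma abs_integral_le_const:
  fixes f :: "'a \<Rightarrow> real"
  assumes M: "prob_space M" and f: "AE x in M. \<bar>f x\<bar> \<le> C" and "0 \<le> C"
  shows "\<bar>\<integral>x. f x \<partial>M\<bar> \<le> C"
proof (cases "integrable M f")
  case True
  interpret prob_space M by fact
  have "\<bar>\<integral>x. f x \<partial>M\<bar> \<le> (\<integral>x. \<bar>f x\<bar> \<partial>M)"
    by (rule integral_abs_bound)
  also have "\<dots> \<le> (\<integral>x. C \<partial>M)"
    using f True by (intro integral_mono_AE) auto
  finally show ?thesis by (simp add: prob_space)
qed (use \<open>0 \<le> C\<close> in \<open>simp add: not_integrable_integral_eq\<close>)

lemma square_integral_abs_le: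
  fixes f :: "'a \<Rightarrow> real"
  assumes M: "prob_space M" and f: "integrable M f" "integrable M (\<lambda>x. (f x)\<^sup>2)"
  shows "(\<integral>x. \<bar>f x\<bar> \<partial>M)\<^sup>2 \<le> (\<integral>x. (f x)\<^sup>2 \<partial>M)"
proof -
  interpret prob_space M by fact
  define c where "c = (\<integral>x. \<bar>f x\<bar> \<partial>M)"
  have "0 \<le> (\<integral>x. (\<bar>f x\<bar> - c)\<^sup>2 \<partial>M)" by simp
  also have "\<dots> = (\<integral>x. (f x)\<^sup>2 - 2 * c * \<bar>f x\<bar> + c\<^sup>2 \<partial>M)"
    by (simp add: power2_diff algebra_simps)
  also have "\<dots> = (\<integral>x. (f x)\<^sup>2 \<partial>M) - 2 * c * c + c\<^sup>2"
    using f by (simp add: c_def prob_space)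
  finally show ?thesis by (simp add: c_def power2_eq_square)
qed

lemma pmf_mult_le_integral:
  fixes G :: "'a \<Rightarrow> real"
  assumes "integrable (measure_pmf p) G" and "\<And>x. 0 \<le> G x"
  shows "pmf p s * G s \<le> (\<integral>x. G x \<partial>p)"
proof -
  have "pmf p s * G s = (\<integral>x. indicator {s} x * G s \<partial>p)"
    by (simp add: measure_pmf_single)
  also have "\<dots> \<le> (\<integral>x. G x \<partial>p)"
    using assms by (intro integral_mono) (auto intro!: integrable_mult_left integrable_pmf_bounded[where C=1] simp: indicator_def)
  finally show ?thesis .
qed

text \<open>A random walk whose step law is symmetric with generating support.\<close>

locale symmetric_walk =
  fixes p :: "'g::{group_add,countable} pmf"
  assumes sym: "symmetric_pmf p" and gen: "generates_group (set_pmf p)"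
begin

lemma integral_uminus: "(\<integral>x. f (- x) \<partial>p) = (\<integral>x. f x \<partial>p :: real)"
  using integral_map_pmf[of uminus p f] map_uminus_symmetric_pmf[OF sym] by simp

lemma integral_walk_uminus: "(\<integral>x. f (- x) \<partial>walk p n) = (\<integral>x. (f x :: real) \<partial>walk p n)"
  using integral_map_pmf[of uminus "walk p n" f] map_uminus_walk[OF sym] by simp

lemma conv_left: "conv (pmf p) \<psi> g = (\<integral>x. \<psi> (x + g) \<partial>p)"
  unfolding conv_def infsum_pmf_eq_integral
  using integral_uminus[of "\<lambda>x. \<psi> (x + g)"] by simp

lemma conv_right: "conv h (pmf p) g = (\<integral>x. h (g + x) \<partial>p)"
proof -
  have "conv h (pmf p) g = (\<Sum>\<^sub>\<infinity>x. pmf p x * h (g - x))"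
    unfolding conv_def
    by (rule infsum_reindex_bij_witness[where i="\<lambda>x. g - x" and j="\<lambda>x. - x + g"])
      (auto simp: minus_add diff_conv_add_uminus add.assoc simp del: add_uminus_conv_diff)
  then show ?thesis
    unfolding infsum_pmf_eq_integral using integral_uminus[of "\<lambda>x. h (g + x)"] by simp
qed

text \<open>For a bounded left-harmonic \<open>b\<close>, the second moments of \<open>b\<close> along the walk increase and are
  bounded, and their increments control the mean square variation of \<open>b\<close>.\<close>

lemma harmonic_increment:
  fixes b :: "'g \<Rightarrow> real"
  assumes bnd: "\<And>g. \<bar>b g\<bar> \<le> C" and harm: "\<And>g. (\<integral>x. b (x + g) \<partial>p) = b g"
  shows "(\<integral>x. \<integral>y. (b (x + y) - b y)\<^sup>2 \<partial>walk p n \<partial>p)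
      = (\<integral>y. (b y)\<^sup>2 \<partial>walk p (Suc n)) - (\<integral>y. (b y)\<^sup>2 \<partial>walk p n)"
proof -
  have sq: "(b x)\<^sup>2 \<le> C\<^sup>2" for x
    using power_mono[OF bnd[of x] abs_ge_zero, of 2] by simp
  have m: "\<bar>b x * b y\<bar> \<le> C * C" for x y
    unfolding abs_mult by (intro mult_mono bnd order_trans[OF abs_ge_zero bnd[of x]]) auto
  let ?Q = "pair_pmf p (walk p n)"
  have i1: "integrable ?Q (\<lambda>z. (b (fst z + snd z))\<^sup>2)"
    and i2: "integrable ?Q (\<lambda>z. (b (snd z))\<^sup>2)"
    by (rule integrable_pmf_bounded[where C="C\<^sup>2"]; simp add: sq)+
  have i3: "integrable ?Q (\<lambda>z. b (fst z + snd z) * b (snd z))"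
    by (rule integrable_pmf_bounded[where C="C * C"]) (rule m)
  have i4: "integrable ?Q (\<lambda>z. (b (fst z + snd z))\<^sup>2 - 2 * (b (fst z + snd z) * b (snd z)) + (b (snd z))\<^sup>2)"
    using i1 i2 i3 by auto
  have e: "(b (x + y) - b y)\<^sup>2 = (b (x + y))\<^sup>2 - 2 * (b (x + y) * b y) + (b y)\<^sup>2" for x y
    by (simp add: power2_diff)
  have "(\<integral>x. \<integral>y. (b (x + y) - b y)\<^sup>2 \<partial>walk p n \<partial>p) =
      (\<integral>z. (b (fst z + snd z))\<^sup>2 - 2 * (b (fst z + snd z) * b (snd z)) + (b (snd z))\<^sup>2 \<partial>?Q)"
    unfolding e using integral_pair_pmf(1)[OF i4] by simp
  also have "\<dots> = (\<integral>z. (b (fst z + snd z))\<^sup>2 \<partial>?Q) - 2 * (\<integral>z. b (fst z + snd z) * b (snd z) \<partial>?Q)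
      + (\<integral>z. (b (snd z))\<^sup>2 \<partial>?Q)"
    using i1 i2 i3 by simp
  also have "(\<integral>z. (b (snd z))\<^sup>2 \<partial>?Q) = (\<integral>y. (b y)\<^sup>2 \<partial>walk p n)"
    by (rule expectation_pair_pmf_snd)
  also have "(\<integral>z. (b (fst z + snd z))\<^sup>2 \<partial>?Q) = (\<integral>y. (b y)\<^sup>2 \<partial>walk p (Suc n))"
    by (simp add: case_prod_beta')
  also have "(\<integral>z. b (fst z + snd z) * b (snd z) \<partial>?Q) = (\<integral>y. (b y)\<^sup>2 \<partial>walk p n)"
  proof -
    have "?Q = map_pmf (\<lambda>(x, y). (y, x)) (pair_pmf (walk p n) p)"
      by (rule pair_commute_pmf)
    then have "(\<integral>z. b (fst z + snd z) * b (snd z) \<partial>?Q) =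
        (\<integral>z. b (snd z + fst z) * b (fst z) \<partial>pair_pmf (walk p n) p)"
      by (simp add: case_prod_beta')
    also have "\<dots> = (\<integral>y. \<integral>x. b (x + y) * b y \<partial>p \<partial>walk p n)"
      by (subst integral_pair_pmf(1)) (auto intro!: integrable_pmf_bounded[where C="C * C"] m)
    finally show ?thesis
      by (simp add: harm power2_eq_square)
  qed
  finally show ?thesis by simp
qed

text \<open>For \<open>g\<close> in the support of \<open>p\<close> this follows from the convergence of the second moments. A product
  \<open>g + s\<close> is handled by comparing \<open>s + y\<close>, for \<open>y\<close> distributed as \<open>walk p n\<close>, with
  \<open>walk p (Suc n)\<close>: the law of the former is at most the law of the latter divided by \<open>pmf p s\<close>.\<close>

lemma harmonic_increment_tendsto_0:
  fixes b :: "'g \<Rightarrow> real"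
  assumes bnd: "\<And>g. \<bar>b g\<bar> \<le> C" and harm: "\<And>g. (\<integral>x. b (x + g) \<partial>p) = b g"
  shows "(\<lambda>n. \<integral>y. \<bar>b (g + y) - b y\<bar> \<partial>walk p n) \<longlonglongrightarrow> 0"
  using sym gen
proof (induction g rule: generated_induct)
  case zero
  show ?case by simp
next
  case (step g s)
  have ps: "pmf p s > 0" using step(2) by (simp add: pmf_positive)
  have bd: "\<bar>b x - b y\<bar> \<le> 2 * C" for x y
    using bnd[of x] bnd[of y] by linarith
  have sqd: "(b x - b y)\<^sup>2 \<le> (2 * C)\<^sup>2" for x y
    using power_mono[OF bd[of x y] abs_ge_zero, of 2] by simp
  define u where "u n = (\<integral>y. (b y)\<^sup>2 \<partial>walk p n)" for n
  have inc: "(\<integral>x. \<integral>y. (b (x + y) - b y)\<^sup>2 \<partial>walk p n \<partial>p) = u (Suc n) - u n" for n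
    unfolding u_def by (rule harmonic_increment[OF bnd harm])
  have "C \<ge> 0" using bnd[of 0] by linarith
  have Gb: "\<bar>\<integral>y. (b (x + y) - b y)\<^sup>2 \<partial>walk p n\<bar> \<le> (2 * C)\<^sup>2" for x n
    by (rule abs_integral_le_const[OF measure_pmf.prob_space_axioms]) (use sqd in \<open>auto intro!: AE_I2\<close>)
  have "incseq u"
  proof (rule incseq_SucI)
    fix n
    have "0 \<le> (\<integral>x. \<integral>y. (b (x + y) - b y)\<^sup>2 \<partial>walk p n \<partial>p)" by simp
    then show "u n \<le> u (Suc n)" using inc by simp
  qed
  moreover have "\<bar>u n\<bar> \<le> C\<^sup>2" for n
    unfolding u_def
    by (rule abs_integral_le_const[OF measure_pmf.prob_space_axioms])
      (use power_mono[OF bnd abs_ge_zero, of _ 2] in auto)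
  ultimately obtain l where "u \<longlonglongrightarrow> l"
    by (metis abs_le_D1 incseq_convergent)
  then have "(\<lambda>n. u (Suc n) - u n) \<longlonglongrightarrow> l - l"
    by (intro tendsto_diff LIMSEQ_Suc)
  from tendsto_real_sqrt[OF tendsto_divide[OF this tendsto_const[of "pmf p s"]]]
  have lim1: "(\<lambda>n. sqrt ((u (Suc n) - u n) / pmf p s)) \<longlonglongrightarrow> 0"
    using ps by simp
  have le1: "(\<integral>y. \<bar>b (s + y) - b y\<bar> \<partial>walk p n) \<le> sqrt ((u (Suc n) - u n) / pmf p s)" for n
  proof (rule real_le_rsqrt)
    have "integrable (walk p n) (\<lambda>y. b (s + y) - b y)" "integrable (walk p n) (\<lambda>y. (b (s + y) - b y)\<^sup>2)"
      using bd sqd by (auto intro: integrable_pmf_bounded[where C="2 * C"] integrable_pmf_bounded[where C="(2 * C)\<^sup>2"])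
    then have "(\<integral>y. \<bar>b (s + y) - b y\<bar> \<partial>walk p n)\<^sup>2 \<le> (\<integral>y. (b (s + y) - b y)\<^sup>2 \<partial>walk p n)"
      by (rule square_integral_abs_le[OF measure_pmf.prob_space_axioms])
    moreover have "pmf p s * (\<integral>y. (b (s + y) - b y)\<^sup>2 \<partial>walk p n) \<le> u (Suc n) - u n"
      unfolding inc[symmetric]
      by (rule pmf_mult_le_integral) (auto intro!: integrable_pmf_bounded[where C="(2 * C)\<^sup>2"] Gb)
    ultimately have "pmf p s * (\<integral>y. \<bar>b (s + y) - b y\<bar> \<partial>walk p n)\<^sup>2 \<le> u (Suc n) - u n"
      using ps by (meson mult_left_mono order_trans less_imp_le)
    then show "(\<integral>y. \<bar>b (s + y) - b y\<bar> \<partial>walk p n)\<^sup>2 \<le> (u (Suc n) - u n) / pmf p s"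
      using ps by (simp add: pos_le_divide_eq mult.commute)
  qed
  have "(\<lambda>n. (\<integral>y. \<bar>b (g + y) - b y\<bar> \<partial>walk p (Suc n)) / pmf p s) \<longlonglongrightarrow> 0 / pmf p s"
    using ps by (intro tendsto_divide LIMSEQ_Suc[OF step(1)] tendsto_const) auto
  then have lim2: "(\<lambda>n. (\<integral>y. \<bar>b (g + y) - b y\<bar> \<partial>walk p (Suc n)) / pmf p s) \<longlonglongrightarrow> 0" by simp
  have le2: "(\<integral>y. \<bar>b (g + (s + y)) - b (s + y)\<bar> \<partial>walk p n)
      \<le> (\<integral>y. \<bar>b (g + y) - b y\<bar> \<partial>walk p (Suc n)) / pmf p s" for n
  proof -
    have i: "integrable (walk p (Suc n)) (\<lambda>y. \<bar>b (g + y) - b y\<bar>)"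
      by (rule integrable_pmf_bounded[where C="2 * C"]) (simp add: bd)
    have "pmf p s * (\<integral>y. \<bar>b (g + (s + y)) - b (s + y)\<bar> \<partial>walk p n)
        \<le> (\<integral>x. \<integral>y. \<bar>b (g + (x + y)) - b (x + y)\<bar> \<partial>walk p n \<partial>p)"
      by (rule pmf_mult_le_integral) (use integral_walk_Suc(2)[OF i] in auto)
    also have "\<dots> = (\<integral>y. \<bar>b (g + y) - b y\<bar> \<partial>walk p (Suc n))"
      by (rule integral_walk_Suc(1)[OF i, symmetric])
    finally show ?thesis using ps by (simp add: field_simps del: walk.simps)
  qed
  show ?case
  proof (rule tendsto_sandwich[OF _ _ tendsto_const])
    show "(\<lambda>n. (\<integral>y. \<bar>b (g + y) - b y\<bar> \<partial>walk p (Suc n)) / pmf p s + sqrt ((u (Suc n) - u n) / pmf p s)) \<longlonglongrightarrow> 0"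
      using tendsto_add[OF lim2 lim1] by simp
    show "\<forall>\<^sub>F n in sequentially. (\<integral>y. \<bar>b (g + s + y) - b y\<bar> \<partial>walk p n)
      \<le> (\<integral>y. \<bar>b (g + y) - b y\<bar> \<partial>walk p (Suc n)) / pmf p s + sqrt ((u (Suc n) - u n) / pmf p s)"
    proof (rule always_eventually, rule allI)
      fix n
      have "(\<integral>y. \<bar>b (g + s + y) - b y\<bar> \<partial>walk p n) \<le>
          (\<integral>y. \<bar>b (g + (s + y)) - b (s + y)\<bar> + \<bar>b (s + y) - b y\<bar> \<partial>walk p n)"
      proof (rule integral_mono)
        show "integrable (walk p n) (\<lambda>y. \<bar>b (g + (s + y)) - b (s + y)\<bar> + \<bar>b (s + y) - b y\<bar>)"
          by (intro Bochner_Integration.integrable_add integrable_pmf_bounded[where C="2 * C"]) (auto simp: bd)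
        show "\<bar>b (g + s + y) - b y\<bar> \<le> \<bar>b (g + (s + y)) - b (s + y)\<bar> + \<bar>b (s + y) - b y\<bar>" for y
          unfolding add.assoc by linarith
      qed (rule integrable_pmf_bounded[where C="2 * C"], simp add: bd)
      also have "\<dots> = (\<integral>y. \<bar>b (g + (s + y)) - b (s + y)\<bar> \<partial>walk p n) + (\<integral>y. \<bar>b (s + y) - b y\<bar> \<partial>walk p n)"
        by (intro Bochner_Integration.integral_add integrable_pmf_bounded[where C="2 * C"]) (auto simp: bd)
      also note add_mono[OF le2 le1]
      finally show "(\<integral>y. \<bar>b (g + s + y) - b y\<bar> \<partial>walk p n)
        \<le> (\<integral>y. \<bar>b (g + y) - b y\<bar> \<partial>walk p (Suc n)) / pmf p s + sqrt ((u (Suc n) - u n) / pmf p s)" .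
    qed
  qed simp
qed

end

section \<open>Harmonic functions near a quasimorphism\<close>

text \<open>A quasimorphism \<open>\<phi>o\<close> with defect at most \<open>D\<close>, integrable with respect to the step law.\<close>

locale qm_walk = symmetric_walk p
  for p :: "'g::{group_add,countable} pmf" +
  fixes \<phi>o :: "'g \<Rightarrow> real" and D :: real
  assumes qm: "\<And>g h. \<bar>\<phi>o (g + h) - \<phi>o g - \<phi>o h\<bar> \<le> D"
    and zero: "\<phi>o 0 = 0"
    and integrable_p: "integrable p \<phi>o"
begin

lemma D_nonneg: "0 \<le> D"
  using qm[of 0 0] by linarith

text \<open>The uniform distance to \<open>\<phi>o\<close> is at most \<open>C\<close>.\<close>

definition near :: "real \<Rightarrow> ('g \<Rightarrow> real) \<Rightarrow> bool" where
  "near C \<phi> \<longleftrightarrow> (\<forall>g. \<bar>\<phi> g - \<phi>o g\<bar> \<le> C)"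

lemma nearD: "near C \<phi> \<Longrightarrow> \<bar>\<phi> g - \<phi>o g\<bar> \<le> C"
  by (simp add: near_def)

lemma near_translate_abs_le:
  assumes "near C \<phi>"
  shows "\<bar>\<phi> (a + x + b)\<bar> \<le> \<bar>\<phi>o x\<bar> + (\<bar>\<phi>o a\<bar> + \<bar>\<phi>o b\<bar> + 2 * D + C)"
  using nearD[OF assms, of "a + x + b"] qm[of "a + x" b] qm[of a x] by linarith

lemma integrable_translate:
  fixes q :: "'g pmf"
  assumes q: "integrable q \<phi>o" and \<phi>: "near C \<phi>"
  shows "integrable q (\<lambda>x. \<phi> (a + x + b))" "integrable q (\<lambda>x. \<phi> (x + b))"
    "integrable q (\<lambda>x. \<phi> (a + x))" "integrable q \<phi>"
proof -
  have *: "integrable q (\<lambda>x. \<phi> (a + x + b))" for a b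
    by (rule Bochner_Integration.integrable_bound[where f="\<lambda>x. \<bar>\<phi>o x\<bar> + (\<bar>\<phi>o a\<bar> + \<bar>\<phi>o b\<bar> + 2 * D + C)"])
      (use q near_translate_abs_le[OF \<phi>, of a _ b] in \<open>auto intro!: AE_I2 order_trans[OF _ abs_ge_self]\<close>)
  show "integrable q (\<lambda>x. \<phi> (a + x + b))" "integrable q (\<lambda>x. \<phi> (x + b))"
    "integrable q (\<lambda>x. \<phi> (a + x))" "integrable q \<phi>"
    using *[of a b] *[of 0 b] *[of a 0] *[of 0 0] by simp_all
qed

lemma near_self: "near 0 \<phi>o"
  by (simp add: near_def)

lemma integrable_walk: "integrable (walk p n) \<phi>o"
proof (induction n)
  case 0
  show ?case by (simp add: integrable_measure_pmf_finite)
next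
  case (Suc n)
  let ?Q = "pair_pmf p (walk p n)"
  have "integrable (map_pmf fst ?Q) \<phi>o" "integrable (map_pmf snd ?Q) \<phi>o"
    using Suc.IH integrable_p by (simp_all only: map_fst_pair_pmf map_snd_pair_pmf)
  then have "integrable ?Q (\<lambda>z. \<bar>\<phi>o (fst z)\<bar> + \<bar>\<phi>o (snd z)\<bar> + D)"
    by (simp add: integrable_map_pmf_eq)
  then have "integrable ?Q (\<lambda>z. \<phi>o (fst z + snd z))"
  proof (rule Bochner_Integration.integrable_bound)
    show "AE z in ?Q. norm (\<phi>o (fst z + snd z)) \<le> norm (\<bar>\<phi>o (fst z)\<bar> + \<bar>\<phi>o (snd z)\<bar> + D)"
    proof (rule AE_I2)
      fix z show "norm (\<phi>o (fst z + snd z)) \<le> norm (\<bar>\<phi>o (fst z)\<bar> + \<bar>\<phi>o (snd z)\<bar> + D)"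
        using qm[of "fst z" "snd z"] by simp
    qed
  qed simp
  then show ?case by (simp add: integrable_map_pmf_eq case_prod_beta')
qed

lemma harmonic_set_iff:
  "\<psi> \<in> harmonic_set p \<phi>o \<longleftrightarrow>
    \<psi> \<in> F0 \<and> (\<forall>g. (\<integral>x. \<psi> (x + g) \<partial>p) = \<psi> g) \<and> (\<exists>C. near C \<psi>)"
  unfolding harmonic_set_def bounded_distance_def near_def
  by (auto simp: fun_eq_iff conv_left bounded_iff)

text \<open>The orbits of two elements of the harmonic set approach each other in mean along the walk.\<close>

lemma harmonic_set_contraction:
  assumes \<phi>: "\<phi> \<in> harmonic_set p \<phi>o" and \<psi>: "\<psi> \<in> harmonic_set p \<phi>o"
  shows "(\<lambda>n. \<integral>x. dist (act0 x \<phi>) (act0 x \<psi>) \<partial>walk p n) \<longlonglongrightarrow> 0"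
proof -
  obtain C C' where C: "near C \<phi>" "near C' \<psi>"
    using \<phi> \<psi> by (auto simp: harmonic_set_iff)
  define b where "b g = \<phi> g - \<psi> g" for g
  have bnd: "\<bar>b g\<bar> \<le> C + C'" for g
    using nearD[OF C(1), of g] nearD[OF C(2), of g] unfolding b_def by linarith
  have harm: "(\<integral>x. b (x + g) \<partial>p) = b g" for g
    using \<phi> \<psi> integrable_translate(2)[OF integrable_p C(1)] integrable_translate(2)[OF integrable_p C(2)]
    by (simp add: b_def harmonic_set_iff)
  have e: "act0 x \<phi> g - act0 x \<psi> g = b (g + x) - b x" for x g
    by (simp add: act0_def b_def)
  show ?thesis
  proof (rule tendsto_integral_dist_fun)
    show "integrable (walk p n) (\<lambda>x. \<bar>act0 x \<phi> g - act0 x \<psi> g\<bar>)" for n g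
    proof (rule integrable_pmf_bounded)
      show "\<bar>\<bar>act0 x \<phi> g - act0 x \<psi> g\<bar>\<bar> \<le> 2 * (C + C')" for x
        unfolding e using bnd[of "g + x"] bnd[of x] by (simp add: abs_if split: if_splits)
    qed
    show "(\<lambda>n. \<integral>x. \<bar>act0 x \<phi> g - act0 x \<psi> g\<bar> \<partial>walk p n) \<longlonglongrightarrow> 0" for g
      unfolding e by (rule harmonic_increment_tendsto_0[OF bnd harm])
  qed (auto simp: measure_pmf.prob_space_axioms)
qed

text \<open>The functions whose whole orbit stays within distance \<open>C\<close> of \<open>\<phi>o\<close>. Unlike the condition
  \<open>near C\<close> on \<open>\<phi>\<close> alone, this one is invariant under the action.\<close>

definition tube :: "real \<Rightarrow> ('g \<Rightarrow> real) set" where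
  "tube C = {\<phi> \<in> F0. \<forall>\<gamma>. near C (act0 \<gamma> \<phi>)}"

lemma tube_near: "\<phi> \<in> tube C \<Longrightarrow> near C \<phi>"
  using act0_zero[of \<phi>] by (auto simp: tube_def dest: spec[of _ 0])

lemma tube_F0: "\<phi> \<in> tube C \<Longrightarrow> \<phi> \<in> F0"
  by (simp add: tube_def)

lemma tube_act0: "\<phi> \<in> tube C \<Longrightarrow> act0 \<gamma> \<phi> \<in> tube C"
  by (simp add: tube_def act0_in_F0 act0_add[symmetric])

lemma tube_mono: "C \<le> C' \<Longrightarrow> tube C \<subseteq> tube C'"
  by (auto simp: tube_def near_def intro: order_trans)

lemma near_imp_tube:
  assumes "near C \<phi>" "\<phi> \<in> F0"
  shows "\<phi> \<in> tube (2 * C + D)"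
proof -
  have "\<bar>act0 \<gamma> \<phi> g - \<phi>o g\<bar> \<le> 2 * C + D" for \<gamma> g
    using nearD[OF assms(1), of "g + \<gamma>"] nearD[OF assms(1), of \<gamma>] qm[of g \<gamma>]
    unfolding act0_def by linarith
  then show ?thesis using assms(2) by (simp add: tube_def near_def)
qed

lemma closed_tube: "closed (tube C)"
proof -
  have "tube C = F0 \<inter> (\<Inter>\<gamma>. \<Inter>g. {\<phi>. \<bar>\<phi> (g + \<gamma>) - \<phi> \<gamma> - \<phi>o g\<bar> \<le> C})"
    by (auto simp: tube_def near_def act0_def)
  also have "closed \<dots>"
    by (intro closed_Int closed_F0 closed_INT ballI closed_Collect_le continuous_intros)
  finally show ?thesis .
qed

text \<open>The left-harmonic elements of a tube. These sets are closed and invariant, and the harmonic set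
  is their union over integer radii, which is therefore Borel.\<close>

definition harmonic_tube :: "real \<Rightarrow> ('g \<Rightarrow> real) set" where
  "harmonic_tube C = {\<phi> \<in> tube C. \<forall>g. (\<integral>x. \<phi> (x + g) \<partial>p) = \<phi> g}"

lemma tendsto_coordinate: "(X \<longlongrightarrow> l) F \<Longrightarrow> ((\<lambda>i. (X i :: 'g \<Rightarrow> real) g) \<longlongrightarrow> l g) F"
  using continuous_on_tendsto_compose[OF continuous_on_coordinate[of UNIV g]] by simp

lemma closed_harmonic_tube: "closed (harmonic_tube C)"
  unfolding closed_sequential_limits
proof (intro allI impI, elim conjE)
  fix X l assume X: "\<forall>n. X n \<in> harmonic_tube C" and lim: "X \<longlonglongrightarrow> l"
  have l: "l \<in> tube C"
    using X lim closed_tube[of C] unfolding closed_sequential_limits harmonic_tube_def by blast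
  have "(\<integral>x. l (x + g) \<partial>p) = l g" for g
  proof -
    have n: "near C (X n)" for n using X tube_near by (auto simp: harmonic_tube_def)
    have "(\<lambda>n. \<integral>x. X n (x + g) \<partial>p) \<longlonglongrightarrow> (\<integral>x. l (x + g) \<partial>p)"
    proof (rule integral_dominated_convergence[where w="\<lambda>x. \<bar>\<phi>o x\<bar> + (\<bar>\<phi>o 0\<bar> + \<bar>\<phi>o g\<bar> + 2 * D + C)"])
      show "AE x in p. norm (X n (x + g)) \<le> \<bar>\<phi>o x\<bar> + (\<bar>\<phi>o 0\<bar> + \<bar>\<phi>o g\<bar> + 2 * D + C)" for n
        using near_translate_abs_le[OF n[of n], of 0 _ g] by (auto intro!: AE_I2)
    qed (use integrable_p in \<open>auto intro!: tendsto_coordinate lim\<close>)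
    moreover have "(\<lambda>n. \<integral>x. X n (x + g) \<partial>p) = (\<lambda>n. X n g)"
      using X by (auto simp: harmonic_tube_def)
    ultimately show ?thesis
      using tendsto_coordinate[OF lim, of g] LIMSEQ_unique by auto
  qed
  with l show "l \<in> harmonic_tube C" by (simp add: harmonic_tube_def)
qed

lemma harmonic_tube_act0:
  assumes "\<phi> \<in> harmonic_tube C" shows "act0 \<gamma> \<phi> \<in> harmonic_tube C"
proof -
  have n: "near C \<phi>" using assms tube_near by (auto simp: harmonic_tube_def)
  have "(\<integral>x. \<phi> (x + (g + \<gamma>)) - \<phi> \<gamma> \<partial>p) = \<phi> (g + \<gamma>) - \<phi> \<gamma>" for g
    using assms integrable_translate(2)[OF integrable_p n, of "g + \<gamma>"] by (simp add: harmonic_tube_def)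
  then show ?thesis
    using assms tube_act0[of \<phi> C \<gamma>] by (simp add: harmonic_tube_def act0_def add.assoc)
qed

lemma harmonic_set_eq: "harmonic_set p \<phi>o = (\<Union>n. harmonic_tube (real n))"
proof (intro set_eqI iffI)
  fix \<psi> assume \<psi>: "\<psi> \<in> harmonic_set p \<phi>o"
  then obtain C where C: "near C \<psi>" by (auto simp: harmonic_set_iff)
  obtain n where "2 * C + D \<le> real n" using real_arch_simple by blast
  then have "\<psi> \<in> tube (real n)"
    using near_imp_tube[OF C] tube_mono \<psi> by (auto simp: harmonic_set_iff)
  then show "\<psi> \<in> (\<Union>n. harmonic_tube (real n))"
    using \<psi> by (auto simp: harmonic_tube_def harmonic_set_iff)
qed (auto simp: harmonic_tube_def harmonic_set_iff dest: tube_near tube_F0)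

lemma harmonic_set_borel [measurable]: "harmonic_set p \<phi>o \<in> sets borel"
  unfolding harmonic_set_eq by (intro sets.countable_UN image_subsetI borel_closed closed_harmonic_tube)

lemma harmonic_set_F0: "harmonic_set p \<phi>o \<subseteq> F0"
  by (auto simp: harmonic_set_def)

lemma harmonic_set_act0: "\<phi> \<in> harmonic_set p \<phi>o \<Longrightarrow> act0 \<gamma> \<phi> \<in> harmonic_set p \<phi>o"
  by (auto simp: harmonic_set_eq intro: harmonic_tube_act0)

lemma orbit_closure_harmonic: "\<psi> \<in> harmonic_set p \<phi>o \<Longrightarrow> orbit_closure \<psi> \<subseteq> harmonic_set p \<phi>o"
  unfolding harmonic_set_eq
  using orbit_closure_subset[OF harmonic_tube_act0 closed_harmonic_tube] by blast

lemma closed_harmonic_core: "closed (harmonic_core p \<phi>o)"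
  unfolding harmonic_core_def by (intro closed_INT ballI closed_orbit_closure)

lemma harmonic_core_borel [measurable]: "harmonic_core p \<phi>o \<in> sets borel"
  by (rule borel_closed[OF closed_harmonic_core])

lemma harmonic_core_act0: "\<phi> \<in> harmonic_core p \<phi>o \<Longrightarrow> act0 \<gamma> \<phi> \<in> harmonic_core p \<phi>o"
  by (auto simp: harmonic_core_def intro: orbit_closure_act0)

lemma harmonic_core_subset:
  assumes "harmonic_set p \<phi>o \<noteq> {}"
  shows "harmonic_core p \<phi>o \<subseteq> harmonic_set p \<phi>o"
  using assms orbit_closure_harmonic unfolding harmonic_core_def by blast

section \<open>Uniqueness of stationary measures\<close>

text \<open>The means on the left do not depend on \<open>\<nu>\<close>, whence uniqueness; for \<open>F\<close> vanishing on the orbit of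
  \<open>\<psi>\<close> they are \<open>0\<close>, whence the support of \<open>\<nu>\<close>.\<close>

lemma stationary_lipschitz_limit:
  assumes st: "stationary_on p X \<nu>" and X: "X \<subseteq> harmonic_set p \<phi>o" and \<psi>: "\<psi> \<in> harmonic_set p \<phi>o"
    and F: "L-lipschitz_on UNIV F" "\<And>x. \<bar>F x\<bar> \<le> C"
  shows "(\<lambda>n. \<integral>x. F (act0 x \<psi>) \<partial>walk p n) \<longlonglongrightarrow> (\<integral>\<phi>. F \<phi> \<partial>\<nu> :: real)"
proof -
  have sets: "sets \<nu> = sets (restrict_space borel X)" and st': "stationary p act0 \<nu>"
    using st by (auto simp: stationary_on_def)
  have sp: "space \<nu> = X"
    using sets_eq_imp_space_eq[OF sets] by (simp add: space_restrict_space)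
  interpret \<nu>: prob_space \<nu> using st' by (simp add: stationary_def)
  have meas: "f \<in> borel_measurable \<nu>" if "f \<in> borel_measurable borel" for f :: "('g \<Rightarrow> real) \<Rightarrow> real"
    using measurable_restrict_space1[OF that] sets by (simp cong: measurable_cong_sets)
  have [measurable]: "F \<in> borel_measurable borel"
    by (rule borel_measurable_continuous_onI[OF lipschitz_on_continuous_on[OF F(1)]])
  have L: "L \<ge> 0" using F(1) by (simp add: lipschitz_on_def)
  define d where "d = (\<lambda>x \<phi>. dist (act0 x \<phi>) (act0 x \<psi>))"
  have d2: "\<bar>d x \<phi>\<bar> \<le> 2" for x \<phi> by (simp add: d_def dist_fun_le_2)
  have dm[measurable]: "d x \<in> borel_measurable \<nu>" for x
    unfolding d_def by (rule meas) measurable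
  have Fd: "\<bar>F (act0 x \<phi>) - F (act0 x \<psi>)\<bar> \<le> L * d x \<phi>" for x \<phi>
    using lipschitz_onD[OF F(1), of "act0 x \<phi>" "act0 x \<psi>"] by (simp add: dist_real_def d_def)
  have Fm[measurable]: "(\<lambda>\<phi>. F (act0 x \<phi>)) \<in> borel_measurable \<nu>" for x by (rule meas) measurable
  have C: "C \<ge> 0" using F(2) order_trans[OF abs_ge_zero] by blast
  have bound: "\<bar>(\<integral>\<phi>. F \<phi> \<partial>\<nu>) - (\<integral>x. F (act0 x \<psi>) \<partial>walk p n)\<bar> \<le> L * (\<integral>\<phi>. \<integral>x. d x \<phi> \<partial>walk p n \<partial>\<nu>)" for n
  proof -
    interpret pair_prob_space "measure_pmf (walk p n)" \<nu>
      by (intro pair_prob_space.intro pair_sigma_finite.intro \<nu>.prob_space_axioms measure_pmf.prob_space_axioms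
        prob_space_imp_sigma_finite)
    have dint: "integrable (measure_pmf (walk p n) \<Otimes>\<^sub>M \<nu>) (\<lambda>(x, \<phi>). d x \<phi>)"
      by (rule P.integrable_const_bound[where B=2]) (auto intro!: AE_I2 measurable_pmf_pair simp: d2)
    have Fi: "integrable \<nu> (\<lambda>\<phi>. F (act0 x \<phi>))" for x
      by (rule \<nu>.integrable_const_bound[where B=C]) (auto simp: F(2))
    have di: "integrable \<nu> (d x)" for x
      by (rule \<nu>.integrable_const_bound[where B=2]) (auto simp: d2)
    have b1: "\<bar>\<integral>\<phi>. F (act0 x \<phi>) \<partial>\<nu>\<bar> \<le> C" for x
      by (rule abs_integral_le_const[OF \<nu>.prob_space_axioms]) (auto simp: F(2) C)
    have i1: "integrable (walk p n) (\<lambda>x. \<integral>\<phi>. F (act0 x \<phi>) \<partial>\<nu>)"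
      by (rule integrable_pmf_bounded[OF b1])
    have i2: "integrable (walk p n) (\<lambda>x. F (act0 x \<psi>))"
      by (rule integrable_pmf_bounded[OF F(2)])
    have i3: "integrable (walk p n) (\<lambda>x. \<integral>\<phi>. d x \<phi> \<partial>\<nu>)"
      by (rule integrable_pmf_bounded, rule abs_integral_le_const[OF \<nu>.prob_space_axioms, where C=2]) (auto simp: d2)
    have "(\<integral>\<phi>. F \<phi> \<partial>\<nu>) = (\<integral>x. \<integral>\<phi>. F (act0 x \<phi>) \<partial>\<nu> \<partial>walk p n)"
      by (rule stationary_integral_walk[OF st', where C=C]) (auto simp: F(2) intro: meas)
    then have "\<bar>(\<integral>\<phi>. F \<phi> \<partial>\<nu>) - (\<integral>x. F (act0 x \<psi>) \<partial>walk p n)\<bar> =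
        \<bar>\<integral>x. (\<integral>\<phi>. F (act0 x \<phi>) \<partial>\<nu>) - F (act0 x \<psi>) \<partial>walk p n\<bar>"
      using i1 i2 by simp
    also have "\<dots> \<le> (\<integral>x. \<bar>(\<integral>\<phi>. F (act0 x \<phi>) \<partial>\<nu>) - F (act0 x \<psi>)\<bar> \<partial>walk p n)"
      by (rule integral_abs_bound)
    also have "\<dots> \<le> (\<integral>x. L * (\<integral>\<phi>. d x \<phi> \<partial>\<nu>) \<partial>walk p n)"
    proof (rule integral_mono)
      show "\<bar>(\<integral>\<phi>. F (act0 x \<phi>) \<partial>\<nu>) - F (act0 x \<psi>)\<bar> \<le> L * (\<integral>\<phi>. d x \<phi> \<partial>\<nu>)" for x
      proof -
        have "(\<integral>\<phi>. F (act0 x \<phi>) \<partial>\<nu>) - F (act0 x \<psi>) = (\<integral>\<phi>. F (act0 x \<phi>) - F (act0 x \<psi>) \<partial>\<nu>)"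
          using Fi by (simp add: \<nu>.prob_space)
        also have "\<bar>\<dots>\<bar> \<le> (\<integral>\<phi>. \<bar>F (act0 x \<phi>) - F (act0 x \<psi>)\<bar> \<partial>\<nu>)"
          by (rule integral_abs_bound)
        also have "\<dots> \<le> (\<integral>\<phi>. L * d x \<phi> \<partial>\<nu>)"
          using Fi di by (intro integral_mono) (auto simp: Fd)
        finally show ?thesis by simp
      qed
    qed (use i1 i2 i3 in auto)
    also have "\<dots> = L * (\<integral>\<phi>. \<integral>x. d x \<phi> \<partial>walk p n \<partial>\<nu>)"
      using Fubini_integral[OF dint] by simp
    finally show ?thesis .
  qed
  have "(\<lambda>n. \<integral>\<phi>. \<integral>x. d x \<phi> \<partial>walk p n \<partial>\<nu>) \<longlonglongrightarrow> (\<integral>\<phi>. 0 \<partial>\<nu>)"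
  proof (rule integral_dominated_convergence[where w="\<lambda>_. 2"])
    show "AE \<phi> in \<nu>. (\<lambda>n. \<integral>x. d x \<phi> \<partial>walk p n) \<longlonglongrightarrow> 0"
      using X sp harmonic_set_contraction[OF _ \<psi>] by (intro AE_I2) (auto simp: d_def)
    show "AE \<phi> in \<nu>. norm (\<integral>x. d x \<phi> \<partial>walk p n) \<le> 2" for n
      unfolding real_norm_def
      by (intro AE_I2 abs_integral_le_const[OF measure_pmf.prob_space_axioms]) (auto simp: d2)
    show "(\<lambda>\<phi>. \<integral>x. d x \<phi> \<partial>walk p n) \<in> borel_measurable \<nu>" for n
      by (rule borel_measurable_integral_pmf[OF dm])
  qed auto
  then have "(\<lambda>n. L * (\<integral>\<phi>. \<integral>x. d x \<phi> \<partial>walk p n \<partial>\<nu>)) \<longlonglongrightarrow> L * 0"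
    by (intro tendsto_intros) simp
  then have "(\<lambda>n. (\<integral>\<phi>. F \<phi> \<partial>\<nu>) - (\<integral>x. F (act0 x \<psi>) \<partial>walk p n)) \<longlonglongrightarrow> 0"
    by (rule_tac Lim_null_comparison[rotated]) (use bound in auto)
  then have "(\<lambda>n. (\<integral>\<phi>. F \<phi> \<partial>\<nu>) - ((\<integral>\<phi>. F \<phi> \<partial>\<nu>) - (\<integral>x. F (act0 x \<psi>) \<partial>walk p n))) \<longlonglongrightarrow> (\<integral>\<phi>. F \<phi> \<partial>\<nu>) - 0"
    by (intro tendsto_intros)
  then show ?thesis by simp
qed

lemma stationary_on_prob:
  assumes "stationary_on p X \<nu>"
  shows "prob_space \<nu>" "sets \<nu> = sets (restrict_space borel X)" "space \<nu> = X" "stationary p act0 \<nu>"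
proof -
  show s: "sets \<nu> = sets (restrict_space borel X)" "stationary p act0 \<nu>" "prob_space \<nu>"
    using assms by (auto simp: stationary_on_def stationary_def)
  show "space \<nu> = X"
    using sets_eq_imp_space_eq[OF s(1)] by (simp add: space_restrict_space)
qed

lemma stationary_unique:
  assumes 1: "stationary_on p X \<nu>1" and 2: "stationary_on p X \<nu>2" and X: "X \<subseteq> harmonic_set p \<phi>o"
  shows "\<nu>1 = \<nu>2"
proof -
  note s1 = stationary_on_prob[OF 1] and s2 = stationary_on_prob[OF 2]
  obtain \<psi> where \<psi>: "\<psi> \<in> harmonic_set p \<phi>o"
    using prob_space.not_empty[OF s1(1)] s1(3) X by auto
  have m: "(\<lambda>x. x) \<in> \<nu> \<rightarrow>\<^sub>M borel" if "sets \<nu> = sets (restrict_space borel X)" for \<nu> :: "('g \<Rightarrow> real) measure"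
    using measurable_restrict_space1[of "\<lambda>x. x" borel borel X] that by (simp cong: measurable_cong_sets)
  have "distr \<nu>1 borel (\<lambda>x. x) = distr \<nu>2 borel (\<lambda>x. x)"
  proof (rule finite_measure_eqI_lipschitz)
    fix F :: "('g \<Rightarrow> real) \<Rightarrow> real" and L
    assume F: "L-lipschitz_on UNIV F" "\<And>x. \<bar>F x\<bar> \<le> 1"
    have [measurable]: "F \<in> borel_measurable borel"
      by (rule borel_measurable_continuous_onI[OF lipschitz_on_continuous_on[OF F(1)]])
    have "(\<integral>x. F x \<partial>\<nu>1) = (\<integral>x. F x \<partial>\<nu>2)"
      by (rule LIMSEQ_unique[OF stationary_lipschitz_limit[OF 1 X \<psi> F] stationary_lipschitz_limit[OF 2 X \<psi> F]])
    then show "(\<integral>x. F x \<partial>distr \<nu>1 borel (\<lambda>x. x)) = (\<integral>x. F x \<partial>distr \<nu>2 borel (\<lambda>x. x))"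
      by (simp add: integral_distr[OF m[OF s1(2)]] integral_distr[OF m[OF s2(2)]])
  qed (auto intro!: prob_space.prob_space_distr s1 s2 m)
  then have e: "emeasure (distr \<nu>1 borel (\<lambda>x. x)) A = emeasure (distr \<nu>2 borel (\<lambda>x. x)) A" for A by simp
  show ?thesis
  proof (rule measure_eqI)
    show "sets \<nu>1 = sets \<nu>2" by (simp add: s1 s2)
    fix A assume "A \<in> sets \<nu>1"
    then obtain B where B: "A = B \<inter> X" "B \<in> sets borel"
      by (auto simp: s1(2) sets_restrict_space)
    show "emeasure \<nu>1 A = emeasure \<nu>2 A"
      using e[of B] B by (simp add: emeasure_distr[OF m[OF s1(2)]] emeasure_distr[OF m[OF s2(2)]] s1(3) s2(3) vimage_def Int_def)
  qed
qed

lemma stationary_core: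
  assumes st: "stationary_on p X \<nu>" and X: "X \<subseteq> harmonic_set p \<phi>o"
  shows "AE \<phi> in \<nu>. \<phi> \<in> harmonic_core p \<phi>o"
proof -
  note s = stationary_on_prob[OF st]
  interpret \<nu>: prob_space \<nu> by (rule s)
  have meas: "f \<in> borel_measurable \<nu>" if "f \<in> borel_measurable borel" for f :: "('g \<Rightarrow> real) \<Rightarrow> real"
    using measurable_restrict_space1[OF that] s(2) by (simp cong: measurable_cong_sets)
  have 1: "AE \<phi> in \<nu>. \<phi> \<in> orbit_closure \<psi>" if \<psi>: "\<psi> \<in> harmonic_set p \<phi>o" for \<psi>
  proof -
    \<comment> \<open>The orbit of \<open>\<psi>\<close> stays in its closure, where \<open>F\<close> vanishes.\<close>
    define F where "F = (\<lambda>\<phi>. min 1 (infdist \<phi> (orbit_closure \<psi>)))"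
    have lip: "1-lipschitz_on UNIV F"
    proof (rule lipschitz_onI)
      fix x y
      show "dist (F x) (F y) \<le> 1 * dist x y"
        using infdist_triangle_abs[of x "orbit_closure \<psi>" y] unfolding F_def dist_real_def by linarith
    qed simp
    have Fm: "F \<in> borel_measurable borel"
      by (rule borel_measurable_continuous_onI[OF lipschitz_on_continuous_on[OF lip]])
    have b: "\<bar>F x\<bar> \<le> 1" for x by (simp add: F_def infdist_nonneg)
    have orb: "act0 x \<psi> \<in> orbit_closure \<psi>" for x
      unfolding orbit_closure_def by (rule subsetD[OF closure_subset]) simp
    have "(\<lambda>n. \<integral>x. F (act0 x \<psi>) \<partial>walk p n) \<longlonglongrightarrow> (\<integral>\<phi>. F \<phi> \<partial>\<nu>)"
      by (rule stationary_lipschitz_limit[OF st X \<psi> lip b])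
    moreover have "F (act0 x \<psi>) = 0" for x using orb by (simp add: F_def)
    ultimately have "(\<integral>\<phi>. F \<phi> \<partial>\<nu>) = 0"
      by (simp add: LIMSEQ_const_iff)
    then have "AE \<phi> in \<nu>. F \<phi> = 0"
      by (subst (asm) integral_nonneg_eq_0_iff_AE)
        (use meas[OF Fm] b in \<open>auto intro!: \<nu>.integrable_const_bound[where B=1] AE_I2 simp: F_def infdist_nonneg\<close>)
    then show ?thesis
    proof eventually_elim
      case (elim \<phi>)
      then have "infdist \<phi> (orbit_closure \<psi>) = 0" by (auto simp: F_def min_def split: if_splits)
      then show ?case
        using in_closed_iff_infdist_zero[OF closed_orbit_closure[of \<psi>]] orb by blast
    qed
  qed
  \<comment> \<open>By the Lindelof property, countably many of the orbit closures have the same intersection.\<close>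
  obtain \<F> where \<F>: "\<F> \<subseteq> (\<lambda>\<psi>. - orbit_closure \<psi>) ` harmonic_set p \<phi>o" "countable \<F>"
    "\<Union>\<F> = \<Union>((\<lambda>\<psi>. - orbit_closure \<psi>) ` harmonic_set p \<phi>o)"
    by (rule Lindelof[of "(\<lambda>\<psi>. - orbit_closure \<psi>) ` harmonic_set p \<phi>o"]) (auto simp: closed_orbit_closure open_Compl)
  have "AE \<phi> in \<nu>. \<forall>A\<in>\<F>. \<phi> \<notin> A"
    using \<F>(1) 1 by (subst AE_ball_countable[OF \<F>(2)]) auto
  then show ?thesis
  proof eventually_elim
    case (elim \<phi>)
    then have "\<phi> \<notin> \<Union>\<F>" by auto
    then show ?case unfolding \<F>(3) by (auto simp: harmonic_core_def)
  qed
qed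

lemma stationary_measure_core:
  assumes st: "stationary_on p X \<nu>" and X: "X \<subseteq> harmonic_set p \<phi>o"
  shows "harmonic_core p \<phi>o \<subseteq> harmonic_set p \<phi>o" and "harmonic_core p \<phi>o \<noteq> {}"
    and "X = harmonic_set p \<phi>o \<Longrightarrow> measure \<nu> (harmonic_core p \<phi>o) = 1"
proof -
  note s = stationary_on_prob[OF st]
  interpret \<nu>: prob_space \<nu> by (rule s)
  show sub: "harmonic_core p \<phi>o \<subseteq> harmonic_set p \<phi>o"
    using prob_space.not_empty[OF s(1)] s(3) X by (intro harmonic_core_subset) auto
  show "harmonic_core p \<phi>o \<noteq> {}"
    using stationary_core[OF st X] \<nu>.AE_False by fastforce
  assume "X = harmonic_set p \<phi>o"
  then have "harmonic_core p \<phi>o \<in> sets \<nu>"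
    using sub by (auto simp: s(2) sets_restrict_space intro!: image_eqI[where x="harmonic_core p \<phi>o"])
  then show "measure \<nu> (harmonic_core p \<phi>o) = 1"
    using stationary_core[OF st X] \<nu>.AE_in_set_eq_1 by blast
qed

end

section \<open>Harmonic corrections along a stationary measure\<close>

text \<open>If the solutions \<open>c n\<close> of the recursion \<open>c (n + 1) = f + P (c n)\<close>, where
  \<open>P u x\<close> is the mean of \<open>u (a y x)\<close> over \<open>y\<close>, are uniformly bounded, then
  \<open>S = limsup c n\<close> satisfies \<open>S \<le> f + P S\<close>. Both sides have the same integral with respect to a
  stationary measure, so they agree almost everywhere.\<close>

lemma stationary_cohomological_equation:
  fixes p :: "'g::{group_add,countable} pmf" and c :: "nat \<Rightarrow> 'b \<Rightarrow> real"
  assumes st: "stationary p a M"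
    and cm[measurable]: "\<And>n. c n \<in> borel_measurable M"
    and cK: "\<And>n x. \<bar>c n x\<bar> \<le> K"
    and fm[measurable]: "f \<in> borel_measurable M"
    and rec: "AE x in M. \<forall>n. c (Suc n) x = f x + (\<integral>y. c n (a y x) \<partial>p)"
  defines "S \<equiv> \<lambda>x. INF m. SUP n\<in>{m..}. c n x"
  shows "AE x in M. S x = f x + (\<integral>y. S (a y x) \<partial>p)"
    and "\<And>x. \<bar>S x\<bar> \<le> K" and "S \<in> borel_measurable M"
proof -
  have M: "prob_space M" and a: "measurable_action a M"
    using st by (auto simp: stationary_def)
  interpret M: prob_space M by fact
  have am[measurable]: "a \<gamma> \<in> measurable M M" for \<gamma>
    using a by (simp add: measurable_action_def)
  have K0: "0 \<le> K" using cK order_trans[OF abs_ge_zero] by blast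
  define T where "T m x = (SUP n\<in>{m..}. c n x)" for m x
  have bdd: "bdd_above ((\<lambda>n. c n x) ` {m..})" for m x
    using cK by (intro bdd_aboveI2[where M=K]) (auto simp: abs_le_iff)
  have cT: "c n x \<le> T m x" if "m \<le> n" for n m x
    unfolding T_def using that bdd by (intro cSUP_upper) auto
  have TK: "\<bar>T m x\<bar> \<le> K" for m x
  proof -
    have "T m x \<le> K"
      unfolding T_def using cK by (intro cSUP_least) (auto simp: abs_le_iff)
    moreover have "- K \<le> T m x"
      using cT[of m m x] cK[of m x] by linarith
    ultimately show ?thesis by simp
  qed
  have Tm[measurable]: "T m \<in> borel_measurable M" for m
    unfolding T_def using bdd by (intro borel_measurable_cSUP) auto
  have Tdec: "decseq (\<lambda>m. T m x)" for x
    unfolding decseq_def T_def using bdd by (auto intro!: cSUP_subset_mono)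
  have "bdd_below (range (\<lambda>m. T m x))" for x
    using TK by (intro bdd_belowI2[where m="- K"]) (auto simp: abs_le_iff minus_le_iff)
  then have lim: "(\<lambda>m. T m x) \<longlonglongrightarrow> S x" for x
    unfolding S_def T_def[symmetric] by (intro LIMSEQ_decseq_INF Tdec)
  show SK: "\<bar>S x\<bar> \<le> K" for x
    using LIMSEQ_le_const2[OF tendsto_rabs[OF lim[of x]]] TK by blast
  show Sm[measurable]: "S \<in> borel_measurable M"
    by (rule borel_measurable_LIMSEQ_real[OF lim Tm])
  have cint: "integrable M (c n)" for n
    by (rule M.integrable_const_bound[where B=K]) (auto simp: cK)
  have Tint: "integrable M (T m)" for m
    by (rule M.integrable_const_bound[where B=K]) (auto simp: TK)
  have Sint: "integrable M S"
    by (rule M.integrable_const_bound[where B=K]) (auto simp: SK)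
  note P_c = stationary_integral(2,3)[OF st cm cK]
    and P_S = stationary_integral(2,3)[OF st Sm SK]
  have Pb: "\<bar>\<integral>y. c n (a y x) \<partial>p\<bar> \<le> K" for n x
    by (rule abs_integral_le_const[OF measure_pmf.prob_space_axioms]) (auto simp: cK K0)
  have fint: "integrable M f"
  proof (rule M.integrable_const_bound[where B="2 * K"])
    show "AE x in M. norm (f x) \<le> 2 * K"
      using rec
    proof eventually_elim
      case (elim x)
      then show ?case using cK[of "Suc 0" x] Pb[of 0 x] by (simp add: spec[of _ 0])
    qed
  qed measurable
  have e: "(\<integral>x. c n x \<partial>M) = (\<integral>x. c 0 x \<partial>M) + real n * (\<integral>x. f x \<partial>M)" for n
  proof (induction n)
    case (Suc n)
    have "(\<integral>x. c (Suc n) x \<partial>M) = (\<integral>x. f x + (\<integral>y. c n (a y x) \<partial>p) \<partial>M)"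
    proof (rule integral_cong_AE)
      show "AE x in M. c (Suc n) x = f x + (\<integral>y. c n (a y x) \<partial>p)"
        using rec by eventually_elim blast
      show "(\<lambda>x. f x + (\<integral>y. c n (a y x) \<partial>p)) \<in> borel_measurable M"
        using borel_measurable_integrable[OF P_c(2)] by measurable
    qed measurable
    also have "\<dots> = (\<integral>x. f x \<partial>M) + (\<integral>x. c n x \<partial>M)"
      using fint P_c by simp
    finally show ?case using Suc.IH by (simp add: algebra_simps)
  qed simp
  have b: "\<bar>(\<integral>x. c 0 x \<partial>M) + real n * (\<integral>x. f x \<partial>M)\<bar> \<le> K" for n
    unfolding e[of n, symmetric] by (rule abs_integral_le_const[OF M]) (auto simp: cK K0)
  \<comment> \<open>The integrals of \<open>c n\<close> form a bounded arithmetic progression.\<close>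
  have f0: "(\<integral>x. f x \<partial>M) = 0"
  proof (rule ccontr)
    assume "(\<integral>x. f x \<partial>M) \<noteq> 0"
    then obtain n where n: "2 * K < real n * \<bar>\<integral>x. f x \<partial>M\<bar>"
      using reals_Archimedean3[of "\<bar>\<integral>x. f x \<partial>M\<bar>"] by auto
    have "real n * \<bar>\<integral>x. f x \<partial>M\<bar> = \<bar>real n * (\<integral>x. f x \<partial>M)\<bar>" by (simp add: abs_mult)
    then show False using b[of n] b[of 0] n by simp
  qed
  have sub: "AE x in M. S x \<le> f x + (\<integral>y. S (a y x) \<partial>p)"
    using rec
  proof eventually_elim
    case (elim x)
    have "T (Suc m) x \<le> f x + (\<integral>y. T m (a y x) \<partial>p)" for m
      unfolding T_def[of "Suc m"]
    proof (rule cSUP_least)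
      fix n' assume "n' \<in> {Suc m..}"
      then obtain n where n: "n' = Suc n" "m \<le> n" by (cases n') auto
      have "(\<integral>y. c n (a y x) \<partial>p) \<le> (\<integral>y. T m (a y x) \<partial>p)"
        using cT n(2) by (intro integral_mono integrable_pmf_bounded[where C=K] cK TK)
      then show "c n' x \<le> f x + (\<integral>y. T m (a y x) \<partial>p)"
        using elim n by simp
    qed simp
    moreover have "(\<lambda>m. f x + (\<integral>y. T m (a y x) \<partial>p)) \<longlonglongrightarrow> f x + (\<integral>y. S (a y x) \<partial>p)"
      by (intro tendsto_add tendsto_const integral_dominated_convergence[where w="\<lambda>_. K"])
        (auto simp: lim TK)
    ultimately show ?case
      using LIMSEQ_le[OF LIMSEQ_Suc[OF lim[of x]]] by blast
  qed
  \<comment> \<open>By stationarity the two sides have the same integral, so the nonnegative difference vanishes.\<close>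
  define d where "d x = f x + (\<integral>y. S (a y x) \<partial>p) - S x" for x
  have dint: "integrable M d"
    unfolding d_def using fint P_S Sint by simp
  have "(\<integral>x. d x \<partial>M) = 0"
    unfolding d_def using fint P_S Sint f0 by simp
  moreover have "AE x in M. 0 \<le> d x"
    using sub by eventually_elim (simp add: d_def)
  ultimately have "AE x in M. d x = 0"
    using integral_nonneg_eq_0_iff_AE[OF dint] by blast
  then show "AE x in M. S x = f x + (\<integral>y. S (a y x) \<partial>p)"
    by eventually_elim (simp add: d_def)
qed

context qm_walk
begin

text \<open>The law of the walk is symmetric, and \<open>\<phi> x + \<phi> (- x)\<close> is bounded for \<open>\<phi>\<close> near \<open>\<phi>o\<close>.\<close>

lemma abs_walk_integral_le:
  assumes \<phi>: "near C \<phi>"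
  shows "\<bar>\<integral>x. \<phi> x \<partial>walk p n\<bar> \<le> C + D"
proof -
  have C: "C \<ge> 0" using nearD[OF \<phi>, of 0] by linarith
  note i = integrable_translate(4)[OF integrable_walk \<phi>, of n]
  have i': "integrable (walk p n) (\<lambda>x. \<phi> (- x))"
    using i integrable_map_pmf_eq[of uminus "walk p n" \<phi>] map_uminus_walk[OF sym, of n] by simp
  have s: "\<bar>\<phi> x + \<phi> (- x)\<bar> \<le> 2 * (C + D)" for x
    using nearD[OF \<phi>, of x] nearD[OF \<phi>, of "- x"] qm[of x "- x"] D_nonneg zero unfolding abs_le_iff by simp
  have "2 * (\<integral>x. \<phi> x \<partial>walk p n) = (\<integral>x. \<phi> x + \<phi> (- x) \<partial>walk p n)"
    using i i' integral_walk_uminus[where f=\<phi> and n=n] by simp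
  also have "\<bar>\<dots>\<bar> \<le> 2 * (C + D)"
    using s C D_nonneg by (intro abs_integral_le_const[OF measure_pmf.prob_space_axioms]) auto
  finally show ?thesis by simp
qed

lemma walk_integral_Suc:
  assumes \<phi>: "near C \<phi>"
  shows "(\<integral>x. \<phi> x \<partial>walk p (Suc n)) = (\<integral>x. \<phi> x \<partial>p) + (\<integral>y. \<integral>x. act0 y \<phi> x \<partial>walk p n \<partial>p)"
proof -
  note i = integrable_translate(4)[OF integrable_walk \<phi>, of "Suc n"]
  note j = integrable_translate(4)[OF integrable_p \<phi>]
  note k = integrable_translate(2)[OF integrable_walk \<phi>]
  have e: "(\<integral>x. act0 y \<phi> x \<partial>walk p n) = (\<integral>x. \<phi> (x + y) \<partial>walk p n) - \<phi> y" for y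
    unfolding act0_def using k by simp
  show ?thesis
    unfolding e using integral_walk_Suc_right(2,3)[OF i] j by simp
qed

text \<open>The mean of \<open>\<phi>\<close> along the walk, truncated at the bound that holds when \<open>\<phi>\<close> is within distance
  \<open>C\<close> of \<open>\<phi>o\<close>; the truncation makes the means uniformly bounded for all functions.\<close>

definition walk_mean :: "real \<Rightarrow> nat \<Rightarrow> ('g \<Rightarrow> real) \<Rightarrow> real" where
  "walk_mean C n \<phi> = max (- (C + D)) (min (C + D) (\<integral>x. \<phi> x \<partial>walk p n))"

text \<open>The upper limit of the truncated means.\<close>

definition correction :: "real \<Rightarrow> ('g \<Rightarrow> real) \<Rightarrow> real" where
  "correction C \<phi> = (INF m. SUP n\<in>{m..}. walk_mean C n \<phi>)"

text \<open>Adding the coboundary of the correction makes almost every \<open>\<phi>\<close> left-harmonic, for any stationary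
  measure carried by the tube of radius \<open>C\<close>.\<close>

definition harmonize :: "real \<Rightarrow> ('g \<Rightarrow> real) \<Rightarrow> 'g \<Rightarrow> real" where
  "harmonize C \<phi> = (\<lambda>g. \<phi> g + correction C (act0 g \<phi>) - correction C \<phi>)"

lemma harmonize_act0: "harmonize C (act0 \<gamma> \<phi>) = act0 \<gamma> (harmonize C \<phi>)"
  by (simp add: harmonize_def act0_add[symmetric]) (simp add: act0_def fun_eq_iff)

lemma harmonize_harmonic:
  assumes st: "stationary_on p F0 \<mu>" and C: "C \<ge> 0" and tube: "AE \<phi> in \<mu>. \<phi> \<in> tube C"
  shows "AE \<phi> in \<mu>. harmonize C \<phi> \<in> harmonic_set p \<phi>o" and "harmonize C \<in> borel_measurable \<mu>"
proof -
  note s = stationary_on_prob[OF st]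
  interpret prob_space \<mu> by (rule s)
  have meas: "f \<in> borel_measurable \<mu>" if "f \<in> borel_measurable borel" for f :: "('g \<Rightarrow> real) \<Rightarrow> real"
    using measurable_restrict_space1[OF that] s(2) by (simp cong: measurable_cong_sets)
  have mm: "walk_mean C n \<in> borel_measurable \<mu>" for n
    unfolding walk_mean_def
    by (intro borel_measurable_max borel_measurable_min borel_measurable_const borel_measurable_integral_pmf meas)
      measurable
  have fm: "(\<lambda>\<phi>. \<integral>x. \<phi> x \<partial>p) \<in> borel_measurable \<mu>"
    by (intro borel_measurable_integral_pmf meas) measurable
  have b: "\<bar>walk_mean C n \<phi>\<bar> \<le> C + D" for n \<phi>
    using C D_nonneg unfolding walk_mean_def by auto
  have eq: "walk_mean C n \<phi> = (\<integral>x. \<phi> x \<partial>walk p n)" if "\<phi> \<in> tube C" for n \<phi>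
    using abs_walk_integral_le[OF tube_near[OF that], of n] unfolding walk_mean_def by auto
  have rec: "AE \<phi> in \<mu>. \<forall>n. walk_mean C (Suc n) \<phi> = (\<integral>x. \<phi> x \<partial>p) + (\<integral>y. walk_mean C n (act0 y \<phi>) \<partial>p)"
    using tube
  proof eventually_elim
    case (elim \<phi>)
    show ?case
      using walk_integral_Suc[OF tube_near[OF elim]] by (simp add: eq elim tube_act0 del: walk.simps)
  qed
  note coh = stationary_cohomological_equation[OF s(4) mm b fm rec, folded correction_def]
  have cm: "correction C \<in> borel_measurable \<mu>"
    using coh(3) by (simp add: correction_def[abs_def])
  show "harmonize C \<in> borel_measurable \<mu>"
  proof (rule measurable_coordinatewise_then_product)
    fix g
    have a: "act0 g \<in> measurable \<mu> \<mu>"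
      using s(4) by (auto simp: stationary_def measurable_action_def)
    show "(\<lambda>\<phi>. harmonize C \<phi> g) \<in> borel_measurable \<mu>"
      unfolding harmonize_def
      by (intro borel_measurable_add borel_measurable_diff measurable_compose[OF a cm] cm meas) measurable
  qed
  have "AE \<phi> in \<mu>. \<forall>g. correction C (act0 g \<phi>) = (\<integral>x. act0 g \<phi> x \<partial>p) + (\<integral>y. correction C (act0 y (act0 g \<phi>)) \<partial>p)"
    by (subst AE_all_countable) (intro allI stationary_AE_translate[OF s(4) sym gen coh(1)])
  then show "AE \<phi> in \<mu>. harmonize C \<phi> \<in> harmonic_set p \<phi>o"
    using tube
  proof eventually_elim
    case (elim \<phi>)
    note n = tube_near[OF elim(2)]
    have cb: "\<bar>correction C \<psi>\<bar> \<le> C + D" for \<psi> by (rule coh(2))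
    have ci: "integrable p (\<lambda>x. correction C (act0 (x + g) \<phi>))" for g
      by (rule integrable_pmf_bounded[OF cb])
    note i = integrable_translate(2)[OF integrable_p n]
    have "(\<integral>x. harmonize C \<phi> (x + g) \<partial>p) = harmonize C \<phi> g" for g
    proof -
      have "(\<integral>x. harmonize C \<phi> (x + g) \<partial>p) =
          (\<integral>x. \<phi> (x + g) \<partial>p) + (\<integral>x. correction C (act0 (x + g) \<phi>) \<partial>p) - correction C \<phi>"
        unfolding harmonize_def using ci i by simp
      also have "(\<integral>x. \<phi> (x + g) \<partial>p) = (\<integral>x. act0 g \<phi> x \<partial>p) + \<phi> g"
        unfolding act0_def using i by simp
      finally show ?thesis
        using spec[OF elim(1), of g] by (simp add: harmonize_def act0_add)
    qed
    moreover have "harmonize C \<phi> \<in> F0"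
      using tube_F0[OF elim(2)] by (simp add: harmonize_def F0_def act0_zero)
    moreover have "\<bar>harmonize C \<phi> g - \<phi>o g\<bar> \<le> C + 2 * (C + D)" for g
      using nearD[OF n, of g] cb[of "act0 g \<phi>"] cb[of \<phi>] unfolding harmonize_def abs_le_iff by auto
    ultimately show ?case
      unfolding harmonic_set_iff near_def by blast
  qed
qed

text \<open>A stationary space with an equivariant map to functions near \<open>\<phi>o\<close> has an
  equivariant map to the harmonic core.\<close>

lemma factor_onto_core:
  assumes st: "stationary p a M"
    and \<Phi>m: "\<Phi> \<in> measurable M (restrict_space borel F0)"
    and C: "C \<ge> 0" and tube: "AE x in M. \<Phi> x \<in> tube C"
    and equiv: "AE x in M. \<forall>\<gamma>. \<Phi> (a \<gamma> x) = act0 \<gamma> (\<Phi> x)"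
  obtains B0 \<pi> where "B0 \<in> sets M" "measure M B0 = 1" "\<And>\<gamma> b. b \<in> B0 \<Longrightarrow> a \<gamma> b \<in> B0"
    "\<pi> \<in> measurable M (restrict_space borel (harmonic_core p \<phi>o))"
    "\<And>\<gamma> b. b \<in> B0 \<Longrightarrow> \<pi> (a \<gamma> b) = act0 \<gamma> (\<pi> b)"
    "stationary_on p (harmonic_core p \<phi>o) (distr M (restrict_space borel (harmonic_core p \<phi>o)) \<pi>)"
    "\<exists>\<nu>. stationary_on p (harmonic_set p \<phi>o) \<nu>"
proof -
  have M: "prob_space M" and a: "measurable_action a M"
    using st by (auto simp: stationary_def)
  interpret M: prob_space M by fact
  have am[measurable]: "a \<gamma> \<in> measurable M M" for \<gamma>
    using a by (simp add: measurable_action_def)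
  let ?H = "harmonic_set p \<phi>o" and ?K = "harmonic_core p \<phi>o"
  let ?RF = "restrict_space borel (F0 :: ('g \<Rightarrow> real) set)"
  have actF: "measurable_action act0 ?RF"
    by (rule measurable_action_act0) (auto simp: act0_in_F0)
  define \<mu> where "\<mu> = distr M ?RF \<Phi>"
  have st\<mu>: "stationary_on p F0 \<mu>"
    unfolding stationary_on_def \<mu>_def using stationary_distr[OF st actF \<Phi>m equiv] by simp
  have tubeset: "tube C \<in> sets ?RF"
    using tube_F0 by (auto simp: sets_restrict_space intro!: image_eqI[where x="tube C"] borel_closed closed_tube)
  have "AE \<phi> in \<mu>. \<phi> \<in> tube C"
  proof -
    have "{x \<in> space ?RF. x \<in> tube C} = tube C"
      using sets.sets_into_space[OF tubeset] by auto
    then show ?thesis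
      unfolding \<mu>_def using tubeset tube by (subst AE_distr_iff[OF \<Phi>m]) auto
  qed
  note har = harmonize_harmonic[OF st\<mu> C this]
  define f where "f x = harmonize C (\<Phi> x)" for x
  have fm[measurable]: "f \<in> borel_measurable M"
  proof -
    have "harmonize C \<in> borel_measurable ?RF"
      using har(2) by (simp add: \<mu>_def)
    from measurable_compose[OF \<Phi>m this] show ?thesis by (simp add: f_def[abs_def])
  qed
  have fH: "AE x in M. f x \<in> ?H"
    unfolding f_def using AE_distrD[OF \<Phi>m har(1)[unfolded \<mu>_def]] .
  have fe: "AE x in M. \<forall>\<gamma>. f (a \<gamma> x) = act0 \<gamma> (f x)"
    using equiv by eventually_elim (simp add: f_def harmonize_act0)
  obtain h where h: "h \<in> ?H"
    using fH M.AE_False by fastforce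
  \<comment> \<open>The values \<open>h\<close> here and \<open>k\<close> below only serve on null sets.\<close>
  define f1 where "f1 x = (if f x \<in> ?H then f x else h)" for x
  have f1m: "f1 \<in> measurable M (restrict_space borel ?H)"
    unfolding f1_def using h by (intro measurable_restrict_space2) auto
  have actH: "measurable_action act0 (restrict_space borel ?H)"
    by (rule measurable_action_act0[OF harmonic_set_F0 harmonic_set_act0])
  have "AE x in M. \<forall>\<gamma>. f1 (a \<gamma> x) = act0 \<gamma> (f1 x)"
    using fH fe by eventually_elim (simp add: f1_def harmonic_set_act0)
  from stationary_distr[OF st actH f1m this]
  have st1: "stationary_on p ?H (distr M (restrict_space borel ?H) f1)"
    by (simp add: stationary_on_def)
  have "AE x in M. f1 x \<in> ?K"
    using AE_distrD[OF f1m stationary_core[OF st1]] by simp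
  with fH have fK: "AE x in M. f x \<in> ?K"
    by eventually_elim (simp add: f1_def)
  obtain k where k: "k \<in> ?K"
    using fK M.AE_False by fastforce
  define \<pi> where "\<pi> x = (if f x \<in> ?K then f x else k)" for x
  have \<pi>m: "\<pi> \<in> measurable M (restrict_space borel ?K)"
    unfolding \<pi>_def using k by (intro measurable_restrict_space2) auto
  have KF0: "?K \<subseteq> F0"
    using harmonic_core_subset harmonic_set_F0 h by blast
  have actK: "measurable_action act0 (restrict_space borel ?K)"
    by (rule measurable_action_act0[OF KF0 harmonic_core_act0])
  have pe: "AE x in M. \<forall>\<gamma>. \<pi> (a \<gamma> x) = act0 \<gamma> (\<pi> x)"
    using fK fe by eventually_elim (simp add: \<pi>_def harmonic_core_act0)
  define G where "G = {x\<in>space M. f x \<in> ?K \<and> (\<forall>\<gamma> g. f (a \<gamma> x) g = act0 \<gamma> (f x) g)}"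
  have Gm[measurable]: "G \<in> sets M"
  proof -
    have [measurable]: "(\<lambda>x. f (a \<gamma> x) g) \<in> borel_measurable M" "(\<lambda>x. act0 \<gamma> (f x) g) \<in> borel_measurable M" for \<gamma> g
      by (rule measurable_product_then_coordinatewise, measurable)+
    show ?thesis unfolding G_def by measurable
  qed
  have G: "AE x in M. x \<in> G"
    using fK fe AE_space by eventually_elim (auto simp: G_def)
  \<comment> \<open>All translates of \<open>G\<close> are conull by quasi-invariance, so their intersection is conull and invariant.\<close>
  define B0 where "B0 = {x\<in>space M. \<forall>\<gamma>. a \<gamma> x \<in> G}"
  have B0m: "B0 \<in> sets M"
    unfolding B0_def by measurable
  have "AE x in M. \<forall>\<gamma>. a \<gamma> x \<in> G"
    by (subst AE_all_countable) (intro allI stationary_AE_translate[OF st sym gen G])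
  then have B0ae: "AE x in M. x \<in> B0"
    using AE_space by eventually_elim (simp add: B0_def)
  have inv: "a \<gamma> b \<in> B0" if "b \<in> B0" for \<gamma> b
  proof -
    have "a \<delta> (a \<gamma> b) = a (\<delta> + \<gamma>) b" for \<delta>
      using a that by (simp add: measurable_action_def B0_def)
    then show ?thesis
      using that measurable_space[OF am, of b \<gamma>] by (simp add: B0_def)
  qed
  have BG: "b \<in> G" if "b \<in> B0" for b
  proof -
    have "a 0 b = b" using a that by (simp add: measurable_action_def B0_def)
    then show ?thesis using that unfolding B0_def by (metis (mono_tags, lifting) mem_Collect_eq)
  qed
  show ?thesis
  proof (rule that[of B0 \<pi>])
    show "measure M B0 = 1"
      using B0ae B0m M.AE_in_set_eq_1 by blast
    show "\<pi> (a \<gamma> b) = act0 \<gamma> (\<pi> b)" if "b \<in> B0" for \<gamma> b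
      using BG[OF that] BG[OF inv[OF that, of \<gamma>]] unfolding G_def \<pi>_def by auto
    show "stationary_on p ?K (distr M (restrict_space borel ?K) \<pi>)"
      using stationary_distr[OF st actK \<pi>m pe] by (simp add: stationary_on_def)
  qed (use B0m inv \<pi>m st1 in auto)
qed

end

section \<open>Existence of a stationary measure\<close>

lemma convergent_summable_dist:
  fixes X :: "nat \<Rightarrow> 'a::complete_space"
  assumes "summable (\<lambda>k. dist (X k) (X (Suc k)))"
  shows "convergent X"
proof -
  have le: "dist (X m) (X n) \<le> (\<Sum>k\<in>{m..<n}. dist (X k) (X (Suc k)))" if "m \<le> n" for m n
    using that
  proof (induction n rule: dec_induct)
    case (step n)
    then show ?case
      using dist_triangle[of "X m" "X (Suc n)" "X n"] by (simp add: sum.atLeastLessThan_Suc)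
  qed simp
  have "Cauchy X"
  proof (rule metric_CauchyI)
    fix e :: real assume "e > 0"
    then obtain N where N: "\<And>m n. m \<ge> N \<Longrightarrow> norm (\<Sum>k\<in>{m..<n}. dist (X k) (X (Suc k))) < e"
      using assms unfolding summable_Cauchy by blast
    have *: "dist (X m) (X n) < e" if "N \<le> m" "m \<le> n" for m n
      using le[OF that(2)] N[OF that(1), of n] by simp
    show "\<exists>N. \<forall>m\<ge>N. \<forall>n\<ge>N. dist (X m) (X n) < e"
    proof (intro exI[of _ N] allI impI)
      fix m n assume "N \<le> m" "N \<le> n"
      then show "dist (X m) (X n) < e"
        using *[of m n] *[of n m] by (cases "m \<le> n") (simp_all add: dist_commute)
    qed
  qed
  then show ?thesis by (rule Cauchy_convergent)
qed

context qm_walk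
begin

text \<open>A limit point of the Cesaro means of the functions \<open>g \<mapsto> E (\<phi>o (g + x))\<close>, with \<open>x\<close> distributed as
  \<open>walk p k\<close>, shifted by a constant so that it vanishes at \<open>0\<close>.\<close>

lemma exists_right_harmonic:
  obtains \<psi> C where "\<psi> \<in> F0" "near C \<psi>" "\<And>g. (\<integral>x. \<psi> (g + x) \<partial>p) = \<psi> g"
proof -
  define V where "V k g = (\<integral>x. \<phi>o (g + x) \<partial>walk p k)" for k g
  define A where "A N g = (\<Sum>k<Suc N. V k g) / real (Suc N)" for N g
  note iw = integrable_translate(3,4)[OF integrable_walk near_self]
  have V0: "V 0 g = \<phi>o g" for g by (simp add: V_def)
  have VD: "\<bar>V k g - \<phi>o g\<bar> \<le> 2 * D" for k g
  proof -
    have "V k g - \<phi>o g - (\<integral>x. \<phi>o x \<partial>walk p k) = (\<integral>x. \<phi>o (g + x) - \<phi>o g - \<phi>o x \<partial>walk p k)"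
      using iw by (simp add: V_def)
    moreover have "\<bar>\<integral>x. \<phi>o (g + x) - \<phi>o g - \<phi>o x \<partial>walk p k\<bar> \<le> D"
      by (rule abs_integral_le_const[OF measure_pmf.prob_space_axioms]) (auto simp: qm D_nonneg)
    ultimately show ?thesis
      using abs_walk_integral_le[OF near_self, of k] by linarith
  qed
  have VS: "(\<integral>x. V k (g + x) \<partial>p) = V (Suc k) g" for k g
    unfolding V_def using integral_walk_Suc(1)[where f="\<lambda>x. \<phi>o (g + x)" and p=p and n=k] iw by (simp add: add.assoc del: walk.simps)
  have Vi: "integrable p (\<lambda>x. V k (g + x))" for k g
    using integrable_translate(3)[OF integrable_p, of "2 * D" "V k" g] VD by (simp add: near_def)
  have AD: "\<bar>A N g - \<phi>o g\<bar> \<le> 2 * D" for N g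
  proof -
    have "A N g - \<phi>o g = (\<Sum>k<Suc N. V k g - \<phi>o g) / real (Suc N)"
      by (simp add: A_def sum_subtractf field_simps del: sum.lessThan_Suc)
    moreover have "\<bar>\<Sum>k<Suc N. V k g - \<phi>o g\<bar> \<le> real (Suc N) * (2 * D)"
      by (rule order_trans[OF sum_abs]) (use sum_bounded_above[of "{..<Suc N}" "\<lambda>k. \<bar>V k g - \<phi>o g\<bar>" "2 * D"] VD in
        \<open>simp del: sum.lessThan_Suc\<close>)
    ultimately show ?thesis
      by (simp add: divide_le_eq mult.commute del: sum.lessThan_Suc)
  qed
  \<comment> \<open>The means are right-harmonic up to an error of order \<open>1 / N\<close>.\<close>
  have AS: "(\<integral>x. A N (g + x) \<partial>p) = A N g + (V (Suc N) g - \<phi>o g) / real (Suc N)" for N g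
  proof -
    have "(\<integral>x. A N (g + x) \<partial>p) = (\<Sum>k<Suc N. V (Suc k) g) / real (Suc N)"
      unfolding A_def using Vi VS by (simp del: sum.lessThan_Suc)
    also have "(\<Sum>k<Suc N. V (Suc k) g) = (\<Sum>k<Suc N. V k g) + V (Suc N) g - V 0 g"
      using sum.lessThan_Suc_shift[of "\<lambda>k. V k g" "Suc N"] by simp
    finally show ?thesis by (simp add: A_def V0 add_divide_distrib diff_divide_distrib del: sum.lessThan_Suc)
  qed
  let ?B = "\<lambda>g. {\<phi>o g - 2 * D .. \<phi>o g + 2 * D}"
  have "compact (Pi\<^sub>E UNIV ?B)"
    using compactin_PiE[of "\<lambda>_. euclidean" UNIV ?B]
    by (simp add: euclidean_product_topology)
  moreover have "A N \<in> Pi\<^sub>E UNIV ?B" for N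
    using AD[of N] by (auto simp: abs_le_iff algebra_simps)
  ultimately obtain l r where l: "l \<in> Pi\<^sub>E UNIV ?B" and r: "strict_mono r" and lim: "(A \<circ> r) \<longlonglongrightarrow> l"
    unfolding compact_def by meson
  have ln: "near (2 * D) l"
    using l by (fastforce simp: near_def abs_le_iff PiE_iff algebra_simps)
  have An: "near (2 * D) (A N)" for N using AD by (simp add: near_def)
  have limg: "(\<lambda>j. A (r j) g) \<longlonglongrightarrow> l g" for g
    using tendsto_coordinate[OF lim, of g] by simp
  have lh: "(\<integral>x. l (g + x) \<partial>p) = l g" for g
  proof -
    have "(\<lambda>j. \<integral>x. A (r j) (g + x) \<partial>p) \<longlonglongrightarrow> (\<integral>x. l (g + x) \<partial>p)"
    proof (rule integral_dominated_convergence[where w="\<lambda>x. \<bar>\<phi>o x\<bar> + (\<bar>\<phi>o g\<bar> + \<bar>\<phi>o 0\<bar> + 2 * D + 2 * D)"])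
      show "AE x in p. norm (A (r j) (g + x)) \<le> \<bar>\<phi>o x\<bar> + (\<bar>\<phi>o g\<bar> + \<bar>\<phi>o 0\<bar> + 2 * D + 2 * D)" for j
        using near_translate_abs_le[OF An[of "r j"], of g _ 0] by (auto intro!: AE_I2)
    qed (use integrable_p limg in auto)
    moreover have "(\<lambda>j. \<integral>x. A (r j) (g + x) \<partial>p) \<longlonglongrightarrow> l g + 0"
      unfolding AS
    proof (intro tendsto_add limg)
      have z: "(\<lambda>N. (V (Suc N) g - \<phi>o g) / real (Suc N)) \<longlonglongrightarrow> 0"
      proof (rule Lim_null_comparison)
        show "\<forall>\<^sub>F N in sequentially. norm ((V (Suc N) g - \<phi>o g) / real (Suc N)) \<le> 2 * D * inverse (real (Suc N))"
          using VD[of "Suc _" g] by (intro always_eventually allI) (simp add: divide_inverse abs_mult mult_right_mono)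
        show "(\<lambda>N. 2 * D * inverse (real (Suc N))) \<longlonglongrightarrow> 0"
          using tendsto_mult[OF tendsto_const LIMSEQ_inverse_real_of_nat, of "2 * D"] by simp
      qed
      show "(\<lambda>j. (V (Suc (r j)) g - \<phi>o g) / real (Suc (r j))) \<longlonglongrightarrow> 0"
        using LIMSEQ_subseq_LIMSEQ[OF z r] by (simp add: o_def)
    qed
    ultimately show ?thesis using LIMSEQ_unique by fastforce
  qed
  show ?thesis
  proof (rule that[of "\<lambda>g. l g - l 0" "2 * D + \<bar>l 0\<bar>"])
    show "(\<lambda>g. l g - l 0) \<in> F0" by (simp add: F0_def)
    have "\<bar>l g - l 0 - \<phi>o g\<bar> \<le> 2 * D + \<bar>l 0\<bar>" for g
      using nearD[OF ln, of g] by linarith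
    then show "near (2 * D + \<bar>l 0\<bar>) (\<lambda>g. l g - l 0)" by (simp add: near_def)
    show "(\<integral>x. l (g + x) - l 0 \<partial>p) = l g - l 0" for g
      using lh integrable_translate(3)[OF integrable_p ln, of g] by simp
  qed
qed

end

text \<open>The position at time \<open>n\<close> of the walk with increments \<open>\<omega>\<close>. Increments are added on the right, as
  for the Poisson boundary; prefixing an increment then adds it on the left of all later positions.\<close>

definition walk_at :: "nat \<Rightarrow> (nat \<Rightarrow> 'g::group_add) \<Rightarrow> 'g" where
  "walk_at n \<omega> = sum_list (map \<omega> [0..<n])"

lemma walk_at_0 [simp]: "walk_at 0 \<omega> = 0"
  by (simp add: walk_at_def)

lemma walk_at_case_nat: "walk_at (Suc n) (case_nat s \<omega>) = s + walk_at n \<omega>"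
  unfolding walk_at_def map_upt_Suc by simp

context symmetric_walk
begin

lemma sequence_space_p: "sequence_space (measure_pmf p)"
  by (intro sequence_space.intro product_prob_space.intro product_prob_space_axioms.intro
    product_sigma_finite.intro prob_space_imp_sigma_finite measure_pmf.prob_space_axioms)

lemma prob_space_increments: "prob_space (increments_measure p)"
  unfolding increments_measure_def by (rule prob_space_PiM) (rule measure_pmf.prob_space_axioms)

lemma measurable_walk_at [measurable]: "walk_at n \<in> measurable (increments_measure p) (count_space UNIV)"
proof (induction n)
  case 0
  have "walk_at 0 = (\<lambda>_. 0)" by (simp add: fun_eq_iff)
  then show ?case by simp
next
  case (Suc n)
  have e: "walk_at (Suc n) = (\<lambda>\<omega>. (\<lambda>(x, y). x + y) (walk_at n \<omega>, \<omega> n))"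
    by (simp add: walk_at_def fun_eq_iff)
  have c: "(\<lambda>\<omega>. \<omega> n) \<in> measurable (increments_measure p) (count_space UNIV)"
  proof -
    have "(\<lambda>\<omega>. \<omega> n) \<in> measurable (increments_measure p) (measure_pmf p)"
      unfolding increments_measure_def by (rule measurable_component_singleton) simp
    then show ?thesis by (simp cong: measurable_cong_sets)
  qed
  have "(\<lambda>(x::'g, y). x + y) \<in> measurable (count_space UNIV \<Otimes>\<^sub>M count_space UNIV) (count_space UNIV)"
    by (subst pair_measure_countable) auto
  then show ?case
    unfolding e using Suc c by measurable
qed

text \<open>The increments measure is invariant under prefixing an independent increment.\<close>

lemma integral_increments_shift:
  fixes G :: "(nat \<Rightarrow> 'g) \<Rightarrow> real"
  assumes [measurable]: "G \<in> borel_measurable (increments_measure p)" and b: "\<And>\<omega>. \<bar>G \<omega>\<bar> \<le> C"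
  shows "(\<integral>\<omega>. G \<omega> \<partial>increments_measure p) = (\<integral>s. \<integral>\<omega>. G (case_nat s \<omega>) \<partial>increments_measure p \<partial>p)"
proof -
  interpret sequence_space "measure_pmf p" by (rule sequence_space_p)
  interpret O: prob_space "increments_measure p" by (rule prob_space_increments)
  interpret Q: pair_prob_space "measure_pmf p" "increments_measure p"
    by (intro pair_prob_space.intro pair_sigma_finite.intro O.prob_space_axioms measure_pmf.prob_space_axioms
      prob_space_imp_sigma_finite)
  have m[measurable]: "(\<lambda>(s, \<omega>). case_nat s \<omega>) \<in> measurable (measure_pmf p \<Otimes>\<^sub>M increments_measure p) (increments_measure p)"
    unfolding increments_measure_def by measurable
  have eq: "distr (measure_pmf p \<Otimes>\<^sub>M increments_measure p) (increments_measure p) (\<lambda>(s, \<omega>). case_nat s \<omega>) = increments_measure p"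
    unfolding increments_measure_def by (rule PiM_iter)
  have i: "integrable (measure_pmf p \<Otimes>\<^sub>M increments_measure p) (\<lambda>(s, \<omega>). G (case_nat s \<omega>))"
  proof (rule Q.P.integrable_const_bound[where B=C])
    show "(\<lambda>(s, \<omega>). G (case_nat s \<omega>)) \<in> borel_measurable (measure_pmf p \<Otimes>\<^sub>M increments_measure p)"
      using measurable_compose[OF m, of G borel] by (simp add: case_prod_beta')
  qed (auto simp: b)
  have "(\<integral>\<omega>. G \<omega> \<partial>increments_measure p) =
      (\<integral>\<omega>. G \<omega> \<partial>distr (measure_pmf p \<Otimes>\<^sub>M increments_measure p) (increments_measure p) (\<lambda>(s, \<omega>). case_nat s \<omega>))"
    by (simp only: eq)
  also have "\<dots> = (\<integral>z. (\<lambda>(s, \<omega>). G (case_nat s \<omega>)) z \<partial>(measure_pmf p \<Otimes>\<^sub>M increments_measure p))"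
    by (subst integral_distr[OF m]) (auto simp: case_prod_beta')
  also have "\<dots> = (\<integral>s. \<integral>\<omega>. G (case_nat s \<omega>) \<partial>increments_measure p \<partial>p)"
    using Q.integral_fst[OF i] by simp
  finally show ?thesis .
qed

lemma borel_measurable_walk_at: "(\<lambda>\<omega>. f (walk_at n \<omega>)) \<in> borel_measurable (increments_measure p)"
  by (rule measurable_compose[OF measurable_walk_at]) simp

lemma integral_walk_at:
  fixes f :: "'g \<Rightarrow> real"
  assumes b: "\<And>g. \<bar>f g\<bar> \<le> C"
  shows "(\<integral>\<omega>. f (walk_at n \<omega>) \<partial>increments_measure p) = (\<integral>x. f x \<partial>walk p n)"
  using b
proof (induction n arbitrary: f)
  case 0
  interpret O: prob_space "increments_measure p" by (rule prob_space_increments)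
  show ?case by (simp add: O.prob_space)
next
  case (Suc n)
  have "(\<integral>\<omega>. f (walk_at (Suc n) \<omega>) \<partial>increments_measure p) =
      (\<integral>s. \<integral>\<omega>. f (s + walk_at n \<omega>) \<partial>increments_measure p \<partial>p)"
    by (subst integral_increments_shift[where C=C]) (auto simp: walk_at_case_nat Suc.prems intro: borel_measurable_walk_at)
  also have "\<dots> = (\<integral>s. \<integral>x. f (s + x) \<partial>walk p n \<partial>p)"
    by (intro Bochner_Integration.integral_cong refl Suc.IH) (rule Suc.prems)
  also have "\<dots> = (\<integral>x. f x \<partial>walk p (Suc n))"
    by (rule integral_walk_Suc(1)[symmetric]) (rule integrable_pmf_bounded[OF Suc.prems])
  finally show ?case .
qed

lemma right_harmonic_walk:
  fixes h :: "'g \<Rightarrow> real"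
  assumes b: "\<And>g. \<bar>h g\<bar> \<le> C" and harm: "\<And>g. (\<integral>x. h (g + x) \<partial>p) = h g"
  shows "(\<integral>x. h x \<partial>walk p n) = h 0"
proof (induction n)
  case (Suc n)
  show ?case
    by (subst integral_walk_Suc_right(1)) (auto simp: harm Suc.IH intro: integrable_pmf_bounded[OF b] simp del: walk.simps)
qed simp

text \<open>Along a path, a right-harmonic function is a martingale, so its increments are orthogonal to the
  past.\<close>

lemma right_harmonic_martingale:
  fixes h :: "'g \<Rightarrow> real"
  assumes "\<And>g. \<bar>h g\<bar> \<le> C" and "\<And>g. (\<integral>x. h (g + x) \<partial>p) = h g" and "m \<le> n"
  shows "(\<integral>\<omega>. h (walk_at n \<omega>) * h (walk_at m \<omega>) \<partial>increments_measure p) =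
    (\<integral>\<omega>. (h (walk_at m \<omega>))\<^sup>2 \<partial>increments_measure p)"
  using assms
proof (induction m arbitrary: h n)
  case 0
  interpret O: prob_space "increments_measure p" by (rule prob_space_increments)
  show ?case
    using integral_walk_at[of h C n, OF 0(1)] right_harmonic_walk[of h C n, OF 0(1,2)]
    by (simp add: O.prob_space power2_eq_square)
next
  case (Suc m)
  then obtain n' where n: "n = Suc n'" "m \<le> n'" by (cases n) auto
  have m: "\<bar>h x * h y\<bar> \<le> C * C" for x y
    unfolding abs_mult by (intro mult_mono Suc.prems(1) order_trans[OF abs_ge_zero Suc.prems(1)[of x]]) auto
  have "(\<integral>\<omega>. h (walk_at n \<omega>) * h (walk_at (Suc m) \<omega>) \<partial>increments_measure p) =
      (\<integral>s. \<integral>\<omega>. h (s + walk_at n' \<omega>) * h (s + walk_at m \<omega>) \<partial>increments_measure p \<partial>p)"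
    unfolding n
    by (subst integral_increments_shift[where C="C * C"])
      (auto simp: walk_at_case_nat m intro!: borel_measurable_times borel_measurable_walk_at)
  also have "\<dots> = (\<integral>s. \<integral>\<omega>. (h (s + walk_at m \<omega>))\<^sup>2 \<partial>increments_measure p \<partial>p)"
    by (intro Bochner_Integration.integral_cong refl Suc.IH)
      (use Suc.prems(1,2) n in \<open>auto simp: add.assoc[symmetric]\<close>)
  also have "\<dots> = (\<integral>\<omega>. (h (walk_at (Suc m) \<omega>))\<^sup>2 \<partial>increments_measure p)"
    by (subst integral_increments_shift[where C="C * C"])
      (use m[of x x for x] in \<open>auto simp: walk_at_case_nat power2_eq_square intro!: borel_measurable_times borel_measurable_walk_at\<close>)
  finally show ?case .
qed

lemma right_harmonic_cauchy:
  fixes h :: "'g \<Rightarrow> real"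
  assumes b: "\<And>g. \<bar>h g\<bar> \<le> C" and harm: "\<And>g. (\<integral>x. h (g + x) \<partial>p) = h g"
  shows "((\<lambda>(n, m). \<integral>\<omega>. \<bar>h (walk_at n \<omega>) - h (walk_at m \<omega>)\<bar> \<partial>increments_measure p) \<longlongrightarrow> 0)
    (sequentially \<times>\<^sub>F sequentially)"
proof -
  interpret O: prob_space "increments_measure p" by (rule prob_space_increments)
  note [measurable] = borel_measurable_walk_at
  define v where "v n = (\<integral>\<omega>. (h (walk_at n \<omega>))\<^sup>2 \<partial>increments_measure p)" for n
  have m: "\<bar>h x * h y\<bar> \<le> C * C" for x y
    unfolding abs_mult by (intro mult_mono b order_trans[OF abs_ge_zero b[of x]]) auto
  have sq: "(h x)\<^sup>2 \<le> C * C" for x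
    using m[of x x] by (simp add: power2_eq_square abs_le_iff)
  have i1: "integrable (increments_measure p) (\<lambda>\<omega>. h (walk_at n \<omega>) * h (walk_at m \<omega>))" for n m
    by (rule O.integrable_const_bound[where B="C * C"]) (auto intro!: AE_I2 m simp del: abs_mult)
  have i2: "integrable (increments_measure p) (\<lambda>\<omega>. (h (walk_at n \<omega>))\<^sup>2)" for n
    using i1[of n n] by (simp add: power2_eq_square)
  have i0: "integrable (increments_measure p) (\<lambda>\<omega>. h (walk_at n \<omega>))" for n
    by (rule O.integrable_const_bound[where B=C]) (auto intro!: AE_I2 b)
  have e: "(h x - h y)\<^sup>2 = (h x)\<^sup>2 - 2 * (h x * h y) + (h y)\<^sup>2" for x y
    by (simp add: power2_diff)
  have i3: "integrable (increments_measure p) (\<lambda>\<omega>. (h (walk_at n \<omega>) - h (walk_at m \<omega>))\<^sup>2)" for n m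
    unfolding e using i1 i2 by simp
  have inc: "(\<integral>\<omega>. (h (walk_at n \<omega>) - h (walk_at m \<omega>))\<^sup>2 \<partial>increments_measure p) = v n - v m" if "m \<le> n" for n m
    unfolding e using i1 i2 right_harmonic_martingale[OF b harm that] by (simp add: v_def)
  have mono: "v m \<le> v n" if "m \<le> n" for n m
  proof -
    have "0 \<le> (\<integral>\<omega>. (h (walk_at n \<omega>) - h (walk_at m \<omega>))\<^sup>2 \<partial>increments_measure p)" by simp
    then show ?thesis using inc[OF that] by simp
  qed
  have L1: "(\<integral>\<omega>. \<bar>h (walk_at n \<omega>) - h (walk_at m \<omega>)\<bar> \<partial>increments_measure p) \<le> sqrt (v n - v m)" if "m \<le> n" for n m
    unfolding inc[OF that, symmetric]
    by (rule real_le_rsqrt, rule square_integral_abs_le[OF O.prob_space_axioms]) (use i0 i3 in auto)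
  have L2: "(\<integral>\<omega>. \<bar>h (walk_at n \<omega>) - h (walk_at m \<omega>)\<bar> \<partial>increments_measure p) \<le> sqrt \<bar>v n - v m\<bar>" for n m
  proof (cases "m \<le> n")
    case True
    then show ?thesis using L1[OF True] mono[OF True] by simp
  next
    case False
    then show ?thesis using L1[of n m] mono[of n m] by (simp add: abs_minus_commute)
  qed
  have "v n \<le> C * C" for n
  proof -
    have "v n \<le> (\<integral>\<omega>. C * C \<partial>increments_measure p)"
      unfolding v_def using i2 by (intro integral_mono sq) auto
    then show ?thesis by (simp add: O.prob_space)
  qed
  moreover have "incseq v" using mono by (simp add: incseq_def)
  ultimately obtain l where l: "v \<longlonglongrightarrow> l"
    by (metis incseq_convergent)
  have "((\<lambda>z. sqrt \<bar>v (fst z) - v (snd z)\<bar>) \<longlongrightarrow> sqrt \<bar>l - l\<bar>) (sequentially \<times>\<^sub>F sequentially)"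
    by (intro tendsto_real_sqrt tendsto_rabs tendsto_diff filterlim_compose[OF l filterlim_fst]
      filterlim_compose[OF l filterlim_snd])
  then have l': "((\<lambda>z. sqrt \<bar>v (fst z) - v (snd z)\<bar>) \<longlongrightarrow> 0) (sequentially \<times>\<^sub>F sequentially)" by simp
  show ?thesis
    by (rule Lim_null_comparison[OF always_eventually l']) (use L2 in auto)
qed

end

context qm_walk
begin

text \<open>The law of an almost sure limit of the translates \<open>act0 (walk_at n \<omega>) \<psi>\<close>, for a right-harmonic \<open>\<psi>\<close>
  near \<open>\<phi>o\<close>. Their coordinates are martingales bounded in the second moment; this gives convergence in
  mean distance, and almost sure convergence along a subsequence of times.\<close>

lemma exists_stationary_near:
  obtains \<nu> C where "stationary_on p F0 \<nu>" "C \<ge> 0" "AE \<phi> in \<nu>. \<phi> \<in> tube C"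
proof -
  obtain \<psi> C0 where \<psi>: "\<psi> \<in> F0" "near C0 \<psi>" "\<And>g. (\<integral>x. \<psi> (g + x) \<partial>p) = \<psi> g"
    using exists_right_harmonic by blast
  define C where "C = 2 * C0 + D"
  have C: "C \<ge> 0" using nearD[OF \<psi>(2), of 0] D_nonneg by (simp add: C_def)
  have \<psi>t: "\<psi> \<in> tube C" unfolding C_def by (rule near_imp_tube[OF \<psi>(2,1)])
  let ?W = "increments_measure p"
  interpret W: prob_space ?W by (rule prob_space_increments)
  define X where "X n \<omega> = act0 (walk_at n \<omega>) \<psi>" for n \<omega>
  have Xm[measurable]: "X n \<in> borel_measurable ?W" for n
    unfolding X_def by (rule measurable_compose[OF measurable_walk_at]) simp
  have Xg: "(\<lambda>\<omega>. X n \<omega> g) \<in> borel_measurable ?W" for n g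
    by (rule measurable_product_then_coordinatewise) measurable
  \<comment> \<open>The coordinate \<open>g\<close> of the translate of \<open>\<psi>\<close> by \<open>y\<close>.\<close>
  define h where "h g y = \<psi> (g + y) - \<psi> y" for g y
  have hX: "X n \<omega> g = h g (walk_at n \<omega>)" for n \<omega> g by (simp add: X_def h_def act0_def)
  have hb: "\<bar>h g y\<bar> \<le> \<bar>\<phi>o g\<bar> + C" for g y
    using nearD[OF tube_near[OF tube_act0[OF \<psi>t, of y]], of g] by (simp add: act0_def h_def)
  have hh: "(\<integral>x. h g (y + x) \<partial>p) = h g y" for g y
    using integrable_translate(3)[OF integrable_p \<psi>(2), of "g + y"]
      integrable_translate(3)[OF integrable_p \<psi>(2), of y] \<psi>(3)[of "g + y"] \<psi>(3)[of y]
    by (simp add: h_def add.assoc)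
  have "((\<lambda>z. \<integral>\<omega>. dist (X (fst z) \<omega>) (X (snd z) \<omega>) \<partial>?W) \<longlongrightarrow> 0) (sequentially \<times>\<^sub>F sequentially)"
  proof (rule tendsto_integral_dist_fun)
    show "integrable ?W (\<lambda>\<omega>. \<bar>X (fst z) \<omega> g - X (snd z) \<omega> g\<bar>)" for z g
    proof (rule W.integrable_const_bound[where B="2 * (\<bar>\<phi>o g\<bar> + C)"])
      show "AE \<omega> in ?W. norm \<bar>X (fst z) \<omega> g - X (snd z) \<omega> g\<bar> \<le> 2 * (\<bar>\<phi>o g\<bar> + C)"
      proof (rule AE_I2)
        fix \<omega>
        show "norm \<bar>X (fst z) \<omega> g - X (snd z) \<omega> g\<bar> \<le> 2 * (\<bar>\<phi>o g\<bar> + C)"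
          unfolding hX real_norm_def abs_abs
          using add_mono[OF hb[of g "walk_at (fst z) \<omega>"] hb[of g "walk_at (snd z) \<omega>"]]
          by (intro order_trans[OF abs_triangle_ineq4]) simp
      qed
    qed (use Xg in measurable)
    show "((\<lambda>z. \<integral>\<omega>. \<bar>X (fst z) \<omega> g - X (snd z) \<omega> g\<bar> \<partial>?W) \<longlongrightarrow> 0) (sequentially \<times>\<^sub>F sequentially)" for g
      using right_harmonic_cauchy[OF hb hh, of g] by (simp add: hX case_prod_beta')
  qed (auto simp: W.prob_space_axioms)
  note cau = order_tendstoD(2)[OF this]
  have "\<exists>N. \<forall>n\<ge>N. \<forall>m\<ge>N. (\<integral>\<omega>. dist (X n \<omega>) (X m \<omega>) \<partial>?W) < (1/2)^k" for k :: nat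
    using cau[of "(1/2)^k"] unfolding eventually_prod_sequentially by fastforce
  then obtain N where N: "\<And>k n m. n \<ge> N k \<Longrightarrow> m \<ge> N k \<Longrightarrow> (\<integral>\<omega>. dist (X n \<omega>) (X m \<omega>) \<partial>?W) < (1/2)^k"
    by metis
  \<comment> \<open>Times with summable mean distances, each larger than all the thresholds up to it.\<close>
  define r where "r k = k + (\<Sum>i\<le>k. N i)" for k
  have rN: "r k \<ge> N k" "r (Suc k) \<ge> N k" "r k \<ge> k" for k
    using member_le_sum[of k "{..k}" N] by (auto simp: r_def)
  have small: "(\<integral>\<omega>. dist (X (r k) \<omega>) (X (r (Suc k)) \<omega>) \<partial>?W) < (1/2)^k" for k
    by (rule N) (auto simp: rN)
  have di: "integrable ?W (\<lambda>\<omega>. dist (X n \<omega>) (X m \<omega>))" for n m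
    by (rule W.integrable_const_bound[where B=2]) (auto simp: dist_fun_le_2)
  have "AE \<omega> in ?W. (\<Sum>k. ennreal (dist (X (r k) \<omega>) (X (r (Suc k)) \<omega>))) \<noteq> \<infinity>"
  proof (rule nn_integral_noteq_infinite)
    have "(\<integral>\<^sup>+\<omega>. (\<Sum>k. ennreal (dist (X (r k) \<omega>) (X (r (Suc k)) \<omega>))) \<partial>?W) =
        (\<Sum>k. \<integral>\<^sup>+\<omega>. ennreal (dist (X (r k) \<omega>) (X (r (Suc k)) \<omega>)) \<partial>?W)"
      by (rule nn_integral_suminf) measurable
    also have "\<dots> = (\<Sum>k. ennreal (\<integral>\<omega>. dist (X (r k) \<omega>) (X (r (Suc k)) \<omega>) \<partial>?W))"
      by (intro suminf_cong nn_integral_eq_integral di) simp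
    also have "\<dots> \<le> (\<Sum>k. ennreal ((1/2)^k))"
      using small by (intro suminf_le summableI ennreal_leI less_imp_le) auto
    also have "\<dots> = ennreal (\<Sum>k. (1/2)^k)"
      by (rule suminf_ennreal2) (auto simp: summable_geometric_iff)
    finally show "(\<integral>\<^sup>+\<omega>. (\<Sum>k. ennreal (dist (X (r k) \<omega>) (X (r (Suc k)) \<omega>))) \<partial>?W) \<noteq> \<infinity>"
      by (auto simp: top_unique)
  qed measurable
  then have conv: "AE \<omega> in ?W. convergent (\<lambda>k. X (r k) \<omega>)"
  proof eventually_elim
    case (elim \<omega>)
    then show ?case
      by (intro convergent_summable_dist summable_suminf_not_top) auto
  qed
  define Z where "Z \<omega> g = lim (\<lambda>k. X (r k) \<omega> g)" for \<omega> g
  have lim: "AE \<omega> in ?W. (\<lambda>k. X (r k) \<omega>) \<longlonglongrightarrow> Z \<omega>"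
    using conv
  proof eventually_elim
    case (elim \<omega>)
    then obtain l where l: "(\<lambda>k. X (r k) \<omega>) \<longlonglongrightarrow> l" by (auto simp: convergent_def)
    have "Z \<omega> = l"
      using tendsto_coordinate[OF l] by (auto simp: Z_def fun_eq_iff intro: limI)
    with l show ?case by simp
  qed
  have Zm[measurable]: "Z \<in> borel_measurable ?W"
    by (rule measurable_coordinatewise_then_product)
      (unfold Z_def, rule borel_measurable_lim_metric, rule Xg)
  have X0: "X n \<omega> 0 = 0" for n \<omega> using act0_in_F0 by (simp add: X_def F0_def)
  have ZF0: "Z \<omega> \<in> F0" for \<omega>
    by (simp add: F0_def Z_def X0)
  have Zt: "AE \<omega> in ?W. Z \<omega> \<in> tube C"
    using lim
  proof eventually_elim
    case (elim \<omega>)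
    show ?case
      by (rule closed_sequentially[OF closed_tube _ elim]) (simp add: X_def tube_act0[OF \<psi>t])
  qed
  \<comment> \<open>Translating \<open>X n\<close> by an independent step gives the law of \<open>X (Suc n)\<close>, which is close to
    \<open>X n\<close> in mean; hence the limit is stationary.\<close>
  define \<nu>' where "\<nu>' = distr ?W borel Z"
  interpret \<nu>': prob_space \<nu>' unfolding \<nu>'_def by (rule W.prob_space_distr) measurable
  have a\<nu>: "act0 \<gamma> \<in> measurable \<nu>' borel" for \<gamma> by (simp add: \<nu>'_def)
  have eq: "distr (measure_pmf p \<Otimes>\<^sub>M \<nu>') borel (\<lambda>(\<gamma>, \<phi>). act0 \<gamma> \<phi>) = \<nu>'"
  proof (rule finite_measure_eqI_lipschitz)
    fix F :: "('g \<Rightarrow> real) \<Rightarrow> real" and L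
    assume F: "L-lipschitz_on UNIV F" "\<And>x. \<bar>F x\<bar> \<le> 1"
    have cont: "continuous_on UNIV F" by (rule lipschitz_on_continuous_on[OF F(1)])
    have Fm[measurable]: "F \<in> borel_measurable borel"
      by (rule borel_measurable_continuous_onI[OF cont])
    have L: "L \<ge> 0" using F(1) by (simp add: lipschitz_on_def)
    have walkX: "(\<integral>\<omega>. F (act0 \<gamma> (X n \<omega>)) \<partial>?W) = (\<integral>x. F (act0 (\<gamma> + x) \<psi>) \<partial>walk p n)" for \<gamma> n
      using integral_walk_at[of "\<lambda>x. F (act0 (\<gamma> + x) \<psi>)" 1 n] F(2) by (simp add: X_def act0_add)
    have limF: "(\<lambda>k. \<integral>\<omega>. F (act0 \<gamma> (X (r k) \<omega>)) \<partial>?W) \<longlonglongrightarrow> (\<integral>\<omega>. F (act0 \<gamma> (Z \<omega>)) \<partial>?W)" for \<gamma>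
    proof (rule integral_dominated_convergence[where w="\<lambda>_. 1"])
      have c: "continuous_on UNIV (\<lambda>\<phi>. F (act0 \<gamma> \<phi>))"
        by (rule continuous_on_compose2[OF cont continuous_on_act0]) simp
      show "AE \<omega> in ?W. (\<lambda>k. F (act0 \<gamma> (X (r k) \<omega>))) \<longlonglongrightarrow> F (act0 \<gamma> (Z \<omega>))"
        using lim by eventually_elim (rule continuous_on_tendsto_compose[OF c], auto)
    qed (auto simp: F(2))
    have Gm: "(\<lambda>(\<gamma>, \<phi>). F (act0 \<gamma> \<phi>)) \<in> borel_measurable (measure_pmf p \<Otimes>\<^sub>M \<nu>')"
      by (rule measurable_pmf_pair) (simp add: \<nu>'_def)
    interpret Q: pair_prob_space "measure_pmf p" \<nu>'
      by (intro pair_prob_space.intro pair_sigma_finite.intro \<nu>'.prob_space_axioms measure_pmf.prob_space_axioms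
        prob_space_imp_sigma_finite)
    have Qi: "integrable (measure_pmf p \<Otimes>\<^sub>M \<nu>') (\<lambda>(\<gamma>, \<phi>). F (act0 \<gamma> \<phi>))"
      by (rule Q.P.integrable_const_bound[where B=1]) (use Gm F(2) in auto)
    have "(\<integral>\<phi>. F \<phi> \<partial>distr (measure_pmf p \<Otimes>\<^sub>M \<nu>') borel (\<lambda>(\<gamma>, \<phi>). act0 \<gamma> \<phi>)) =
        (\<integral>z. (\<lambda>(\<gamma>, \<phi>). F (act0 \<gamma> \<phi>)) z \<partial>(measure_pmf p \<Otimes>\<^sub>M \<nu>'))"
      by (subst integral_distr[OF measurable_pmf_pair[OF a\<nu>]]) (auto simp: case_prod_beta')
    also have "\<dots> = (\<integral>\<gamma>. \<integral>\<phi>. F (act0 \<gamma> \<phi>) \<partial>\<nu>' \<partial>p)"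
      using Q.integral_fst[OF Qi] by simp
    also have "\<dots> = (\<integral>\<gamma>. \<integral>\<omega>. F (act0 \<gamma> (Z \<omega>)) \<partial>?W \<partial>p)"
      unfolding \<nu>'_def by (subst integral_distr) auto
    finally have lhs: "(\<integral>\<phi>. F \<phi> \<partial>distr (measure_pmf p \<Otimes>\<^sub>M \<nu>') borel (\<lambda>(\<gamma>, \<phi>). act0 \<gamma> \<phi>)) =
      (\<integral>\<gamma>. \<integral>\<omega>. F (act0 \<gamma> (Z \<omega>)) \<partial>?W \<partial>p)" .
    have "(\<lambda>k. \<integral>\<gamma>. \<integral>\<omega>. F (act0 \<gamma> (X (r k) \<omega>)) \<partial>?W \<partial>p) \<longlonglongrightarrow> (\<integral>\<gamma>. \<integral>\<omega>. F (act0 \<gamma> (Z \<omega>)) \<partial>?W \<partial>p)"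
    proof (rule integral_dominated_convergence[where w="\<lambda>_. 1"])
      show "AE \<gamma> in p. norm (\<integral>\<omega>. F (act0 \<gamma> (X (r k) \<omega>)) \<partial>?W) \<le> 1" for k
        unfolding real_norm_def by (intro AE_I2 abs_integral_le_const[OF W.prob_space_axioms]) (auto simp: F(2))
    qed (auto simp: limF)
    moreover have "(\<integral>\<gamma>. \<integral>\<omega>. F (act0 \<gamma> (X (r k) \<omega>)) \<partial>?W \<partial>p) = (\<integral>\<omega>. F (X (Suc (r k)) \<omega>) \<partial>?W)" for k
    proof -
      have "(\<integral>\<gamma>. \<integral>\<omega>. F (act0 \<gamma> (X (r k) \<omega>)) \<partial>?W \<partial>p) = (\<integral>x. F (act0 x \<psi>) \<partial>walk p (Suc (r k)))"
        unfolding walkX by (rule integral_walk_Suc(1)[symmetric]) (rule integrable_pmf_bounded[OF F(2)])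
      also have "\<dots> = (\<integral>\<omega>. F (X (Suc (r k)) \<omega>) \<partial>?W)"
        unfolding X_def using F(2) by (subst integral_walk_at[where C=1]) auto
      finally show ?thesis .
    qed
    ultimately have A: "(\<lambda>k. \<integral>\<omega>. F (X (Suc (r k)) \<omega>) \<partial>?W) \<longlonglongrightarrow> (\<integral>\<gamma>. \<integral>\<omega>. F (act0 \<gamma> (Z \<omega>)) \<partial>?W \<partial>p)" by simp
    have act0X: "act0 0 (X n \<omega>) = X n \<omega>" "act0 0 (Z \<omega>) = Z \<omega>" for n \<omega>
      using act0_zero[OF ZF0] act0_zero[OF act0_in_F0] by (auto simp: X_def)
    have B: "(\<lambda>k. \<integral>\<omega>. F (X (r k) \<omega>) \<partial>?W) \<longlonglongrightarrow> (\<integral>\<omega>. F (Z \<omega>) \<partial>?W)"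
      using limF[of 0] by (simp add: act0X)
    have Fi: "integrable ?W (\<lambda>\<omega>. F (X n \<omega>))" for n
      by (rule W.integrable_const_bound[where B=1]) (auto simp: F(2))
    have "(\<lambda>k. (\<integral>\<omega>. F (X (Suc (r k)) \<omega>) \<partial>?W) - (\<integral>\<omega>. F (X (r k) \<omega>) \<partial>?W)) \<longlonglongrightarrow> 0"
    proof (rule Lim_null_comparison)
      show "(\<lambda>k. L * (1/2)^k) \<longlonglongrightarrow> 0"
        using tendsto_mult[OF tendsto_const[of L] LIMSEQ_realpow_zero[of "1/2"]] by simp
      show "\<forall>\<^sub>F k in sequentially. norm ((\<integral>\<omega>. F (X (Suc (r k)) \<omega>) \<partial>?W) - (\<integral>\<omega>. F (X (r k) \<omega>) \<partial>?W)) \<le> L * (1/2)^k"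
      proof (intro always_eventually allI)
        fix k
        have "\<bar>(\<integral>\<omega>. F (X (Suc (r k)) \<omega>) \<partial>?W) - (\<integral>\<omega>. F (X (r k) \<omega>) \<partial>?W)\<bar> =
            \<bar>\<integral>\<omega>. F (X (Suc (r k)) \<omega>) - F (X (r k) \<omega>) \<partial>?W\<bar>"
          using Fi by simp
        also have "\<dots> \<le> (\<integral>\<omega>. \<bar>F (X (Suc (r k)) \<omega>) - F (X (r k) \<omega>)\<bar> \<partial>?W)"
          by (rule integral_abs_bound)
        also have "\<dots> \<le> (\<integral>\<omega>. L * dist (X (Suc (r k)) \<omega>) (X (r k) \<omega>) \<partial>?W)"
          using Fi di lipschitz_onD[OF F(1)] by (intro integral_mono) (auto simp: dist_real_def)
        also have "\<dots> \<le> L * (1/2)^k"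
          using N[of k "Suc (r k)" "r k"] rN(1)[of k] L by (simp add: mult_left_mono)
        finally show "norm ((\<integral>\<omega>. F (X (Suc (r k)) \<omega>) \<partial>?W) - (\<integral>\<omega>. F (X (r k) \<omega>) \<partial>?W)) \<le> L * (1/2)^k"
          by simp
      qed
    qed
    from tendsto_add[OF this B] have "(\<lambda>k. \<integral>\<omega>. F (X (Suc (r k)) \<omega>) \<partial>?W) \<longlonglongrightarrow> (\<integral>\<omega>. F (Z \<omega>) \<partial>?W)"
      by simp
    then have "(\<integral>\<gamma>. \<integral>\<omega>. F (act0 \<gamma> (Z \<omega>)) \<partial>?W \<partial>p) = (\<integral>\<omega>. F (Z \<omega>) \<partial>?W)"
      using A LIMSEQ_unique by blast
    then show "(\<integral>\<phi>. F \<phi> \<partial>distr (measure_pmf p \<Otimes>\<^sub>M \<nu>') borel (\<lambda>(\<gamma>, \<phi>). act0 \<gamma> \<phi>)) = (\<integral>\<phi>. F \<phi> \<partial>\<nu>')"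
      unfolding lhs unfolding \<nu>'_def by (subst integral_distr) auto
  qed (use \<nu>'.prob_space_axioms prob_space_distr_action[OF \<nu>'.prob_space_axioms a\<nu>] in \<open>auto simp: \<nu>'_def\<close>)
  let ?RF = "restrict_space borel (F0 :: ('g \<Rightarrow> real) set)"
  have ZmF: "Z \<in> measurable ?W ?RF"
    by (intro measurable_restrict_space2 Zm) (simp add: ZF0)
  define \<nu> where "\<nu> = distr ?W ?RF Z"
  have F0b: "(F0 :: ('g \<Rightarrow> real) set) \<in> sets borel" by (rule borel_closed[OF closed_F0])
  have RFb: "A \<in> sets borel" if "A \<in> sets ?RF" for A
    using that F0b by (auto simp: sets_restrict_space)
  have m\<nu>: "measure \<nu> (A \<inter> F0) = measure \<nu>' A" if A: "A \<in> sets borel" for A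
  proof -
    have "A \<inter> F0 \<in> sets ?RF" using A by (auto simp: sets_restrict_space)
    then have "measure \<nu> (A \<inter> F0) = measure ?W (Z -` (A \<inter> F0) \<inter> space ?W)"
      unfolding \<nu>_def by (rule measure_distr[OF ZmF])
    also have "Z -` (A \<inter> F0) = Z -` A" using ZF0 by auto
    also have "measure ?W (Z -` A \<inter> space ?W) = measure \<nu>' A"
      unfolding \<nu>'_def by (rule measure_distr[OF Zm A, symmetric])
    finally show ?thesis .
  qed
  have "stationary p act0 \<nu>"
    unfolding stationary_def
  proof (intro conjI ballI)
    show "prob_space \<nu>" unfolding \<nu>_def by (rule W.prob_space_distr[OF ZmF])
    have "measurable_action act0 ?RF"
      by (rule measurable_action_act0) (auto simp: act0_in_F0)
    then show "measurable_action act0 \<nu>"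
      by (simp add: measurable_action_def \<nu>_def)
    fix A assume "A \<in> sets \<nu>"
    then have "A \<in> sets ?RF" by (simp add: \<nu>_def)
    from RFb[OF this] sets.sets_into_space[OF this]
    have A: "A \<in> sets borel" "A \<subseteq> F0" by (simp_all add: space_restrict_space)
    have sp: "space \<nu> = F0" "space \<nu>' = UNIV" by (simp_all add: \<nu>_def \<nu>'_def space_restrict_space)
    have "measure \<nu> A = measure \<nu>' A" using m\<nu>[OF A(1)] A(2) by (simp add: Int_absorb2)
    also have "\<dots> = (\<Sum>\<^sub>\<infinity>\<gamma>. pmf p \<gamma> * measure \<nu>' (act0 \<gamma> -` A \<inter> space \<nu>'))"
      using measure_distr_action[where a=act0 and p=p, OF \<nu>'.prob_space_axioms a\<nu> A(1)] unfolding eq .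
    also have "\<dots> = (\<Sum>\<^sub>\<infinity>\<gamma>. pmf p \<gamma> * measure \<nu> (act0 \<gamma> -` A \<inter> space \<nu>))"
    proof (intro infsum_cong arg_cong2[where f="(*)"] refl)
      fix \<gamma>
      have "act0 \<gamma> -` A \<in> sets borel" using measurable_sets[OF measurable_act0 A(1), of \<gamma>] by simp
      from m\<nu>[OF this] show "measure \<nu>' (act0 \<gamma> -` A \<inter> space \<nu>') = measure \<nu> (act0 \<gamma> -` A \<inter> space \<nu>)"
        by (simp add: sp)
    qed
    finally show "measure \<nu> A = (\<Sum>\<^sub>\<infinity>\<gamma>. pmf p \<gamma> * measure \<nu> (act0 \<gamma> -` A \<inter> space \<nu>))" .
  qed
  then have "stationary_on p F0 \<nu>"
    by (simp add: stationary_on_def \<nu>_def)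
  moreover have "AE \<phi> in \<nu>. \<phi> \<in> tube C"
  proof -
    have tubeset: "tube C \<in> sets ?RF"
      using tube_F0 by (auto simp: sets_restrict_space intro!: image_eqI[where x="tube C"] borel_closed closed_tube)
    then have "{x \<in> space ?RF. x \<in> tube C} = tube C"
      using sets.sets_into_space[OF tubeset] by auto
    then show ?thesis
      unfolding \<nu>_def using tubeset Zt by (subst AE_distr_iff[OF ZmF]) auto
  qed
  ultimately show ?thesis using that C by blast
qed

end

section \<open>The harmonic core as a boundary\<close>

text \<open>A closed subset of a Polish space, with the Borel structure, is standard.\<close>

lemma standard_borel_closed:
  fixes K :: "'a::polish_space set"
  assumes K: "closed K" and M: "sets M = sets (restrict_space borel K)"
  shows "standard_borel M"
proof -
  have sp: "space M = K"
    using sets_eq_imp_space_eq[OF M] by (simp add: space_restrict_space)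
  have c: "completely_metrizable_space (top_of_set K)"
    using K completely_metrizable_space_euclidean by (intro completely_metrizable_space_closedin) auto
  have "second_countable (euclidean :: 'a topology)"
  proof -
    obtain B :: "'a set set" where B: "countable B" "\<And>b. b \<in> B \<Longrightarrow> open b"
      "\<And>S. open S \<Longrightarrow> \<exists>U. U \<subseteq> B \<and> S = \<Union>U"
      using univ_second_countable by metis
    show ?thesis
      unfolding second_countable_def
    proof (intro exI[of _ B] conjI ballI allI impI)
      fix U :: "'a set" and x assume U: "openin euclidean U \<and> x \<in> U"
      then obtain V where "V \<subseteq> B" "U = \<Union>V" using B(3)[of U] by auto
      then show "\<exists>V\<in>B. x \<in> V \<and> V \<subseteq> U" using U by auto
    qed (use B in auto)
  qed
  then have s: "second_countable (top_of_set K)"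
    by (rule second_countable_subtopology)
  have "sets M = sigma_sets K {U. openin (top_of_set K) U}"
  proof -
    have "sets (restrict_space borel K) = sigma_sets K ((\<inter>) K ` {S. open S})"
      unfolding sets_restrict_space borel_def using borel_closed[OF K]
      by (subst sigma_sets_Int[symmetric]) (auto simp: borel_def)
    also have "(\<inter>) K ` {S. open S} = {U. openin (top_of_set K) U}"
      by (auto simp: openin_open)
    finally show ?thesis using M by simp
  qed
  then show ?thesis
    unfolding standard_borel_def using c s sp by (intro exI[of _ "top_of_set K"]) auto
qed

lemma Linf_space_iff:
  assumes M: "prob_space m"
  shows "f \<in> Linf_space m \<longleftrightarrow> f \<in> borel_measurable m \<and> (\<exists>C. AE x in m. \<bar>f x\<bar> \<le> C)"
proof (cases "f \<in> borel_measurable m")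
  case True
  have m: "(\<lambda>x. ereal \<bar>f x\<bar>) \<in> borel_measurable m" using True by measurable
  have "esssup m (\<lambda>x. ereal \<bar>f x\<bar>) < \<infinity> \<longleftrightarrow> (\<exists>C. AE x in m. \<bar>f x\<bar> \<le> C)"
  proof
    assume "esssup m (\<lambda>x. ereal \<bar>f x\<bar>) < \<infinity>"
    then obtain C where C: "esssup m (\<lambda>x. ereal \<bar>f x\<bar>) \<le> ereal C"
      by (cases "esssup m (\<lambda>x. ereal \<bar>f x\<bar>)") auto
    have "AE x in m. \<bar>f x\<bar> \<le> C"
      using esssup_AE[of "\<lambda>x. ereal \<bar>f x\<bar>" m]
    proof eventually_elim
      case (elim x)
      from order_trans[OF this C] show ?case by simp
    qed
    then show "\<exists>C. AE x in m. \<bar>f x\<bar> \<le> C" ..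
  next
    assume "\<exists>C. AE x in m. \<bar>f x\<bar> \<le> C"
    then obtain C where "AE x in m. \<bar>f x\<bar> \<le> C" ..
    then have "esssup m (\<lambda>x. ereal \<bar>f x\<bar>) \<le> ereal C"
      by (intro esssup_I m) auto
    then show "esssup m (\<lambda>x. ereal \<bar>f x\<bar>) < \<infinity>"
      by (rule le_less_trans) simp
  qed
  then show ?thesis using True by (simp add: Linf_space_def)
qed (simp add: Linf_space_def)

text \<open>The transform is isometric, so it controls essential bounds.\<close>

lemma poisson_boundary_AE_bound:
  assumes pb: "poisson_boundary p a m" and f: "f \<in> Linf_space m"
    and b: "\<And>\<gamma>. \<bar>poisson_transform a m f \<gamma>\<bar> \<le> C"
  shows "AE x in m. \<bar>f x\<bar> \<le> C"
proof -
  have "esssup m (\<lambda>x. ereal \<bar>f x\<bar>) = (SUP \<gamma>. ereal \<bar>poisson_transform a m f \<gamma>\<bar>)"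
    using pb f unfolding poisson_boundary_def by metis
  also have "\<dots> \<le> ereal C"
    using b by (intro SUP_least) simp
  finally have le: "esssup m (\<lambda>x. ereal \<bar>f x\<bar>) \<le> ereal C" .
  show ?thesis
    using esssup_AE[of "\<lambda>x. ereal \<bar>f x\<bar>" m]
  proof eventually_elim
    case (elim x)
    from order_trans[OF this le] show ?case by simp
  qed
qed

context qm_walk
begin

lemma exists_stationary_core:
  "\<exists>\<nu>. stationary_on p (harmonic_core p \<phi>o) \<nu>"
  and harmonic_core_subset_harmonic_set: "harmonic_core p \<phi>o \<subseteq> harmonic_set p \<phi>o"
proof -
  obtain \<nu> C where \<nu>: "stationary_on p F0 \<nu>" "C \<ge> 0" "AE \<phi> in \<nu>. \<phi> \<in> tube C"
    using exists_stationary_near by blast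
  note s = stationary_on_prob[OF \<nu>(1)]
  have m: "(\<lambda>x. x) \<in> measurable \<nu> (restrict_space borel F0)"
    using s(2) by (simp cong: measurable_cong_sets)
  show "\<exists>\<nu>. stationary_on p (harmonic_core p \<phi>o) \<nu>"
    by (rule factor_onto_core[OF s(4) m \<nu>(2)]) (use \<nu>(3) in auto)
  have "\<exists>\<nu>. stationary_on p (harmonic_set p \<phi>o) \<nu>"
    by (rule factor_onto_core[OF s(4) m \<nu>(2)]) (use \<nu>(3) in auto)
  then show "harmonic_core p \<phi>o \<subseteq> harmonic_set p \<phi>o"
    using stationary_measure_core(1) by blast
qed

lemma ex1_stationary_core: "\<exists>!\<nu>. stationary_on p (harmonic_core p \<phi>o) \<nu>"
  using exists_stationary_core harmonic_core_subset_harmonic_set stationary_unique by blast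

lemma stationary_core_measure: "stationary_on p (harmonic_core p \<phi>o) (core_measure p \<phi>o)"
  unfolding core_measure_def by (rule theI'[OF ex1_stationary_core])

lemma stationary_core_eq:
  "stationary_on p (harmonic_core p \<phi>o) \<nu> \<Longrightarrow> \<nu> = core_measure p \<phi>o"
  using ex1_stationary_core stationary_core_measure by blast

lemma stationary_harmonic_set_core:
  "stationary_on p (harmonic_set p \<phi>o) \<nu> \<Longrightarrow> measure \<nu> (harmonic_core p \<phi>o) = 1"
  by (rule stationary_measure_core(3)) auto

text \<open>A function fixed by the action is a homomorphism.\<close>

lemma nontrivial_core_measure:
  assumes "\<not> (\<exists>f. real_hom f \<and> bounded_distance \<phi>o f)"
  shows "\<not> trivial_boundary act0 (core_measure p \<phi>o)"
proof
  assume "trivial_boundary act0 (core_measure p \<phi>o)"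
  then obtain f where f: "f \<in> harmonic_core p \<phi>o" "\<And>\<gamma>. act0 \<gamma> f = f"
    using stationary_on_prob(3)[OF stationary_core_measure] by (auto simp: trivial_boundary_def)
  have "f (g + h) = f g + f h" for g h
    using fun_cong[OF f(2)[of h], of g] by (simp add: act0_def)
  then have "real_hom f" by (simp add: real_hom_def)
  moreover have "bounded_distance \<phi>o f"
  proof -
    have "f \<in> harmonic_set p \<phi>o"
      using f(1) harmonic_core_subset_harmonic_set by blast
    then obtain C where "near C f"
      unfolding harmonic_set_iff by blast
    then show ?thesis
      by (auto simp: bounded_distance_def bounded_iff near_def abs_minus_commute)
  qed
  ultimately show False using assms by blast
qed

text \<open>The orbit closure of \<open>\<phi>o\<close> lies in a tube, so its elements have harmonic corrections almost everywhere.\<close>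

lemma core_measure_factor:
  assumes st: "stationary_on p (orbit_closure \<phi>o) \<nu>"
  shows "\<exists>\<pi>. ae_factor_map act0 \<nu> act0 (core_measure p \<phi>o) \<pi>"
proof -
  note s = stationary_on_prob[OF st]
  interpret prob_space \<nu> by (rule s)
  have "\<phi>o \<in> F0" using zero by (simp add: F0_def)
  from near_imp_tube[OF near_self this] have "\<phi>o \<in> tube D" by simp
  then have sub: "orbit_closure \<phi>o \<subseteq> tube D"
    by (intro orbit_closure_subset tube_act0 closed_tube)
  have m: "(\<lambda>x. x) \<in> measurable \<nu> (restrict_space borel F0)"
  proof (rule measurable_restrict_space2)
    show "(\<lambda>x. x) \<in> space \<nu> \<rightarrow> F0" using orbit_closure_F0 s(3) by auto
    show "(\<lambda>x. x) \<in> \<nu> \<rightarrow>\<^sub>M borel"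
      using measurable_restrict_space1[of "\<lambda>x. x" borel borel] s(2) by (simp cong: measurable_cong_sets)
  qed
  have "AE x in \<nu>. x \<in> tube D"
    using sub s(3) by (auto intro!: AE_I2)
  then obtain B0 \<pi> where B: "B0 \<in> sets \<nu>" "measure \<nu> B0 = 1"
    "\<pi> \<in> measurable \<nu> (restrict_space borel (harmonic_core p \<phi>o))"
    "\<And>\<gamma> b. b \<in> B0 \<Longrightarrow> \<pi> (act0 \<gamma> b) = act0 \<gamma> (\<pi> b)"
    "stationary_on p (harmonic_core p \<phi>o) (distr \<nu> (restrict_space borel (harmonic_core p \<phi>o)) \<pi>)"
    by (rule factor_onto_core[OF s(4) m D_nonneg]) auto
  have sc: "sets (core_measure p \<phi>o) = sets (restrict_space borel (harmonic_core p \<phi>o))"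
    by (rule stationary_on_prob(2)[OF stationary_core_measure])
  have pm: "\<pi> \<in> measurable \<nu> (core_measure p \<phi>o)"
    using B(3) sc by (simp cong: measurable_cong_sets)
  have "distr \<nu> (core_measure p \<phi>o) \<pi> = core_measure p \<phi>o"
    using stationary_core_eq[OF B(5)] distr_cong[of \<nu> \<nu> "core_measure p \<phi>o" _ \<pi> \<pi>, OF refl sc] by simp
  moreover have "AE x in \<nu>. \<forall>\<gamma>. \<pi> (act0 \<gamma> x) = act0 \<gamma> (\<pi> x)"
  proof -
    have "AE x in \<nu>. x \<in> B0" using B(1,2) AE_in_set_eq_1 by blast
    then show ?thesis by eventually_elim (simp add: B(4))
  qed
  ultimately show ?thesis
    unfolding ae_factor_map_def using pm
    by (intro exI[of _ \<pi>]) (simp add: distr_completion measurable_completion)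
qed

text \<open>The coordinate \<open>g\<close> of the map from a Poisson boundary is the bounded function whose transform is
  \<open>y \<mapsto> \<psi> (g + y) - \<psi> y\<close>, for a right-harmonic \<open>\<psi>\<close> near \<open>\<phi>o\<close>. Equivariance and the distance to \<open>\<phi>o\<close> are
  read off from the transforms, because the transform is injective and isometric.\<close>

lemma Gp_boundary_core_measure: "Gp_boundary TYPE('b) p act0 (core_measure p \<phi>o)"
  unfolding Gp_boundary_def
proof (intro conjI allI impI)
  let ?K = "harmonic_core p \<phi>o"
  let ?cm = "core_measure p \<phi>o"
  note sc = stationary_on_prob[OF stationary_core_measure]
  show "standard_borel ?cm"
    by (rule standard_borel_closed[OF closed_harmonic_core sc(2)])
  show "measurable_action act0 ?cm"
    using sc(4) by (simp add: stationary_def)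
  fix m :: "'b measure" and a
  assume pb: "poisson_boundary p a m"
  then have st: "stationary p a m"
    and tr: "poisson_transform a m ` Linf_space m = bounded_right_harmonic p"
    by (auto simp: poisson_boundary_def)
  have m: "prob_space m" and act: "measurable_action a m"
    using st by (auto simp: stationary_def)
  interpret m: prob_space m by fact
  have am[measurable]: "a \<gamma> \<in> measurable m m" for \<gamma>
    using act by (simp add: measurable_action_def)
  have transl: "AE x in m. P (a \<gamma> x)" if "AE x in m. P x" for P \<gamma>
    by (rule stationary_AE_translate[OF st sym gen that])
  have int: "integrable m (\<lambda>b. f (a \<delta> b))" if f: "f \<in> Linf_space m" for f \<delta>
  proof -
    obtain C where C: "AE x in m. \<bar>f x\<bar> \<le> C" and [measurable]: "f \<in> borel_measurable m"
      using f by (auto simp: Linf_space_iff[OF m])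
    from transl[OF C, of \<delta>] show ?thesis
      by (intro m.integrable_const_bound[where B=C]) auto
  qed
  obtain \<psi> C0 where \<psi>: "\<psi> \<in> F0" "near C0 \<psi>" "\<And>g. (\<integral>x. \<psi> (g + x) \<partial>p) = \<psi> g"
    using exists_right_harmonic by blast
  define C where "C = 2 * C0 + D"
  have C: "C \<ge> 0" using nearD[OF \<psi>(2), of 0] D_nonneg by (simp add: C_def)
  have \<psi>t: "\<psi> \<in> tube C" unfolding C_def by (rule near_imp_tube[OF \<psi>(2,1)])
  \<comment> \<open>The coordinate \<open>g\<close> of the translate of \<open>\<psi>\<close> by \<open>y\<close>.\<close>
  define h where "h g y = \<psi> (g + y) - \<psi> y" for g y
  have hC: "\<bar>h g y - \<phi>o g\<bar> \<le> C" for g y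
    using nearD[OF tube_near[OF tube_act0[OF \<psi>t, of y]], of g] by (simp add: act0_def h_def)
  have hh: "(\<integral>x. h g (y + x) \<partial>p) = h g y" for g y
    using integrable_translate(3)[OF integrable_p \<psi>(2), of "g + y"]
      integrable_translate(3)[OF integrable_p \<psi>(2), of y] \<psi>(3)[of "g + y"] \<psi>(3)[of y]
    by (simp add: h_def add.assoc)
  have "h g \<in> bounded_right_harmonic p" for g
  proof -
    have "\<bar>h g y\<bar> \<le> C + \<bar>\<phi>o g\<bar>" for y using hC[of g y] by linarith
    then show ?thesis
      by (auto simp: bounded_right_harmonic_def bounded_iff fun_eq_iff conv_right hh)
  qed
  \<comment> \<open>The choice at \<open>g = 0\<close> makes all the functions \<open>\<lambda>g. F g b\<close> vanish at \<open>0\<close>, not only almost all.\<close>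
  then have "\<exists>f. f \<in> Linf_space m \<and> poisson_transform a m f = h g \<and> (g = 0 \<longrightarrow> f = (\<lambda>_. 0))" for g
  proof (cases "g = 0")
    case True
    then show ?thesis
      by (auto simp: Linf_space_iff[OF m] poisson_transform_def h_def fun_eq_iff intro!: exI[of _ "\<lambda>_. 0"] exI[of _ 0])
  next
    case False
    then show ?thesis
      using \<open>h g \<in> bounded_right_harmonic p\<close> unfolding tr[symmetric] by auto
  qed
  then obtain F where F: "\<And>g. F g \<in> Linf_space m" "\<And>g. poisson_transform a m (F g) = h g" "F 0 = (\<lambda>_. 0)"
    by metis
  have Fm[measurable]: "F g \<in> borel_measurable m" for g
    using F(1) by (simp add: Linf_space_iff[OF m])
  have Fint: "(\<integral>b. F g (a \<delta> b) \<partial>m) = h g \<delta>" for g \<delta>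
    using fun_cong[OF F(2), of g \<delta>] by (simp add: poisson_transform_def)
  define \<Phi> where "\<Phi> b g = F g b" for b g
  have \<Phi>F0: "\<Phi> b \<in> F0" for b by (simp add: \<Phi>_def F0_def F(3))
  have "\<Phi> \<in> borel_measurable m"
    by (rule measurable_coordinatewise_then_product) (simp add: \<Phi>_def)
  then have \<Phi>m: "\<Phi> \<in> measurable m (restrict_space borel F0)"
    by (intro measurable_restrict_space2) (auto simp: \<Phi>F0)
  have "AE b in m. \<bar>F g b - \<phi>o g\<bar> \<le> C" for g
  proof (rule poisson_boundary_AE_bound[OF pb])
    obtain B where "AE x in m. \<bar>F g x\<bar> \<le> B"
      using F(1)[of g] by (auto simp: Linf_space_iff[OF m])
    then have "AE x in m. \<bar>F g x - \<phi>o g\<bar> \<le> B + \<bar>\<phi>o g\<bar>"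
      by eventually_elim linarith
    then show "(\<lambda>b. F g b - \<phi>o g) \<in> Linf_space m"
      by (auto simp: Linf_space_iff[OF m])
    have "poisson_transform a m (\<lambda>b. F g b - \<phi>o g) \<gamma> = h g \<gamma> - \<phi>o g" for \<gamma>
      using int[OF F(1)] Fint by (simp add: poisson_transform_def m.prob_space)
    then show "\<bar>poisson_transform a m (\<lambda>b. F g b - \<phi>o g) \<gamma>\<bar> \<le> C" for \<gamma>
      using hC by simp
  qed
  then have "AE b in m. \<forall>g. \<bar>F g b - \<phi>o g\<bar> \<le> C"
    by (subst AE_all_countable) simp
  then have tube: "AE b in m. \<Phi> b \<in> tube (2 * C + D)"
    by eventually_elim (auto intro!: near_imp_tube \<Phi>F0 simp: near_def \<Phi>_def)
  have eqv: "AE b in m. F g (a \<gamma> b) = F (g + \<gamma>) b - F \<gamma> b" for g \<gamma>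
  proof -
    have ex: "\<exists>B. AE x in m. \<bar>F g' x\<bar> \<le> B" for g'
      using F(1)[of g'] unfolding Linf_space_iff[OF m] by blast
    obtain B1 B2 B3 where B: "AE x in m. \<bar>F g x\<bar> \<le> B1" "AE x in m. \<bar>F (g + \<gamma>) x\<bar> \<le> B2" "AE x in m. \<bar>F \<gamma> x\<bar> \<le> B3"
      using ex[of g] ex[of "g + \<gamma>"] ex[of \<gamma>] by blast
    define f where "f b = F g (a \<gamma> b) - F (g + \<gamma>) b + F \<gamma> b" for b
    have "AE x in m. \<bar>f x\<bar> \<le> B1 + B2 + B3"
      using transl[OF B(1), of \<gamma>] B(2,3) by eventually_elim (auto simp: f_def)
    then have fL: "f \<in> Linf_space m"
      by (auto simp: Linf_space_iff[OF m] f_def[abs_def])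
    have "poisson_transform a m f \<delta> = 0" for \<delta>
    proof -
      have e: "(\<integral>b. F g (a \<gamma> (a \<delta> b)) \<partial>m) = (\<integral>b. F g (a (\<gamma> + \<delta>) b) \<partial>m)"
        using act by (intro Bochner_Integration.integral_cong) (auto simp: measurable_action_def)
      have i: "integrable m (\<lambda>b. F g (a \<gamma> (a \<delta> b)))"
      proof -
        have "integrable m (\<lambda>b. F g (a (\<gamma> + \<delta>) b))" by (rule int[OF F(1)])
        then show ?thesis
          by (rule Bochner_Integration.integrable_cong[THEN iffD1, rotated 2])
            (use act in \<open>auto simp: measurable_action_def\<close>)
      qed
      have "poisson_transform a m f \<delta> = h g (\<gamma> + \<delta>) - h (g + \<gamma>) \<delta> + h \<gamma> \<delta>"
        unfolding poisson_transform_def f_def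
        using i int[OF F(1)] by (simp add: e Fint)
      then show ?thesis by (simp add: h_def add.assoc)
    qed
    then have "AE b in m. \<bar>f b\<bar> \<le> 0"
      by (intro poisson_boundary_AE_bound[OF pb fL]) simp
    then show ?thesis by eventually_elim (simp add: f_def)
  qed
  have "AE b in m. \<forall>\<gamma> g. F g (a \<gamma> b) = F (g + \<gamma>) b - F \<gamma> b"
    by (subst AE_all_countable, rule allI, subst AE_all_countable, rule allI, rule eqv)
  then have equiv: "AE b in m. \<forall>\<gamma>. \<Phi> (a \<gamma> b) = act0 \<gamma> (\<Phi> b)"
    by eventually_elim (simp add: \<Phi>_def act0_def fun_eq_iff)
  have C': "2 * C + D \<ge> 0" using C D_nonneg by simp
  obtain B0 \<pi> where B: "B0 \<in> sets m" "measure m B0 = 1" "\<And>\<gamma> b. b \<in> B0 \<Longrightarrow> a \<gamma> b \<in> B0"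
    "\<pi> \<in> measurable m (restrict_space borel ?K)"
    "\<And>\<gamma> b. b \<in> B0 \<Longrightarrow> \<pi> (a \<gamma> b) = act0 \<gamma> (\<pi> b)"
    "stationary_on p ?K (distr m (restrict_space borel ?K) \<pi>)"
    by (rule factor_onto_core[OF st \<Phi>m C' tube equiv]) blast
  have pm: "\<pi> \<in> measurable m ?cm"
    using B(4) sc(2) by (simp cong: measurable_cong_sets)
  have d: "distr m ?cm \<pi> = ?cm"
    using stationary_core_eq[OF B(6)] distr_cong[of m m ?cm _ \<pi> \<pi>, OF refl sc(2)] by simp
  have pr: "\<pi> \<in> measurable (restrict_space m B0) ?cm"
    by (rule measurable_restrict_space1[OF pm])
  have "distr (restrict_space m B0) ?cm \<pi> = distr m ?cm \<pi>"
  proof (rule measure_eqI)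
    fix A assume "A \<in> sets (distr (restrict_space m B0) ?cm \<pi>)"
    then have A: "A \<in> sets ?cm" by simp
    have "emeasure (distr (restrict_space m B0) ?cm \<pi>) A = emeasure (restrict_space m B0) (\<pi> -` A \<inter> space (restrict_space m B0))"
      by (rule emeasure_distr[OF pr A])
    also have "\<dots> = emeasure m (\<pi> -` A \<inter> space (restrict_space m B0))"
      by (rule emeasure_restrict_space) (use B(1) in \<open>auto simp: space_restrict_space\<close>)
    also have "\<dots> = emeasure m (\<pi> -` A \<inter> space m)"
    proof (rule emeasure_eq_AE)
      have "AE b in m. b \<in> B0" using B(1,2) m.AE_in_set_eq_1 by blast
      then show "AE b in m. (b \<in> \<pi> -` A \<inter> space (restrict_space m B0)) = (b \<in> \<pi> -` A \<inter> space m)"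
        by eventually_elim (auto simp: space_restrict_space)
      have "\<pi> -` A \<inter> space m \<in> sets m" by (rule measurable_sets[OF pm A])
      moreover have "\<pi> -` A \<inter> space (restrict_space m B0) = (\<pi> -` A \<inter> space m) \<inter> B0"
        by (auto simp: space_restrict_space)
      ultimately show "\<pi> -` A \<inter> space (restrict_space m B0) \<in> sets m" "\<pi> -` A \<inter> space m \<in> sets m"
        using B(1) by auto
    qed
    also have "\<dots> = emeasure (distr m ?cm \<pi>) A"
      by (rule emeasure_distr[OF pm A, symmetric])
    finally show "emeasure (distr (restrict_space m B0) ?cm \<pi>) A = emeasure (distr m ?cm \<pi>) A" .
  qed simp
  with d B(1,2,3,5) pr show "\<exists>B0 \<pi>. B0 \<in> sets m \<and> measure m B0 = 1 \<and> (\<forall>\<gamma>. \<forall>b\<in>B0. a \<gamma> b \<in> B0) \<and>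
      \<pi> \<in> measurable (restrict_space m B0) ?cm \<and> (\<forall>\<gamma>. \<forall>b\<in>B0. \<pi> (a \<gamma> b) = act0 \<gamma> (\<pi> b)) \<and>
      distr (restrict_space m B0) ?cm \<pi> = ?cm"
    by (intro exI[of _ B0] exI[of _ \<pi>]) simp
qed

end

lemma integrable_of_p_integrable:
  fixes p :: "'g::countable pmf"
  assumes "p_integrable p \<phi>"
  shows "integrable p \<phi>"
proof -
  have "Infinite_Set_Sum.abs_summable_on (\<lambda>g. pmf p g * \<bar>\<phi> g\<bar>) UNIV"
    using assms
    unfolding p_integrable_def summable_on_iff_abs_summable_on_real[of "\<lambda>x. pmf p x * \<bar>\<phi> x\<bar>"]
      abs_summable_equivalent .
  then have "integrable (count_space UNIV) (\<lambda>g. pmf p g * \<phi> g)"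
    unfolding Infinite_Set_Sum.abs_summable_on_def
    by (rule Bochner_Integration.integrable_bound) (auto simp: abs_mult)
  then show ?thesis
    by (subst measure_pmf_eq_density) (simp add: integrable_density)
qed

theorem theorem1p12:
  fixes \<phi>o :: "'g::{group_add, countable} \<Rightarrow> real" and p :: "'g pmf"
  assumes "quasimorphism \<phi>o" and "\<phi>o 0 = 0"
    and "symmetric_pmf p" and "generates_group (set_pmf p)" and "p_integrable p \<phi>o"
    and "\<not> (\<exists>f. real_hom f \<and> bounded_distance \<phi>o f)"
  shows "(\<forall>\<nu>. stationary_on p (harmonic_set p \<phi>o) \<nu> \<longrightarrow> measure \<nu> (harmonic_core p \<phi>o) = 1) \<and>
         (\<exists>!\<nu>. stationary_on p (harmonic_core p \<phi>o) \<nu>) \<and>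
         (Gp_boundary TYPE('b) p act0 (core_measure p \<phi>o) \<and>
          \<not> trivial_boundary act0 (core_measure p \<phi>o)) \<and>
         (\<forall>\<nu>. stationary_on p (orbit_closure \<phi>o) \<nu> \<longrightarrow>
            (\<exists>\<pi>. ae_factor_map act0 \<nu> act0 (core_measure p \<phi>o) \<pi>))"
proof -
  obtain D where D: "\<And>g h. \<bar>\<phi>o (g + h) - \<phi>o g - \<phi>o h\<bar> \<le> D"
    using assms(1) by (auto simp: quasimorphism_def bdd_above_def)
  interpret qm_walk p \<phi>o D
    by unfold_locales (use assms D integrable_of_p_integrable in auto)
  show ?thesis
    using stationary_harmonic_set_core ex1_stationary_core Gp_boundary_core_measure
      nontrivial_core_measure[OF assms(6)] core_measure_factor by blast
qed

end
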